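(* Let $n>2$. For a real symmetric $(n-1)\times(n-1)$ matrix $S=(S_{j,k})$, let $M^S\subset\mathbb{C}^{n+1}$ be the hypersurface $$x_0=\sum_{0<j<j+k\leq n}S_{j,k}\,x_jx_kx_n^{n-j-k}.$$ Then $M^S$ is uniformly $2$-nondegenerate with a rank $1$ Levi kernel if and only if it is equivalent to a hypersurface $M^{S'}$ with $S'$ of the block anti-diagonal form $$S'=\begin{pmatrix}0&\cdots&\cdots&0&S_{n_\mu}\\ \vdots& & &S_{n_{\mu-1}}&0\\ \vdots& & & &\vdots\\ 0&S_{n_2}& & &\vdots\\ S_{n_1}&0&\cdots&\cdots&0\end{pmatrix}$$ for some positive integers $n_1,\dots,n_\mu$ with $n_1+\cdots+n_\mu=n-1$ and $n_j=n_{\mu+1-j}$ for all $j$. In particular, the hypersurfaces $M^S$ comprise, up to local equivalence, at most $2^p-1$ uniformly $2$-nondegenerate hypersurfaces in $\mathbb{C}^{n+1}$ having rank $1$ Levi kernels, where $p=\left\lceil\tfrac{n-2}{2}\right\rceil$.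
   Context: Coordinates on $\mathbb{C}^{n+1}$ are $z=(z_0,\dots,z_n)$ with $z_j=x_j+iy_j$. The sum runs over all ordered pairs of positive integers $(j,k)$ with $j+k\le n$. For a positive integer $l$, $S_l$ denotes the $l\times l$ matrix whose $(j,k)$ entry is $1$ if $j+k\le l+1$ and $0$ otherwise. The matrix $S'$ has blocks $S_{n_1},S_{n_2},\dots,S_{n_\mu}$ along its block anti-diagonal, from bottom left to top right, and zeros elsewhere. Equivalent means locally equivalent at the origin: there is a local biholomorphism of $\mathbb{C}^{n+1}$ fixing the origin and mapping a neighborhood of $0$ in one hypersurface onto a neighborhood of $0$ in the other. For a real hypersurface $M$ with holomorphic tangent bundle $H=T^{1,0}M$, let $K\subset H$ be the kernel of the Levi form. When $K$ has constant rank, for $v\in K_q$ let $\mathrm{ad}_v:H_q/K_q\to H_q/K_q$ be the antilinear map $\mathrm{ad}_v(X_q+K_q)=[V,\overline X]_q\pmod{\overline H\oplus K}$, where $V\in\Gamma(K)$, $V_q=v$, $X\in\Gamma(H)$ (using $(H\oplus\overline H)/(\overline H\oplus K)\cong H/K$). $M$ is uniformly $2$-nondegenerate if at every point $q$ the map $v\mapsto\mathrm{ad}_v$ is injective on $K_q$.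
   Formalization: The case n_1 = ... = n_μ = 1 is excluded: there M^{S'} is x_0 = Σ x_j x_{n-j}, which does not involve z_n, so its rank 1 Levi kernel is spanned by ∂/∂z_n with ad = 0 and it is not 2-nondegenerate; the bound 2^p - 1 already excludes it. *)

theory Defs
  imports "HOL-Analysis.Analysis"
begin

text \<open>Only used for open \<open>U\<close>: \<open>f\<close> is of class \<open>C\<^sup>k\<close> on \<open>U\<close>.\<close>
primrec Ck_on :: "nat \<Rightarrow> ('a::real_normed_vector \<Rightarrow> 'b::real_normed_vector) \<Rightarrow> 'a set \<Rightarrow> bool"
  where
    "Ck_on 0 f U \<longleftrightarrow> continuous_on U f"
  | "Ck_on (Suc k) f U \<longleftrightarrow>
       f differentiable_on U \<and> (\<forall>v. Ck_on k (\<lambda>x. frechet_derivative f (at x) v) U)"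

definition Cinf_on :: "('a::real_normed_vector \<Rightarrow> 'b::real_normed_vector) \<Rightarrow> 'a set \<Rightarrow> bool"
  where "Cinf_on f U \<longleftrightarrow> (\<forall>k. Ck_on k f U)"

definition holomorphic_map_on :: "(complex^'m \<Rightarrow> complex^'m) \<Rightarrow> (complex^'m) set \<Rightarrow> bool"
  where "holomorphic_map_on F U \<longleftrightarrow>
    (\<forall>z\<in>U. \<exists>D. (F has_derivative D) (at z) \<and> (\<forall>c v. D (c *s v) = c *s D v))"

definition locally_equivalent :: "(complex^'m) set \<Rightarrow> (complex^'m) set \<Rightarrow> bool"
  where "locally_equivalent M M' \<longleftrightarrow>
    (\<exists>F G U V. open U \<and> open V \<and> 0 \<in> U \<and> 0 \<in> V \<and> F 0 = 0 \<and>
       holomorphic_map_on F U \<and> holomorphic_map_on G V \<and> F ` U = V \<and> G ` V = U \<and>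
       (\<forall>z\<in>U. G (F z) = z) \<and> (\<forall>w\<in>V. F (G w) = w) \<and>
       F ` (M \<inter> U) = M' \<inter> V)"

text \<open>
  A complexified tangent vector of \<open>\<complex>\<^sup>m\<close> is written as a pair \<open>(a, b)\<close>, which stands
  for \<open>\<Sum>j. a\<^sub>j \<partial>/\<partial>z\<^sub>j + b\<^sub>j \<partial>/\<partial>cnj z\<^sub>j\<close>.  A real tangent vector \<open>u\<close> is thus the pair
  \<open>(u, cnj_vec u)\<close>, and the \<open>(1,0)\<close>-vectors are the pairs \<open>(a, 0)\<close>, which are also
  identified with \<open>a\<close> itself.
\<close>

definition cnj_vec :: "complex^'m \<Rightarrow> complex^'m"
  where "cnj_vec a = (\<chi> j. cnj (a $ j))"

text \<open>
  Velocities of curves in \<open>M\<close>.  For an embedded \<open>C\<^sup>1\<close> submanifold \<open>M\<close>, differentiability of the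
  curve at the single time \<open>0\<close> already yields the usual tangent space.
\<close>
definition tangent_space :: "'a::real_normed_vector set \<Rightarrow> 'a \<Rightarrow> 'a set"
  where "tangent_space M q =
    {u. \<exists>\<gamma>. \<gamma> 0 = q \<and> (\<forall>t. \<gamma> t \<in> M) \<and> (\<gamma> has_vector_derivative u) (at (0::real))}"

definition complexified_tangent :: "(complex^'m) set \<Rightarrow> complex^'m \<Rightarrow> ((complex^'m) \<times> (complex^'m)) set"
  where "complexified_tangent M q =
    {(u + \<i> *s w, cnj_vec u + \<i> *s cnj_vec w) | u w. u \<in> tangent_space M q \<and> w \<in> tangent_space M q}"

text \<open>The fibre \<open>H\<^sub>q\<close> of the holomorphic tangent bundle \<open>T\<^sup>1\<^sup>,\<^sup>0M\<close>.\<close>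
definition hol_tangent :: "(complex^'m) set \<Rightarrow> complex^'m \<Rightarrow> (complex^'m) set"
  where "hol_tangent M q = {a. (a, 0) \<in> complexified_tangent M q}"

text \<open>
  The derivative of \<open>f\<close> along \<open>(a, b)\<close>: if \<open>(a, b) = u + \<i>w\<close> with \<open>u\<close>, \<open>w\<close> real tangent vectors,
  then \<open>u = (a + cnj b)/2\<close> and \<open>w = (a - cnj b)/(2\<i>)\<close>, and the result is \<open>df(u) + \<i> df(w)\<close>.
\<close>
definition cderiv :: "(complex^'m) \<times> (complex^'m) \<Rightarrow> (complex^'m \<Rightarrow> complex^'k) \<Rightarrow> complex^'m \<Rightarrow> complex^'k"
  where "cderiv v f q =
    frechet_derivative f (at q) ((1/2) *s (fst v + cnj_vec (snd v))) +
    \<i> *s frechet_derivative f (at q) ((1/(2*\<i>)) *s (fst v - cnj_vec (snd v)))"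

text \<open>
  The Lie bracket of complex vector fields.  If \<open>Z\<close> and \<open>W\<close> are tangent to \<open>M\<close> along \<open>M\<close>, its
  value at a point of \<open>M\<close> depends only on their restrictions to \<open>M\<close>.
\<close>
definition lie_bracket ::
    "(complex^'m \<Rightarrow> (complex^'m) \<times> (complex^'m)) \<Rightarrow> (complex^'m \<Rightarrow> (complex^'m) \<times> (complex^'m)) \<Rightarrow>
     complex^'m \<Rightarrow> (complex^'m) \<times> (complex^'m)"
  where "lie_bracket Z W q =
    (cderiv (Z q) (\<lambda>p. fst (W p)) q - cderiv (W q) (\<lambda>p. fst (Z p)) q,
     cderiv (Z q) (\<lambda>p. snd (W p)) q - cderiv (W q) (\<lambda>p. snd (Z p)) q)"

text \<open>\<open>[X, cnj Y]\<close> for fields \<open>X\<close>, \<open>Y\<close> of \<open>(1,0)\<close>-vectors\<close>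
definition bracket_bar ::
    "(complex^'m \<Rightarrow> complex^'m) \<Rightarrow> (complex^'m \<Rightarrow> complex^'m) \<Rightarrow> complex^'m \<Rightarrow> (complex^'m) \<times> (complex^'m)"
  where "bracket_bar X Y = lie_bracket (\<lambda>p. (X p, 0)) (\<lambda>p. (0, cnj_vec (Y p)))"

text \<open>
  Smooth sections near \<open>q\<close> of a family \<open>B\<close> of subspaces along \<open>M\<close>, given by a smooth extension to
  a neighbourhood of \<open>q\<close> in the ambient space.
\<close>
definition local_section ::
    "(complex^'m) set \<Rightarrow> (complex^'m \<Rightarrow> (complex^'m) set) \<Rightarrow> complex^'m \<Rightarrow> (complex^'m \<Rightarrow> complex^'m) \<Rightarrow> bool"
  where "local_section M B q X \<longleftrightarrow>
    (\<exists>U. open U \<and> q \<in> U \<and> Cinf_on X U \<and> (\<forall>p\<in>M \<inter> U. X p \<in> B p))"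

text \<open>
  The Levi form \<open>(x, y) \<mapsto> \<i>[X, cnj Y]\<^sub>q\<close> modulo \<open>H \<oplus> cnj H\<close>; its value is a coset, and
  \<open>hol_tangent M q \<times> cnj_vec ` hol_tangent M q\<close> is \<open>H\<^sub>q \<oplus> cnj H\<^sub>q\<close>, the zero coset.
\<close>
definition levi_form ::
    "(complex^'m) set \<Rightarrow> complex^'m \<Rightarrow> complex^'m \<Rightarrow> complex^'m \<Rightarrow> ((complex^'m) \<times> (complex^'m)) set"
  where "levi_form M q x y =
    {(a, b). \<exists>X Y. local_section M (hol_tangent M) q X \<and> local_section M (hol_tangent M) q Y \<and>
       X q = x \<and> Y q = y \<and>
       (a - \<i> *s fst (bracket_bar X Y q), b - \<i> *s snd (bracket_bar X Y q))
         \<in> hol_tangent M q \<times> cnj_vec ` hol_tangent M q}"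

definition levi_kernel :: "(complex^'m) set \<Rightarrow> complex^'m \<Rightarrow> (complex^'m) set"
  where "levi_kernel M q =
    {v \<in> hol_tangent M q. \<forall>y\<in>hol_tangent M q.
       levi_form M q v y = hol_tangent M q \<times> cnj_vec ` hol_tangent M q}"

definition levi_kernel_rank :: "(complex^'m) set \<Rightarrow> nat \<Rightarrow> bool"
  where "levi_kernel_rank M r \<longleftrightarrow> (\<forall>q\<in>M. vec.dim (levi_kernel M q) = r)"

text \<open>The quotient \<open>H\<^sub>q/K\<^sub>q\<close> as a set of cosets\<close>
definition hol_quotient :: "(complex^'m) set \<Rightarrow> complex^'m \<Rightarrow> (complex^'m) set set"
  where "hol_quotient M q = (\<lambda>x. (+) x ` levi_kernel M q) ` hol_tangent M q"

text \<open>
  \<open>ad M q v\<close> maps the coset \<open>C\<close> of \<open>X\<^sub>q\<close> in \<open>H\<^sub>q/K\<^sub>q\<close> to the coset of those \<open>w \<in> H\<^sub>q\<close> that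
  represent \<open>[V, cnj X]\<^sub>q\<close> modulo \<open>cnj H\<^sub>q \<oplus> K\<^sub>q\<close>.
\<close>
definition ad :: "(complex^'m) set \<Rightarrow> complex^'m \<Rightarrow> complex^'m \<Rightarrow> (complex^'m) set \<Rightarrow> (complex^'m) set"
  where "ad M q v C =
    {w \<in> hol_tangent M q. \<exists>V X. local_section M (levi_kernel M) q V \<and> V q = v \<and>
       local_section M (hol_tangent M) q X \<and> X q \<in> C \<and>
       bracket_bar V X q - (w, 0) \<in> levi_kernel M q \<times> cnj_vec ` hol_tangent M q}"

definition uniformly_2_nondegenerate :: "(complex^'m) set \<Rightarrow> bool"
  where "uniformly_2_nondegenerate M \<longleftrightarrow>
    (\<exists>r. levi_kernel_rank M r) \<and>
    (\<forall>q\<in>M. inj_on (\<lambda>v. restrict (ad M q v) (hol_quotient M q)) (levi_kernel M q))"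

text \<open>
  Matrices of size \<open>n - 1\<close> are functions of two indices from \<open>{1..n - 1}\<close>, and the coordinates
  \<open>z\<^sub>0, \<dots>, z\<^sub>n\<close> on \<open>\<complex>\<^sup>n\<^sup>+\<^sup>1\<close> are \<open>z $ e 0, \<dots>, z $ e n\<close> for an enumeration \<open>e\<close> of the index type.
\<close>

definition symmetric_matrix :: "nat \<Rightarrow> (nat \<Rightarrow> nat \<Rightarrow> real) \<Rightarrow> bool"
  where "symmetric_matrix n S \<longleftrightarrow> (\<forall>j\<in>{1..n - 1}. \<forall>k\<in>{1..n - 1}. S j k = S k j)"

definition hypersurface ::
    "(nat \<Rightarrow> 'm) \<Rightarrow> nat \<Rightarrow> (nat \<Rightarrow> nat \<Rightarrow> real) \<Rightarrow> (complex^'m) set"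
  where "hypersurface e n S =
    {z. Re (z $ e 0) =
        (\<Sum>(j, k) \<in> {(j, k). 0 < j \<and> 0 < k \<and> j + k \<le> n}.
           S j k * Re (z $ e j) * Re (z $ e k) * Re (z $ e n) ^ (n - j - k))}"

definition triangular_block :: "nat \<Rightarrow> nat \<Rightarrow> nat \<Rightarrow> real"
  where "triangular_block l j k = (if j + k \<le> l + 1 then 1 else 0)"

text \<open>
  The block anti-diagonal matrix of the blocks \<open>triangular_block (ns ! i)\<close>, the first one at the
  bottom left: block \<open>i\<close> lies below the \<open>r\<close> rows of the blocks after it and to the right of the
  \<open>c\<close> columns of the blocks before it.  Its lower right entries vanish anyway for positive
  \<open>j - r\<close> and \<open>k - c\<close>, so no upper bounds on \<open>j\<close> and \<open>k\<close> are needed.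

  If all blocks have size one, the resulting hypersurface does not involve \<open>z\<^sub>n\<close>.  It then has
  a rank \<open>1\<close> Levi kernel spanned by \<open>\<partial>/\<partial>z\<^sub>n\<close> on which \<open>ad\<close> vanishes, so it is not
  \<open>2\<close>-nondegenerate.
\<close>
definition block_antidiagonal :: "nat list \<Rightarrow> nat \<Rightarrow> nat \<Rightarrow> real"
  where "block_antidiagonal ns j k =
    (\<Sum>i<length ns. let r = sum_list (drop (Suc i) ns); c = sum_list (take i ns) in
       if r < j \<and> c < k then triangular_block (ns ! i) (j - r) (k - c) else 0)"

end

theory Submission
  imports Defs "HOL-Complex_Analysis.Cauchy_Integral_Formula"
begin

text \<open>
  Write the equation of \<open>M\<^sup>S\<close> as \<open>x\<^sub>0 = x\<^sup>T A(t) x\<close> with \<open>t = x\<^sub>n\<close> and \<open>A(t)\<^sub>j\<^sub>k = S\<^sub>j\<^sub>k t\<^sup>n\<^sup>-\<^sup>j\<^sup>-\<^sup>k\<close> for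
  \<open>j + k \<le> n\<close>.  The Levi form is the Hessian of the right hand side.  Its kernel has rank \<open>1\<close> at the
  origin iff the antidiagonal of \<open>S\<close> has no zeros, and then \<open>A(t)\<close> is invertible and the kernel has
  rank \<open>1\<close> everywhere iff \<open>A'' = 2 A' A\<^sup>-\<^sup>1 A'\<close>.  With \<open>N = A\<^sup>-\<^sup>1 A'\<close> this reads \<open>N' = N\<^sup>2\<close>, which by
  homogeneity in \<open>t\<close> says that each column of \<open>S\<close>, above the antidiagonal, is a multiple \<open>r\<^sub>m\<close> of the
  next one.  The kernel is then spanned by the vectors \<open>(-N x, 1)\<close>, and \<open>ad\<close> vanishes iff \<open>N\<close> does, that
  is, iff all \<open>r\<^sub>m\<close> are zero.  Diagonal scalings of the coordinates normalise the antidiagonal and the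
  nonzero \<open>r\<^sub>m\<close> to \<open>1\<close>, which gives the block form: the blocks end at the \<open>m\<close> with \<open>r\<^sub>m = 0\<close>, and
  symmetry of \<open>S\<close> makes this set of \<open>m\<close> symmetric.  Conversely, the Levi kernel of a germ is
  a biholomorphic invariant, and near the origin it already determines whether \<open>S\<close> has this structure.
\<close>

subsection \<open>Matrices with proportional columns\<close>

text \<open>The condition \<open>A'' = 2 A' A^-1 A'\<close> says that the Schur complement of
  \<open>2 A\<close> in the Hessian, which is \<open>x^T A'' x - 2 x^T A' A^-1 A' x\<close>,
  vanishes for every \<open>x\<close>. Differentiating \<open>A N = A'\<close> turns it into
  \<open>N' = N^2\<close>.

  Transporting \<open>ad\<close> through a biholomorphism is avoided: only kernel vectors are shown
  to correspond. This suffices for two reasons. Nonzero kernel vectors at points arbitrarily close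
  to the origin already force the columns to be proportional, because the entries of
  \<open>A\<close> are homogeneous in \<open>t\<close>. And if all ratios are zero, the coordinate
  field of \<open>z\<^sub>n\<close> is a holomorphic kernel field, whereas for a nonzero ratio the
  kernel direction \<open>(- N x, 1)\<close> is real and not constant, so no holomorphic field can
  span it.

  All ratios vanish exactly when all blocks have size 1, hence the clause excluding that list. The
  bound counts possible zero sets of the ratios: these are symmetric under
  \<open>m \<mapsto> n - 1 - m\<close> on \<open>{1..n - 2}\<close>, so their trace on the first
  \<open>p\<close> indices determines them, and the full set is excluded. For an upper bound it is
  enough that equal zero sets give equivalent hypersurfaces.\<close>

lemma antitriangular_inj:
  fixes a :: "nat \<Rightarrow> nat \<Rightarrow> 'a::field"
  assumes upper: "\<And>i j. n < i + j \<Longrightarrow> a i j = 0"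
    and anti: "\<And>j. j \<in> {1..<n} \<Longrightarrow> a (n - j) j \<noteq> 0"
    and zero: "\<And>i. i \<in> {1..<n} \<Longrightarrow> (\<Sum>j\<in>{1..<n}. a i j * w j) = 0"
    and "j \<in> {1..<n}"
  shows "w j = 0"
  using \<open>j \<in> {1..<n}\<close>
proof (induction j rule: less_induct)
  case (less j)
  \<comment> \<open>Forward substitution: row \<open>n - j\<close> vanishes beyond column
    \<open>j\<close>, and \<open>w\<close> vanishes before \<open>j\<close> by induction, so only
    the antidiagonal term survives.\<close>
  have "(\<Sum>l\<in>{1..<n}. a (n - j) l * w l) = (\<Sum>l\<in>{1..<n}. if l = j then a (n - j) j * w j else 0)"
  proof (rule sum.cong[OF refl])
    fix l assume l: "l \<in> {1..<n}"
    show "a (n - j) l * w l = (if l = j then a (n - j) j * w j else 0)"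
      using less l upper[of "n - j" l] by (cases l j rule: linorder_cases) auto
  qed
  also have "\<dots> = a (n - j) j * w j"
    using less.prems by simp
  finally have "a (n - j) j * w j = 0"
    using zero[of "n - j"] less.prems by auto
  then show ?case using anti[OF less.prems] by simp
qed

text \<open>For \<open>0 < m\<close> and \<open>Suc m < n\<close> the ratio \<open>r m\<close> is
  determined by \<open>S\<close>: row \<open>n - 1 - m\<close> has its antidiagonal entry, which is
  nonzero, in column \<open>Suc m\<close>.\<close>

definition column_chain :: "nat \<Rightarrow> (nat \<Rightarrow> nat \<Rightarrow> real) \<Rightarrow> (nat \<Rightarrow> real) \<Rightarrow> bool"
  where "column_chain n S r \<longleftrightarrow>
    (\<forall>j\<in>{1..<n}. S j (n - j) \<noteq> 0) \<and>
    (\<forall>i m. 0 < i \<and> 0 < m \<and> i + m < n \<longrightarrow> S i m = r m * S i (Suc m))"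

text \<open>
  The hypotheses say that \<open>\<nu>\<close> satisfies \<open>A \<nu> = A'\<close> and \<open>2 A' \<nu> = A''\<close> at \<open>t = 1\<close> for
  \<open>A(t)\<^sub>j\<^sub>k = a\<^sub>j\<^sub>k t\<^sup>n\<^sup>-\<^sup>j\<^sup>-\<^sup>k\<close>.  They give \<open>(j - k - 1) \<nu>\<^sub>j\<^sub>k = (\<nu>\<^sup>2)\<^sub>j\<^sub>k\<close>, so that \<open>\<nu>\<close> is
  determined by its first subdiagonal.
\<close>
lemma column_chain_of_nu:
  fixes a \<nu> :: "nat \<Rightarrow> nat \<Rightarrow> real"
  assumes upper: "\<And>i j. n < i + j \<Longrightarrow> a i j = 0"
    and anti: "\<And>j. j \<in> {1..<n} \<Longrightarrow> a j (n - j) \<noteq> 0"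
    and first: "\<And>i k. i \<in> {1..<n} \<Longrightarrow> k \<in> {1..<n} \<Longrightarrow>
      (\<Sum>j\<in>{1..<n}. a i j * \<nu> j k) = (real n - real i - real k) * a i k"
    and second: "\<And>i k. i \<in> {1..<n} \<Longrightarrow> k \<in> {1..<n} \<Longrightarrow>
      2 * (\<Sum>j\<in>{1..<n}. (real n - real i - real j) * a i j * \<nu> j k)
        = (real n - real i - real k) * (real n - real i - real k - 1) * a i k"
  shows "column_chain n a (\<lambda>m. \<nu> (Suc m) m)"
proof -
  have anti': "a (n - j) j \<noteq> 0" if "j \<in> {1..<n}" for j
    using anti[of "n - j"] that by (auto simp: Suc_le_eq)
  \<comment> \<open>Forward substitution again. On the diagonal the factor
    \<open>n - (n - j) - k\<close> is zero; above it the entry \<open>a (n - j) k\<close> lies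
    beyond the antidiagonal.\<close>
  have lower: "\<nu> j k = 0" if "j \<in> {1..<n}" "k \<in> {1..<n}" "j \<le> k" for j k
    using that
  proof (induction j rule: less_induct)
    case (less j)
    have "(\<Sum>l\<in>{1..<n}. a (n - j) l * \<nu> l k) = (\<Sum>l\<in>{1..<n}. if l = j then a (n - j) j * \<nu> j k else 0)"
    proof (rule sum.cong[OF refl])
      fix l assume l: "l \<in> {1..<n}"
      show "a (n - j) l * \<nu> l k = (if l = j then a (n - j) j * \<nu> j k else 0)"
        using less l upper[of "n - j" l] by (cases l j rule: linorder_cases) auto
    qed
    also have "\<dots> = a (n - j) j * \<nu> j k"
      using less.prems by simp
    finally have "a (n - j) j * \<nu> j k = (real n - real (n - j) - real k) * a (n - j) k"
      using first[of "n - j" k] less.prems by auto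
    also have "\<dots> = 0"
      using upper[of "n - j" k] less.prems by (cases "j = k") (auto simp: of_nat_diff)
    finally show ?case using anti'[OF less.prems(1)] by simp
  qed
  \<comment> \<open>Both sides agree after applying \<open>a\<close>, which is injective:
    \<open>first\<close> turns \<open>a\<close> times the square into the weighted sum of
    \<open>second\<close>, and comparing \<open>first\<close> with \<open>second\<close> replaces
    the weight \<open>n - i - j\<close> by \<open>j - k - 1\<close>.\<close>
  have square: "(real j - real k - 1) * \<nu> j k = (\<Sum>l\<in>{1..<n}. \<nu> j l * \<nu> l k)"
    if jk: "j \<in> {1..<n}" "k \<in> {1..<n}" for j k
  proof -
    have "(real j - real k - 1) * \<nu> j k - (\<Sum>l\<in>{1..<n}. \<nu> j l * \<nu> l k) = 0"
    proof (rule antitriangular_inj[where a = a and n = n and j = j and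
          w = "\<lambda>j. (real j - real k - 1) * \<nu> j k - (\<Sum>l\<in>{1..<n}. \<nu> j l * \<nu> l k)"])
      fix i assume i: "i \<in> {1..<n}"
      have "(\<Sum>j\<in>{1..<n}. a i j * (\<Sum>l\<in>{1..<n}. \<nu> j l * \<nu> l k))
          = (\<Sum>l\<in>{1..<n}. (\<Sum>j\<in>{1..<n}. a i j * \<nu> j l) * \<nu> l k)"
        unfolding sum_distrib_left sum_distrib_right
        by (subst sum.swap) (simp add: mult.assoc)
      also have "\<dots> = (\<Sum>l\<in>{1..<n}. (real n - real i - real l) * a i l * \<nu> l k)"
        using first i by (intro sum.cong) auto
      finally have A: "(\<Sum>j\<in>{1..<n}. a i j * (\<Sum>l\<in>{1..<n}. \<nu> j l * \<nu> l k)) = \<dots>" .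
      have "2 * (\<Sum>j\<in>{1..<n}. (real n - real i - real j) * a i j * \<nu> j k)
          = (real n - real i - real k - 1) * (\<Sum>j\<in>{1..<n}. a i j * \<nu> j k)"
        using second[OF i jk(2)] first[OF i jk(2)] by simp
      moreover have "(\<Sum>j\<in>{1..<n}. (real n - real i - real j) * a i j * \<nu> j k)
          = (real n - real i) * (\<Sum>j\<in>{1..<n}. a i j * \<nu> j k) - (\<Sum>j\<in>{1..<n}. real j * (a i j * \<nu> j k))"
        by (simp add: sum_distrib_left left_diff_distrib sum_subtractf mult.assoc)
      moreover have "(\<Sum>j\<in>{1..<n}. (real j - real k - 1) * (a i j * \<nu> j k))
          = (\<Sum>j\<in>{1..<n}. real j * (a i j * \<nu> j k)) - (real k + 1) * (\<Sum>j\<in>{1..<n}. a i j * \<nu> j k)"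
        by (simp add: sum_distrib_left left_diff_distrib sum_subtractf distrib_right sum.distrib)
      ultimately have "(\<Sum>j\<in>{1..<n}. (real j - real k - 1) * (a i j * \<nu> j k))
          = (\<Sum>j\<in>{1..<n}. (real n - real i - real j) * a i j * \<nu> j k)"
        by (simp add: algebra_simps)
      with A show "(\<Sum>j\<in>{1..<n}. a i j * ((real j - real k - 1) * \<nu> j k - (\<Sum>l\<in>{1..<n}. \<nu> j l * \<nu> l k))) = 0"
        by (simp add: right_diff_distrib sum_subtractf mult.left_commute)
    qed (use upper anti' jk in auto)
    then show ?thesis by simp
  qed
  define r where "r = (\<lambda>m. \<nu> (Suc m) m)"
  \<comment> \<open>For \<open>d = 1\<close> the factor \<open>d - 1\<close> vanishes and the entry
    is free. For larger \<open>d\<close> the square has \<open>d - 1\<close> terms, each equal to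
    the full product by induction, which cancels the factor.\<close>
  have prod: "\<nu> (k + d) k = (\<Prod>m\<in>{k..<k+d}. r m)" if "0 < k" "0 < d" "k + d < n" for k d
    using that
  proof (induction d arbitrary: k rule: less_induct)
    case (less d)
    show ?case
    proof (cases "d = 1")
      case True then show ?thesis by (simp add: r_def)
    next
      case False
      have "(real d - 1) * \<nu> (k + d) k = (\<Sum>l\<in>{1..<n}. \<nu> (k + d) l * \<nu> l k)"
        using square[of "k + d" k] less.prems by simp
      also have "\<dots> = (\<Sum>l\<in>{k+1..<k+d}. \<nu> (k + d) l * \<nu> l k)"
        using less.prems lower by (intro sum.mono_neutral_right) (auto simp: not_less Suc_le_eq)
      also have "\<dots> = (\<Sum>l\<in>{k+1..<k+d}. \<Prod>m\<in>{k..<k+d}. r m)"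
      proof (rule sum.cong[OF refl])
        fix l assume l: "l \<in> {k+1..<k+d}"
        have "\<nu> (l + (k + d - l)) l = (\<Prod>m\<in>{l..<l + (k + d - l)}. r m)"
          using l less.prems by (intro less.IH) auto
        moreover have "\<nu> (k + (l - k)) k = (\<Prod>m\<in>{k..<k + (l - k)}. r m)"
          using l less.prems by (intro less.IH) auto
        ultimately have "\<nu> (k + d) l * \<nu> l k = (\<Prod>m\<in>{l..<k + d}. r m) * (\<Prod>m\<in>{k..<l}. r m)"
          using l by simp
        also have "\<dots> = (\<Prod>m\<in>{k..<k+d}. r m)"
          using prod.atLeastLessThan_concat[of k l "k + d" r] l by (simp add: mult.commute)
        finally show "\<nu> (k + d) l * \<nu> l k = (\<Prod>m\<in>{k..<k+d}. r m)" .
      qed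
      also have "\<dots> = (real d - 1) * (\<Prod>m\<in>{k..<k+d}. r m)"
        using less.prems by (simp add: of_nat_diff)
      finally show ?thesis using False less.prems by simp
    qed
  qed
  \<comment> \<open>Columns are treated from right to left, so the claim is available for all
    columns beyond \<open>m\<close>.\<close>
  have "a i m = r m * a i (Suc m)" if "0 < i" "0 < m" "i + m < n" for i m
    using that
  proof (induction "n - m" arbitrary: m rule: less_induct)
    case less
    have tail: "a i j * (\<Prod>l\<in>{Suc m..<j}. r l) = a i (Suc m)" if "Suc m \<le> j" "i + j \<le> n" for j
      using that
    proof (induction j rule: dec_induct)
      case base then show ?case by simp
    next
      case (step j)
      have "a i j = r j * a i (Suc j)"
        using step less.prems by (intro less.hyps) auto
      then show ?case using step by (simp add: mult_ac)
    qed
    \<comment> \<open>The \<open>n - i - m\<close> surviving terms of \<open>first\<close> all equal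
      \<open>r m * a i (Suc m)\<close>, so the factor in front cancels.\<close>
    have "(real n - real i - real m) * a i m = (\<Sum>j\<in>{1..<n}. a i j * \<nu> j m)"
      using first[of i m] less.prems by simp
    also have "\<dots> = (\<Sum>j\<in>{Suc m..n - i}. a i j * \<nu> j m)"
    proof (rule sum.mono_neutral_right)
      show "\<forall>j\<in>{1..<n} - {Suc m..n - i}. a i j * \<nu> j m = 0"
      proof
        fix j assume "j \<in> {1..<n} - {Suc m..n - i}"
        then show "a i j * \<nu> j m = 0"
          using less.prems lower[of j m] upper[of i j] by (cases "j \<le> m") auto
      qed
    qed (use less.prems in auto)
    also have "\<dots> = (\<Sum>j\<in>{Suc m..n - i}. r m * a i (Suc m))"
    proof (rule sum.cong[OF refl])
      fix j assume j: "j \<in> {Suc m..n - i}"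
      have "\<nu> j m = (\<Prod>l\<in>{m..<j}. r l)"
        using prod[of m "j - m"] j less.prems by auto
      also have "\<dots> = r m * (\<Prod>l\<in>{Suc m..<j}. r l)"
        using j by (simp add: prod.atLeast_Suc_lessThan)
      finally show "a i j * \<nu> j m = r m * a i (Suc m)"
        using tail[of j] j less.prems le_diff_conv2[of i n j] by (simp add: mult_ac)
    qed
    also have "\<dots> = (real n - real i - real m) * (r m * a i (Suc m))"
      using less.prems by (simp add: of_nat_diff)
    finally show ?case using less.prems by simp
  qed
  then show ?thesis using anti by (auto simp: column_chain_def r_def)
qed

text \<open>The matrix \<open>N(t)\<close> in closed form. The degree \<open>j - k - 1\<close> in
  \<open>t\<close> comes from the degree \<open>n - j - k\<close> of the entries of
  \<open>A\<close>.\<close>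

definition kernel_matrix :: "(nat \<Rightarrow> real) \<Rightarrow> real \<Rightarrow> nat \<Rightarrow> nat \<Rightarrow> real"
  where "kernel_matrix r t j k = (if k < j then (\<Prod>m\<in>{k..<j}. r m) * t ^ (j - k - 1) else 0)"

text \<open>The derivative in \<open>t\<close>. Here, as in \<open>coef'\<close> and
  \<open>coef''\<close> below, a truncated exponent is always multiplied by zero.\<close>

definition kernel_matrix' :: "(nat \<Rightarrow> real) \<Rightarrow> real \<Rightarrow> nat \<Rightarrow> nat \<Rightarrow> real"
  where "kernel_matrix' r t j k =
    (if k < j then (\<Prod>m\<in>{k..<j}. r m) * (real (j - k - 1) * t ^ (j - k - 2)) else 0)"

text \<open>The entries of \<open>A(t)\<close>, extended by zero beyond the antidiagonal so that
  sums can run over the whole index square.\<close>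

definition coef :: "nat \<Rightarrow> (nat \<Rightarrow> nat \<Rightarrow> real) \<Rightarrow> real \<Rightarrow> nat \<Rightarrow> nat \<Rightarrow> real"
  where "coef n S t j k = (if j + k \<le> n then S j k * t ^ (n - j - k) else 0)"

definition coef' :: "nat \<Rightarrow> (nat \<Rightarrow> nat \<Rightarrow> real) \<Rightarrow> real \<Rightarrow> nat \<Rightarrow> nat \<Rightarrow> real"
  where "coef' n S t j k =
    (if j + k \<le> n then S j k * (real (n - j - k) * t ^ (n - j - k - 1)) else 0)"

definition coef'' :: "nat \<Rightarrow> (nat \<Rightarrow> nat \<Rightarrow> real) \<Rightarrow> real \<Rightarrow> nat \<Rightarrow> nat \<Rightarrow> real"
  where "coef'' n S t j k =
    (if j + k \<le> n then S j k * (real (n - j - k) * (real (n - j - k - 1) * t ^ (n - j - k - 2))) else 0)"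

lemma column_chain_prod:
  assumes "column_chain n S r" "0 < i" "0 < k" "k \<le> j" "i + j \<le> n"
  shows "S i j * (\<Prod>m\<in>{k..<j}. r m) = S i k"
  using assms(4,5)
proof (induction j rule: dec_induct)
  case (step j)
  have "S i j = r j * S i (Suc j)"
    using step assms by (auto simp: column_chain_def)
  then show ?case using step by (simp add: mult_ac)
qed simp

text \<open>This is \<open>A N = A'\<close>: the indices \<open>k < j \<le> n - i\<close>
  contribute, and by \<open>column_chain_prod\<close> these \<open>n - i - k\<close> terms are all
  the same monomial.\<close>

lemma sum_coef_kernel_matrix:
  assumes "column_chain n S r" "i \<in> {1..<n}" "k \<in> {1..<n}"
  shows "(\<Sum>j\<in>{1..<n}. coef n S t i j * kernel_matrix r t j k) = coef' n S t i k"
proof -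
  have "(\<Sum>j\<in>{1..<n}. coef n S t i j * kernel_matrix r t j k)
      = (\<Sum>j\<in>{Suc k..n - i}. coef n S t i j * kernel_matrix r t j k)"
    using assms by (intro sum.mono_neutral_right) (auto simp: coef_def kernel_matrix_def)
  also have "\<dots> = (\<Sum>j\<in>{Suc k..n - i}. S i k * t ^ (n - i - k - 1))"
  proof (rule sum.cong[OF refl])
    fix j assume j: "j \<in> {Suc k..n - i}"
    have "S i j * (\<Prod>m\<in>{k..<j}. r m) = S i k"
      using column_chain_prod[OF assms(1), of i k j] assms j by auto
    moreover have "t ^ (n - i - j) * t ^ (j - k - 1) = t ^ (n - i - k - 1)"
      using j by (auto simp flip: power_add intro!: arg_cong[of _ _ "power t"])
    moreover have "coef n S t i j * kernel_matrix r t j k =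
        (S i j * (\<Prod>m\<in>{k..<j}. r m)) * (t ^ (n - i - j) * t ^ (j - k - 1))"
      using j assms le_diff_conv2[of i n j] by (simp add: coef_def kernel_matrix_def)
    ultimately show "coef n S t i j * kernel_matrix r t j k = S i k * t ^ (n - i - k - 1)"
      by simp
  qed
  also have "\<dots> = coef' n S t i k"
    using assms by (auto simp: coef'_def)
  finally show ?thesis .
qed

text \<open>This is \<open>2 A' N = A''\<close>. Differentiating \<open>A\<close> puts the weight
  \<open>n - i - j\<close> on otherwise equal terms, and \<open>gauss\<close> adds up these
  weights.\<close>

lemma sum_coef'_kernel_matrix:
  assumes "column_chain n S r" "i \<in> {1..<n}" "k \<in> {1..<n}"
  shows "2 * (\<Sum>j\<in>{1..<n}. coef' n S t i j * kernel_matrix r t j k) = coef'' n S t i k"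
proof -
  have gauss: "2 * (\<Sum>j\<in>{Suc k..m}. real (m - j)) = real (m - k) * real (m - k - 1)" for k m
  proof (induction "m - k" arbitrary: k)
    case 0 then show ?case by simp
  next
    case (Suc d)
    then have "{Suc k..m} = insert (Suc k) {Suc (Suc k)..m}" by auto
    then have "2 * (\<Sum>j\<in>{Suc k..m}. real (m - j)) = 2 * real (m - Suc k) + real (m - Suc k) * real (m - Suc k - 1)"
      using Suc(1)[of "Suc k"] Suc(2) by simp
    moreover have "m - Suc k = d" "m - k = Suc d" using Suc(2) by auto
    ultimately show ?case by (cases d) (auto simp: algebra_simps)
  qed
  have "(\<Sum>j\<in>{1..<n}. coef' n S t i j * kernel_matrix r t j k)
      = (\<Sum>j\<in>{Suc k..n - i}. coef' n S t i j * kernel_matrix r t j k)"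
    using assms by (intro sum.mono_neutral_right) (auto simp: coef'_def kernel_matrix_def)
  also have "\<dots> = (\<Sum>j\<in>{Suc k..n - i}. real (n - i - j) * (S i k * t ^ (n - i - k - 2)))"
  proof (rule sum.cong[OF refl])
    fix j assume j: "j \<in> {Suc k..n - i}"
    have *: "S i j * (\<Prod>m\<in>{k..<j}. r m) = S i k"
      using column_chain_prod[OF assms(1), of i k j] assms j by auto
    show "coef' n S t i j * kernel_matrix r t j k = real (n - i - j) * (S i k * t ^ (n - i - k - 2))"
    proof (cases "j = n - i")
      case True then show ?thesis using assms by (simp add: coef'_def)
    next
      case False
      have "t ^ (n - i - j - 1) * t ^ (j - k - 1) = t ^ (n - i - k - 2)"
        using j False by (auto simp flip: power_add intro!: arg_cong[of _ _ "power t"])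
      moreover have "coef' n S t i j * kernel_matrix r t j k =
          real (n - i - j) * ((S i j * (\<Prod>m\<in>{k..<j}. r m)) * (t ^ (n - i - j - 1) * t ^ (j - k - 1)))"
        using j assms by (simp add: coef'_def kernel_matrix_def)
      ultimately show ?thesis using * by simp
    qed
  qed
  also have "\<dots> = (\<Sum>j\<in>{Suc k..n - i}. real (n - i - j)) * (S i k * t ^ (n - i - k - 2))"
    by (simp add: sum_distrib_right)
  finally have "2 * (\<Sum>j\<in>{1..<n}. coef' n S t i j * kernel_matrix r t j k)
      = (2 * (\<Sum>j\<in>{Suc k..n - i}. real (n - i - j))) * (S i k * t ^ (n - i - k - 2))"
    by simp
  also have "\<dots> = coef'' n S t i k"
    unfolding gauss using assms by (auto simp: coef''_def)
  finally show ?thesis .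
qed

text \<open>This is \<open>N^2 = N'\<close>: each of the \<open>j - k - 1\<close> intermediate
  indices splits the product over \<open>{k..<j}\<close> in two.\<close>

lemma kernel_matrix_square:
  assumes "j \<in> {1..<n}" "k \<in> {1..<n}"
  shows "(\<Sum>l\<in>{1..<n}. kernel_matrix r t j l * kernel_matrix r t l k) = kernel_matrix' r t j k"
proof -
  have "(\<Sum>l\<in>{1..<n}. kernel_matrix r t j l * kernel_matrix r t l k)
      = (\<Sum>l\<in>{Suc k..<j}. kernel_matrix r t j l * kernel_matrix r t l k)"
    using assms by (intro sum.mono_neutral_right) (auto simp: kernel_matrix_def)
  also have "\<dots> = (\<Sum>l\<in>{Suc k..<j}. (\<Prod>m\<in>{k..<j}. r m) * t ^ (j - k - 2))"
  proof (rule sum.cong[OF refl])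
    fix l assume l: "l \<in> {Suc k..<j}"
    have "(\<Prod>m\<in>{k..<l}. r m) * (\<Prod>m\<in>{l..<j}. r m) = (\<Prod>m\<in>{k..<j}. r m)"
      using prod.atLeastLessThan_concat[of k l j r] l by simp
    moreover have "t ^ (j - l - 1) * t ^ (l - k - 1) = t ^ (j - k - 2)"
      using l by (auto simp flip: power_add intro!: arg_cong[of _ _ "power t"])
    moreover have "kernel_matrix r t j l * kernel_matrix r t l k =
        ((\<Prod>m\<in>{k..<l}. r m) * (\<Prod>m\<in>{l..<j}. r m)) * (t ^ (j - l - 1) * t ^ (l - k - 1))"
      using l by (simp add: kernel_matrix_def)
    ultimately show "kernel_matrix r t j l * kernel_matrix r t l k = (\<Prod>m\<in>{k..<j}. r m) * t ^ (j - k - 2)"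
      by simp
  qed
  also have "\<dots> = kernel_matrix' r t j k"
    by (auto simp: kernel_matrix'_def)
  finally show ?thesis .
qed

subsection \<open>Smooth maps\<close>

lemma Ck_on_mono: "Ck_on (Suc k) f U \<Longrightarrow> Ck_on k f U"
  by (induction k arbitrary: f) (auto intro: differentiable_imp_continuous_on)

lemma Ck_on_const: "Ck_on k (\<lambda>x. c) U"
  by (induction k arbitrary: c) (auto intro: differentiable_on_const)

text \<open>Lets an explicit derivative stand in for \<open>frechet_derivative\<close>. The sections
  constructed below are polynomial in real coordinates, so smoothness on the whole space is all that
  has to be proved.\<close>

lemma Ck_on_UNIV_Suc:
  assumes "\<And>x. (f has_derivative f' x) (at x)" and "\<And>v. Ck_on k (\<lambda>x. f' x v) UNIV"
  shows "Ck_on (Suc k) f UNIV"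
proof -
  have "frechet_derivative f (at x) = f' x" for x
    using assms(1) by (metis frechet_derivative_at)
  then show ?thesis
    using assms by (auto simp: differentiable_on_def intro: differentiableI)
qed

lemma Ck_on_UNIV_derivative:
  assumes "Ck_on (Suc k) f UNIV"
  shows "(f has_derivative frechet_derivative f (at x)) (at x)"
    and "Ck_on k (\<lambda>x. frechet_derivative f (at x) v) UNIV"
  using assms by (auto simp: differentiable_on_def simp flip: frechet_derivative_works)

lemma Ck_on_bounded_linear: "bounded_linear f \<Longrightarrow> Ck_on k f UNIV"
proof (induction k)
  case 0 then show ?case by (simp add: linear_continuous_on)
next
  case (Suc k)
  then show ?case
    by (intro Ck_on_UNIV_Suc[where f' = "\<lambda>_. f"] bounded_linear_imp_has_derivative Ck_on_const)
qed

lemma Ck_on_add: "Ck_on k f UNIV \<Longrightarrow> Ck_on k g UNIV \<Longrightarrow> Ck_on k (\<lambda>x. f x + g x) UNIV"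
proof (induction k arbitrary: f g)
  case 0 then show ?case by (simp add: continuous_on_add)
next
  case (Suc k)
  show ?case
    by (rule Ck_on_UNIV_Suc[OF has_derivative_add[OF Ck_on_UNIV_derivative(1)[OF Suc.prems(1)]
          Ck_on_UNIV_derivative(1)[OF Suc.prems(2)]]])
      (intro Suc.IH Ck_on_UNIV_derivative(2) Suc.prems)
qed

lemma Ck_on_mult:
  fixes f g :: "'a::real_normed_vector \<Rightarrow> 'b::real_normed_algebra"
  shows "Ck_on k f UNIV \<Longrightarrow> Ck_on k g UNIV \<Longrightarrow> Ck_on k (\<lambda>x. f x * g x) UNIV"
proof (induction k arbitrary: f g)
  case 0 then show ?case by (simp add: continuous_on_mult)
next
  case (Suc k)
  show ?case
    by (rule Ck_on_UNIV_Suc[OF has_derivative_mult[OF Ck_on_UNIV_derivative(1)[OF Suc.prems(1)]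
          Ck_on_UNIV_derivative(1)[OF Suc.prems(2)]]])
      (intro Ck_on_add Suc.IH Ck_on_UNIV_derivative(2) Suc.prems Ck_on_mono[OF Suc.prems(1)]
        Ck_on_mono[OF Suc.prems(2)])
qed

lemma Ck_on_sum:
  "(\<And>i. i \<in> A \<Longrightarrow> Ck_on k (f i) UNIV) \<Longrightarrow> Ck_on k (\<lambda>x. \<Sum>i\<in>A. f i x) UNIV"
  by (induction A rule: infinite_finite_induct) (auto intro: Ck_on_add Ck_on_const)

lemma Ck_on_power:
  fixes f :: "'a::real_normed_vector \<Rightarrow> 'b::real_normed_algebra_1"
  shows "Ck_on k f UNIV \<Longrightarrow> Ck_on k (\<lambda>x. f x ^ m) UNIV"
  by (induction m) (auto intro: Ck_on_mult Ck_on_const)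

lemma has_derivative_vec_lambda:
  fixes f :: "'a::real_normed_vector \<Rightarrow> 'b::real_normed_vector^'m"
  assumes "\<And>i. ((\<lambda>x. f x $ i) has_derivative (\<lambda>v. f' v $ i)) (at x)"
  shows "(f has_derivative f') (at x)"
proof -
  have "bounded_linear f'"
  proof (rule bounded_linear_intro[where K = "\<Sum>i\<in>UNIV. onorm (\<lambda>v. f' v $ i)"])
    have lin: "bounded_linear (\<lambda>v. f' v $ i)" for i
      using assms has_derivative_bounded_linear by blast
    show "f' (a + b) = f' a + f' b" for a b
      by (simp add: vec_eq_iff linear_add[OF bounded_linear.linear[OF lin]])
    show "f' (c *\<^sub>R a) = c *\<^sub>R f' a" for a c
      by (simp add: vec_eq_iff linear_scale[OF bounded_linear.linear[OF lin]])
    show "norm (f' v) \<le> norm v * (\<Sum>i\<in>UNIV. onorm (\<lambda>v. f' v $ i))" for v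
    proof -
      have "norm (f' v) \<le> (\<Sum>i\<in>UNIV. norm (f' v $ i))"
        by (simp add: norm_vec_def L2_set_le_sum)
      also have "\<dots> \<le> (\<Sum>i\<in>UNIV. onorm (\<lambda>v. f' v $ i) * norm v)"
        by (intro sum_mono onorm[OF lin])
      finally show ?thesis by (simp add: sum_distrib_left mult.commute)
    qed
  qed
  moreover have "((\<lambda>y. ((f y - f x) - f' (y - x)) /\<^sub>R norm (y - x)) \<longlongrightarrow> 0) (at x)"
  proof (rule vec_tendstoI)
    fix i
    show "((\<lambda>y. (((f y - f x) - f' (y - x)) /\<^sub>R norm (y - x)) $ i) \<longlongrightarrow> 0 $ i) (at x)"
      using assms[of i] by (simp add: has_derivative_at_within)
  qed
  ultimately show ?thesis
    by (simp add: has_derivative_at_within)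
qed

lemma Ck_on_vec_lambda:
  fixes f :: "'a::real_normed_vector \<Rightarrow> 'b::real_normed_vector^'m"
  assumes "\<And>i. Ck_on k (\<lambda>x. f x $ i) UNIV"
  shows "Ck_on k f UNIV"
  using assms
proof (induction k arbitrary: f)
  case 0 then show ?case
    using continuous_on_vec_lambda[of UNIV "\<lambda>i x. f x $ i"] by simp
next
  case (Suc k)
  show ?case
  proof (rule Ck_on_UNIV_Suc[where f' = "\<lambda>x v. \<chi> i. frechet_derivative (\<lambda>x. f x $ i) (at x) v"])
    show "(f has_derivative (\<lambda>v. \<chi> i. frechet_derivative (\<lambda>x. f x $ i) (at x) v)) (at x)" for x
      using Ck_on_UNIV_derivative(1)[OF Suc.prems] by (intro has_derivative_vec_lambda) simp
    show "Ck_on k (\<lambda>x. \<chi> i. frechet_derivative (\<lambda>x. f x $ i) (at x) v) UNIV" for v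
      using Ck_on_UNIV_derivative(2)[OF Suc.prems] by (intro Suc.IH) simp
  qed
qed

subsection \<open>Complexified derivatives\<close>

lemma cnj_vec_nth [simp]: "cnj_vec a $ i = cnj (a $ i)"
  by (simp add: cnj_vec_def)

lemma cnj_vec_cnj_vec [simp]: "cnj_vec (cnj_vec a) = a"
  by (simp add: vec_eq_iff)

lemma bounded_linear_cnj_vec: "bounded_linear cnj_vec"
proof -
  have "linear cnj_vec" by (rule linearI) (auto simp: vec_eq_iff)
  then show ?thesis by (simp add: linear_linear)
qed

text \<open>\<open>dbar D y\<close> is the derivative along \<open>\<Sum>j. cnj y\<^sub>j \<partial>/\<partial>cnj z\<^sub>j\<close> of a map with differential \<open>D\<close>.\<close>
definition dbar :: "(complex^'m \<Rightarrow> complex^'k) \<Rightarrow> complex^'m \<Rightarrow> complex^'k"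
  where "dbar D y = (1/2) *s (D y + \<i> *s D (\<i> *s y))"

lemma scaleR_eq_vector_scalar_mult: "(c::real) *\<^sub>R (x :: complex^'m) = of_real c *s x"
  by (simp add: vec_eq_iff complex_eq_iff)

text \<open>The vector \<open>(0, cnj_vec y)\<close> is \<open>u + \<i> w\<close> for the real
  vectors \<open>u = y / 2\<close> and \<open>w = \<i> y / 2\<close>.\<close>

lemma cderiv_cnj:
  assumes "(f has_derivative D) (at q)"
  shows "cderiv (0, cnj_vec y) f q = dbar D y"
proof -
  have D: "frechet_derivative f (at q) = D"
    using assms by (metis frechet_derivative_at)
  have lin: "linear D" using assms has_derivative_linear by blast
  have "(1/2) *s (0 + cnj_vec (cnj_vec y)) = (1/2::real) *\<^sub>R y"
    by (simp add: scaleR_eq_vector_scalar_mult)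
  moreover have "(1/(2*\<i>)) *s (0 - cnj_vec (cnj_vec y)) = (1/2::real) *\<^sub>R (\<i> *s y)"
    by (simp add: vec_eq_iff complex_eq_iff)
  ultimately show ?thesis
    unfolding cderiv_def D dbar_def fst_conv snd_conv
    by (simp only: linear_scale[OF lin]) (simp add: vec_eq_iff complex_eq_iff)
qed

text \<open>Here \<open>u = y / 2\<close> and \<open>w = - \<i> y / 2\<close>, and conjugation
  exchanges holomorphic and antiholomorphic derivatives.\<close>

lemma cderiv_hol:
  assumes "(f has_derivative D) (at q)"
  shows "cderiv (y, 0) (\<lambda>p. cnj_vec (f p)) q = cnj_vec (dbar D y)"
proof -
  have "((\<lambda>p. cnj_vec (f p)) has_derivative (\<lambda>b. cnj_vec (D b))) (at q)"
    using bounded_linear.has_derivative[OF bounded_linear_cnj_vec assms] .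
  then have D: "frechet_derivative (\<lambda>p. cnj_vec (f p)) (at q) = (\<lambda>b. cnj_vec (D b))"
    by (metis frechet_derivative_at)
  have lin: "linear D" using assms has_derivative_linear by blast
  have zero: "cnj_vec 0 = 0" by (simp add: vec_eq_iff)
  have "(1/2) *s (y + cnj_vec 0) = (1/2::real) *\<^sub>R y"
    by (simp add: zero scaleR_eq_vector_scalar_mult)
  moreover have "(1/(2*\<i>)) *s (y - cnj_vec 0) = (-1/2::real) *\<^sub>R (\<i> *s y)"
    by (simp add: zero vec_eq_iff complex_eq_iff)
  ultimately show ?thesis
    unfolding cderiv_def D dbar_def fst_conv snd_conv
    by (simp only: linear_scale[OF lin]) (simp add: vec_eq_iff complex_eq_iff)
qed

lemma cderiv_const: "cderiv v (\<lambda>p. c) q = 0"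
  by (simp add: cderiv_def frechet_derivative_const)

text \<open>Each of the two fields has a component that is constantly zero, so two of the four
  derivatives in the bracket disappear.\<close>

lemma bracket_bar_eq:
  assumes "(X has_derivative DX) (at q)" "(Y has_derivative DY) (at q)"
  shows "bracket_bar X Y q = (- dbar DX (Y q), cnj_vec (dbar DY (X q)))"
  by (simp add: bracket_bar_def lie_bracket_def cderiv_const cderiv_cnj[OF assms(1)] cderiv_hol[OF assms(2)])

text \<open>Identities such as \<open>psi S p (X p) = 0\<close> hold on \<open>M\<close> only and
  can be differentiated only along curves in \<open>M\<close>; this is how all of them are exploited
  below.\<close>

lemma tangent_derivative_zero:
  fixes g :: "'a::real_normed_vector \<Rightarrow> 'b::real_normed_vector"
  assumes g: "(g has_derivative g') (at q)" and U: "open U" "q \<in> U"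
    and zero: "\<And>p. p \<in> M \<Longrightarrow> p \<in> U \<Longrightarrow> g p = 0"
    and u: "u \<in> tangent_space M q"
  shows "g' u = 0"
proof -
  obtain \<gamma> where \<gamma>: "\<gamma> 0 = q" "\<And>t. \<gamma> t \<in> M" "(\<gamma> has_vector_derivative u) (at (0::real))"
    using u by (auto simp: tangent_space_def)
  have "((g \<circ> \<gamma>) has_vector_derivative g' u) (at 0)"
    using \<gamma> g vector_derivative_diff_chain_within[of \<gamma> u 0 UNIV g g'] has_derivative_at_withinI
    by fastforce
  moreover have "\<forall>\<^sub>F t in at 0. (g \<circ> \<gamma>) t = 0"
  proof -
    have "(\<gamma> \<longlongrightarrow> \<gamma> 0) (at 0)"
      using \<gamma>(3) has_vector_derivative_continuous isContD by blast
    then have "\<forall>\<^sub>F t in at 0. \<gamma> t \<in> U"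
      using U \<gamma>(1) topological_tendstoD by fastforce
    then show ?thesis
      by eventually_elim (simp add: zero \<gamma>(2))
  qed
  moreover have "(g \<circ> \<gamma>) 0 = 0"
    using zero[of q] U \<gamma>(1) \<gamma>(2)[of 0] by simp
  ultimately have "((\<lambda>_. 0) has_vector_derivative g' u) (at (0::real))"
    unfolding has_vector_derivative_def
    by (rule_tac has_derivative_transform_eventually[of "g \<circ> \<gamma>" _ 0 UNIV]) simp_all
  then show ?thesis
    using vector_derivative_unique_at[OF has_vector_derivative_const] by metis
qed

subsection \<open>The tube hypersurfaces\<close>

definition defining_poly :: "nat \<Rightarrow> (nat \<Rightarrow> nat \<Rightarrow> real) \<Rightarrow> (nat \<Rightarrow> real) \<Rightarrow> real"
  where "defining_poly n S x = (\<Sum>j\<in>{1..<n}. \<Sum>k\<in>{1..<n}. coef n S (x n) j k * (x j * x k))"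

text \<open>The differential of \<open>defining_poly\<close> at \<open>x\<close>, extended complex
  linearly in \<open>a\<close>.\<close>

definition diff1 :: "nat \<Rightarrow> (nat \<Rightarrow> nat \<Rightarrow> real) \<Rightarrow> (nat \<Rightarrow> real) \<Rightarrow> (nat \<Rightarrow> complex) \<Rightarrow> complex"
  where "diff1 n S x a = (\<Sum>j\<in>{1..<n}. \<Sum>k\<in>{1..<n}.
    of_real (coef n S (x n) j k) * (a j * of_real (x k) + of_real (x j) * a k)
    + of_real (coef' n S (x n) j k) * a n * (of_real (x j) * of_real (x k)))"

text \<open>The Hessian of \<open>defining_poly\<close> at \<open>x\<close>, extended complex
  bilinearly in \<open>a\<close> and \<open>b\<close>.\<close>

definition diff2 ::
    "nat \<Rightarrow> (nat \<Rightarrow> nat \<Rightarrow> real) \<Rightarrow> (nat \<Rightarrow> real) \<Rightarrow> (nat \<Rightarrow> complex) \<Rightarrow> (nat \<Rightarrow> complex) \<Rightarrow> complex"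
  where "diff2 n S x a b = (\<Sum>j\<in>{1..<n}. \<Sum>k\<in>{1..<n}.
    of_real (coef n S (x n) j k) * (a j * b k + b j * a k)
    + of_real (coef' n S (x n) j k) * b n * (a j * of_real (x k) + of_real (x j) * a k)
    + of_real (coef' n S (x n) j k) * a n * (b j * of_real (x k) + of_real (x j) * b k)
    + of_real (coef'' n S (x n) j k) * b n * a n * (of_real (x j) * of_real (x k)))"

lemma DERIV_coef: "(( \<lambda>t. coef n S t j k) has_real_derivative coef' n S t j k) (at t)"
  by (auto simp: coef_def coef'_def intro!: derivative_eq_intros)

lemma DERIV_coef': "((\<lambda>t. coef' n S t j k) has_real_derivative coef'' n S t j k) (at t)"
  by (auto simp: coef'_def coef''_def diff_diff_eq intro!: derivative_eq_intros)

lemma DERIV_kernel_matrix: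
  "((\<lambda>t. kernel_matrix r t j k) has_real_derivative kernel_matrix' r t j k) (at t)"
  by (auto simp: kernel_matrix_def kernel_matrix'_def diff_diff_eq intro!: derivative_eq_intros)

lemma has_derivative_compose_DERIV:
  fixes f :: "real \<Rightarrow> real"
  assumes "(f has_real_derivative f') (at (h q))" "(h has_derivative h') (at q)"
  shows "((\<lambda>p. f (h p)) has_derivative (\<lambda>b. f' * h' b)) (at q)"
  using has_derivative_compose[OF assms(2), of f "(*) f'"] assms(1)
  by (simp add: has_field_derivative_def)

locale tube =
  fixes n :: nat and e :: "nat \<Rightarrow> 'm::finite"
  assumes n_gt: "2 < n" and bij: "bij_betw e {0..n} UNIV"
begin

definition mk :: "(nat \<Rightarrow> complex) \<Rightarrow> complex^'m"
  where "mk f = (\<chi> i. f (inv_into {0..n} e i))"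

definition re :: "complex^'m \<Rightarrow> nat \<Rightarrow> real"
  where "re q = (\<lambda>j. Re (q $ e j))"

abbreviation co :: "complex^'m \<Rightarrow> nat \<Rightarrow> complex"
  where "co a \<equiv> (\<lambda>j. a $ e j)"

text \<open>Twice the \<open>(1,0)\<close>-part of the differential of the defining function
  \<open>x\<^sub>0 - defining_poly\<close>; its zeros are the tangent
  \<open>(1,0)\<close>-vectors.\<close>

definition psi :: "(nat \<Rightarrow> nat \<Rightarrow> real) \<Rightarrow> complex^'m \<Rightarrow> complex^'m \<Rightarrow> complex"
  where "psi S q a = a $ e 0 - diff1 n S (re q) (co a)"

text \<open>For a function of the real parts alone the complex Hessian is a quarter of the real one,
  so up to a constant \<open>hess S q x (cnj_vec y)\<close> is the Levi form.\<close>

definition hess :: "(nat \<Rightarrow> nat \<Rightarrow> real) \<Rightarrow> complex^'m \<Rightarrow> complex^'m \<Rightarrow> complex^'m \<Rightarrow> complex"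
  where "hess S q a b = diff2 n S (re q) (co a) (co b)"

text \<open>The coefficients of \<open>psi\<close> depend on the real parts of the coordinates, so
  only this part of a displacement of the base point changes them.\<close>

definition revec :: "complex^'m \<Rightarrow> complex^'m"
  where "revec b = (\<chi> i. of_real (Re (b $ i)))"

section \<open>Coordinates, and linearity of \<open>psi\<close> and \<open>hess\<close>\<close>

lemma mk_nth: "j \<le> n \<Longrightarrow> mk f $ e j = f j"
  using bij by (simp add: mk_def bij_betw_def inv_into_f_f)

lemma e_eq_iff: "j \<le> n \<Longrightarrow> k \<le> n \<Longrightarrow> e j = e k \<longleftrightarrow> j = k"
  using bij by (auto simp: bij_betw_def inj_on_def)

lemma e_cases: obtains j where "j \<le> n" "i = e j"
  using bij by (metis atLeastAtMost_iff bij_betw_def imageE UNIV_I)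

lemma co_eqI: "(\<And>j. j \<le> n \<Longrightarrow> a $ e j = b $ e j) \<Longrightarrow> a = b"
  by (metis e_cases vec_eq_iff)

lemma diff1_add: "diff1 n S x (\<lambda>j. a j + b j) = diff1 n S x a + diff1 n S x b"
  by (simp add: diff1_def algebra_simps sum.distrib)

lemma diff1_scale: "diff1 n S x (\<lambda>j. c * a j) = c * diff1 n S x a"
  by (simp add: diff1_def algebra_simps sum_distrib_left sum.distrib)

lemma diff2_add: "diff2 n S x (\<lambda>j. a j + a' j) b = diff2 n S x a b + diff2 n S x a' b"
  by (simp add: diff2_def algebra_simps sum.distrib)

lemma diff2_scale: "diff2 n S x (\<lambda>j. c * a j) b = c * diff2 n S x a b"
  by (simp add: diff2_def algebra_simps sum_distrib_left sum.distrib)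

lemma diff2_commute: "diff2 n S x a b = diff2 n S x b a"
  by (simp add: diff2_def algebra_simps)

lemma diff1_cong: "(\<And>j. 1 \<le> j \<Longrightarrow> j \<le> n \<Longrightarrow> a j = b j) \<Longrightarrow> (\<And>j. 1 \<le> j \<Longrightarrow> j \<le> n \<Longrightarrow> x j = y j) \<Longrightarrow>
    diff1 n S x a = diff1 n S y b"
  using n_gt by (auto simp: diff1_def intro!: sum.cong)

lemma diff2_cong: "(\<And>j. 1 \<le> j \<Longrightarrow> j \<le> n \<Longrightarrow> a j = b j) \<Longrightarrow> (\<And>j. 1 \<le> j \<Longrightarrow> j \<le> n \<Longrightarrow> a' j = b' j) \<Longrightarrow>
    diff2 n S x a a' = diff2 n S x b b'"
  using n_gt by (auto simp: diff2_def intro!: sum.cong)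

lemma psi_add: "psi S q (a + b) = psi S q a + psi S q b"
  by (simp add: psi_def diff1_add)

lemma psi_scale: "psi S q (c *s a) = c * psi S q a"
  by (simp add: psi_def diff1_scale algebra_simps)

lemma psi_uminus: "psi S q (- a) = - psi S q a"
  using psi_scale[of S q "-1" a] by simp

lemma psi_diff: "psi S q (a - b) = psi S q a - psi S q b"
  using psi_add[of S q a "-b"] by (simp add: psi_uminus)

lemma hess_add: "hess S q (a + a') b = hess S q a b + hess S q a' b"
  by (simp add: hess_def diff2_add)

lemma hess_scale: "hess S q (c *s a) b = c * hess S q a b"
  by (simp add: hess_def diff2_scale)

lemma hess_commute: "hess S q a b = hess S q b a"
  by (simp add: hess_def diff2_commute)

lemma hess_cnj: "hess S q (cnj_vec a) (cnj_vec b) = cnj (hess S q a b)"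
  by (simp add: hess_def diff2_def cnj_sum)

text \<open>\<open>dbar\<close> combines the directions \<open>y\<close> and
  \<open>\<i> *s y\<close>; their real parts, combined in the same way, give
  \<open>cnj_vec y\<close>.\<close>

lemma hess_revec: "hess S q a (revec y) + \<i> * hess S q a (revec (\<i> *s y)) = hess S q a (cnj_vec y)"
proof -
  have "revec y + \<i> *s revec (\<i> *s y) = cnj_vec y"
    by (simp add: vec_eq_iff revec_def complex_eq_iff)
  then show ?thesis
    by (metis hess_add hess_commute hess_scale)
qed

section \<open>Differentials of the coefficients and of \<open>psi\<close>\<close>

lemma has_derivative_nth:
  "(X has_derivative X') F \<Longrightarrow> ((\<lambda>p. X p $ i) has_derivative (\<lambda>b. X' b $ i)) F"
  by (rule bounded_linear.has_derivative[OF bounded_linear_vec_nth])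

lemma has_derivative_re [derivative_intros]:
  "((\<lambda>q. re q j) has_derivative (\<lambda>b. Re (b $ e j))) (at q)"
  unfolding re_def
  by (intro bounded_linear_imp_has_derivative bounded_linear_compose[OF bounded_linear_Re bounded_linear_vec_nth])

lemma has_derivative_coef [derivative_intros]:
  "((\<lambda>q. coef n S (re q n) j k) has_derivative (\<lambda>b. coef' n S (re q n) j k * Re (b $ e n))) (at q)"
  by (rule has_derivative_compose_DERIV[OF DERIV_coef has_derivative_re])

lemma has_derivative_coef' [derivative_intros]:
  "((\<lambda>q. coef' n S (re q n) j k) has_derivative (\<lambda>b. coef'' n S (re q n) j k * Re (b $ e n))) (at q)"
  by (rule has_derivative_compose_DERIV[OF DERIV_coef' has_derivative_re])

lemma has_derivative_kernel_matrix [derivative_intros]: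
  "((\<lambda>q. kernel_matrix r (re q n) j k) has_derivative (\<lambda>b. kernel_matrix' r (re q n) j k * Re (b $ e n))) (at q)"
  by (rule has_derivative_compose_DERIV[OF DERIV_kernel_matrix has_derivative_re])

lemma has_derivative_defining_poly:
  "((\<lambda>q. defining_poly n S (re q)) has_derivative (\<lambda>b. Re (diff1 n S (re q) (co b)))) (at q)"
proof -
  have "((\<lambda>q. defining_poly n S (re q)) has_derivative
     (\<lambda>b. \<Sum>j\<in>{1..<n}. \<Sum>k\<in>{1..<n}. coef n S (re q n) j k * (re q j * Re (b $ e k) + Re (b $ e j) * re q k)
        + coef' n S (re q n) j k * Re (b $ e n) * (re q j * re q k))) (at q)"
    unfolding defining_poly_def
    by (intro has_derivative_sum has_derivative_mult has_derivative_coef has_derivative_re)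
  then show ?thesis
    by (simp add: diff1_def algebra_simps)
qed

text \<open>The product rule has two contributions: moving \<open>X\<close>, and moving the base
  point, which differentiates the coefficients to the Hessian.\<close>

lemma has_derivative_psi:
  assumes X: "(X has_derivative X') (at q)"
  shows "((\<lambda>p. psi S p (X p)) has_derivative
    (\<lambda>b. psi S q (X' b) - hess S q (X q) (revec b))) (at q)"
proof -
  note D = has_derivative_nth[OF X] has_derivative_of_real[OF has_derivative_coef]
    has_derivative_of_real[OF has_derivative_coef'] has_derivative_of_real[OF has_derivative_re]
  have "((\<lambda>p. psi S p (X p)) has_derivative (\<lambda>b. X' b $ e 0 - (\<Sum>j\<in>{1..<n}. \<Sum>k\<in>{1..<n}.
    (of_real (coef n S (re q n) j k) * (
      (X q $ e j * of_real (Re (b $ e k)) + X' b $ e j * of_real (re q k))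
      + (of_real (re q j) * X' b $ e k + of_real (Re (b $ e j)) * X q $ e k))
    + of_real (coef' n S (re q n) j k * Re (b $ e n)) * (X q $ e j * of_real (re q k) + of_real (re q j) * X q $ e k))
    + (of_real (coef' n S (re q n) j k) * X q $ e n *
         (of_real (re q j) * of_real (Re (b $ e k)) + of_real (Re (b $ e j)) * of_real (re q k))
      + (of_real (coef' n S (re q n) j k) * X' b $ e n
          + of_real (coef'' n S (re q n) j k * Re (b $ e n)) * X q $ e n) * (of_real (re q j) * of_real (re q k)))))) (at q)"
    unfolding psi_def diff1_def
    by (intro has_derivative_diff has_derivative_sum has_derivative_add has_derivative_mult D)
  then show ?thesis
    by (rule has_derivative_eq_rhs)
      (simp add: psi_def hess_def diff1_def diff2_def revec_def fun_eq_iff algebra_simps sum.distrib)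
qed

section \<open>Real and holomorphic tangent spaces of the hypersurface\<close>

lemma hypersurface_eq: "hypersurface e n S = {z. Re (z $ e 0) = defining_poly n S (re z)}"
proof -
  have "(\<Sum>(j, k) \<in> {(j, k). 0 < j \<and> 0 < k \<and> j + k \<le> n}.
      S j k * Re (z $ e j) * Re (z $ e k) * Re (z $ e n) ^ (n - j - k)) = defining_poly n S (re z)" for z
  proof -
    have "defining_poly n S (re z) = (\<Sum>(j, k)\<in>{1..<n} \<times> {1..<n}. coef n S (re z n) j k * (re z j * re z k))"
      by (simp add: defining_poly_def sum.cartesian_product)
    also have "\<dots> = (\<Sum>(j, k) \<in> {(j, k). 0 < j \<and> 0 < k \<and> j + k \<le> n}. coef n S (re z n) j k * (re z j * re z k))"
      by (rule sum.mono_neutral_right) (auto simp: coef_def split: if_splits)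
    also have "\<dots> = (\<Sum>(j, k) \<in> {(j, k). 0 < j \<and> 0 < k \<and> j + k \<le> n}.
      S j k * Re (z $ e j) * Re (z $ e k) * Re (z $ e n) ^ (n - j - k))"
      by (rule sum.cong) (auto simp: coef_def re_def)
    finally show ?thesis by simp
  qed
  then show ?thesis by (simp add: hypersurface_def)
qed

text \<open>A retraction onto the hypersurface that resets the real part of
  \<open>z\<^sub>0\<close>. It supplies curves in the hypersurface and points with prescribed real
  coordinates.\<close>

definition graph :: "(nat \<Rightarrow> nat \<Rightarrow> real) \<Rightarrow> complex^'m \<Rightarrow> complex^'m"
  where "graph S q = (\<chi> i. if i = e 0 then of_real (defining_poly n S (re q)) + \<i> * of_real (Im (q $ i)) else q $ i)"

lemma defining_poly_cong: "(\<And>j. 1 \<le> j \<Longrightarrow> j \<le> n \<Longrightarrow> x j = y j) \<Longrightarrow> defining_poly n S x = defining_poly n S y"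
  using n_gt by (auto simp: defining_poly_def intro!: sum.cong)

lemma graph_in: "graph S q \<in> hypersurface e n S"
proof -
  have "defining_poly n S (re (graph S q)) = defining_poly n S (re q)"
    by (rule defining_poly_cong) (auto simp: re_def graph_def e_eq_iff)
  then show ?thesis by (simp add: hypersurface_eq) (simp add: graph_def)
qed

lemma graph_id: "q \<in> hypersurface e n S \<Longrightarrow> graph S q = q"
  by (auto simp: hypersurface_eq graph_def vec_eq_iff complex_eq_iff)

lemma has_derivative_graph:
  "(graph S has_derivative (\<lambda>b. \<chi> i. if i = e 0 then
      of_real (Re (diff1 n S (re q) (co b))) + \<i> * of_real (Im (b $ i)) else b $ i)) (at q)"
proof (rule has_derivative_vec_lambda)
  fix i
  have "((\<lambda>q. of_real (defining_poly n S (re q)) + \<i> * of_real (Im (q $ e 0))) has_derivative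
    (\<lambda>b. complex_of_real (Re (diff1 n S (re q) (co b))) + \<i> * of_real (Im (b $ e 0)))) (at q)"
    by (intro has_derivative_add has_derivative_of_real has_derivative_defining_poly
       has_derivative_mult_right bounded_linear_imp_has_derivative
       bounded_linear_compose[OF bounded_linear_Im bounded_linear_vec_nth])
  moreover have "((\<lambda>q. q $ i) has_derivative (\<lambda>b. b $ i)) (at q)"
    by (intro bounded_linear_imp_has_derivative bounded_linear_vec_nth)
  ultimately show "((\<lambda>q. graph S q $ i) has_derivative (\<lambda>b. (\<chi> i. if i = e 0 then
      of_real (Re (diff1 n S (re q) (co b))) + \<i> * of_real (Im (b $ i)) else b $ i) $ i)) (at q)"
    by (cases "i = e 0") (simp_all add: graph_def)
qed

lemma tangent_space_iff:
  assumes q: "q \<in> hypersurface e n S"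
  shows "u \<in> tangent_space (hypersurface e n S) q \<longleftrightarrow> Re (psi S q u) = 0"
proof
  assume u: "u \<in> tangent_space (hypersurface e n S) q"
  have "((\<lambda>p. Re (p $ e 0) - defining_poly n S (re p)) has_derivative
      (\<lambda>b. Re (b $ e 0) - Re (diff1 n S (re q) (co b)))) (at q)"
    by (intro has_derivative_diff has_derivative_defining_poly bounded_linear_imp_has_derivative
       bounded_linear_compose[OF bounded_linear_Re bounded_linear_vec_nth])
  from tangent_derivative_zero[OF this open_UNIV UNIV_I _ u]
  show "Re (psi S q u) = 0"
    by (simp add: hypersurface_eq psi_def)
next
  assume u: "Re (psi S q u) = 0"
  define D where "D = (\<lambda>b. \<chi> i. if i = e 0 then
      of_real (Re (diff1 n S (re q) (co b))) + \<i> * of_real (Im (b $ i)) else b $ i)"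
  \<comment> \<open>The differential of the retraction fixes \<open>u\<close>, so the line through
    \<open>q\<close> projects to a curve with velocity \<open>u\<close>.\<close>
  have Du: "D u = u"
    using u by (simp add: D_def vec_eq_iff psi_def complex_eq_iff)
  have "((\<lambda>t. q + t *\<^sub>R u) has_vector_derivative u) (at (0::real))"
    by (auto intro!: derivative_eq_intros)
  then have "((graph S \<circ> (\<lambda>t. q + t *\<^sub>R u)) has_vector_derivative D u) (at 0)"
    using vector_derivative_diff_chain_within[of "\<lambda>t. q + t *\<^sub>R u" u 0 UNIV "graph S" D]
      has_derivative_graph[of S q] by (simp add: D_def has_derivative_at_withinI)
  then show "u \<in> tangent_space (hypersurface e n S) q"
    unfolding tangent_space_def Du
    by (intro CollectI exI[of _ "graph S \<circ> (\<lambda>t. q + t *\<^sub>R u)"]) (auto simp: graph_in graph_id[OF q])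
qed

lemma hol_tangent_eq:
  assumes q: "q \<in> hypersurface e n S"
  shows "hol_tangent (hypersurface e n S) q = {a. psi S q a = 0}"
proof (intro set_eqI iffI)
  fix a assume "a \<in> hol_tangent (hypersurface e n S) q"
  then obtain u w where uw: "a = u + \<i> *s w" "0 = cnj_vec u + \<i> *s cnj_vec w"
      "Re (psi S q u) = 0" "Re (psi S q w) = 0"
    by (auto simp: hol_tangent_def complexified_tangent_def tangent_space_iff[OF q])
  \<comment> \<open>The vanishing second component forces this; the real equations for
    \<open>u\<close> and \<open>w\<close> then become the imaginary and real part of one complex
    equation.\<close>
  have "u = \<i> *s w"
  proof (rule co_eqI)
    fix j
    have "0 = cnj (u $ e j) + \<i> * cnj (w $ e j)"
      using arg_cong[OF uw(2), of "\<lambda>v. v $ e j"] by simp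
    then show "u $ e j = (\<i> *s w) $ e j" by (auto simp: complex_eq_iff)
  qed
  then have "psi S q u = \<i> * psi S q w" and "a = (2 * \<i>) *s w"
    using uw(1) by (simp only: psi_scale, simp add: vec_eq_iff)
  then show "a \<in> {a. psi S q a = 0}"
    using uw(3,4) by (simp add: psi_scale complex_eq_iff)
next
  fix a assume "a \<in> {a. psi S q a = 0}"
  then have a: "psi S q a = 0" by simp
  have "(a, 0) = ((1/2) *s a + \<i> *s ((-\<i>/2) *s a), cnj_vec ((1/2) *s a) + \<i> *s cnj_vec ((-\<i>/2) *s a))"
    by (simp add: vec_eq_iff complex_eq_iff)
  moreover have "psi S q ((1/2) *s a) = 0" "psi S q ((-\<i>/2) *s a) = 0"
    using a by (simp_all only: psi_scale mult_zero_right)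
  ultimately show "a \<in> hol_tangent (hypersurface e n S) q"
    unfolding hol_tangent_def complexified_tangent_def tangent_space_iff[OF q] mem_Collect_eq
    by (metis zero_complex.sel(1))
qed

lemma hol_tangent_in_tangent:
  assumes "q \<in> hypersurface e n S" "psi S q a = 0"
  shows "a \<in> tangent_space (hypersurface e n S) q" "\<i> *s a \<in> tangent_space (hypersurface e n S) q"
  using assms by (auto simp: tangent_space_iff psi_scale)

text \<open>Differentiates \<open>psi S p (X p) = 0\<close> along the antiholomorphic direction of \<open>y\<close>.\<close>
lemma psi_dbar:
  assumes q: "q \<in> hypersurface e n S" and X: "(X has_derivative X') (at q)"
    and U: "open U" "q \<in> U" and sec: "\<And>p. p \<in> hypersurface e n S \<Longrightarrow> p \<in> U \<Longrightarrow> psi S p (X p) = 0"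
    and y: "psi S q y = 0"
  shows "psi S q (dbar X' y) = hess S q (X q) (cnj_vec y) / 2"
proof -
  have "psi S q (X' b) = hess S q (X q) (revec b)" if "b \<in> tangent_space (hypersurface e n S) q" for b
    using tangent_derivative_zero[OF has_derivative_psi[OF X] U sec that] by simp
  then show ?thesis
    using hol_tangent_in_tangent[OF q y]
    by (simp add: dbar_def psi_scale psi_add flip: hess_revec)
qed

lemma local_section_derivative:
  assumes "local_section M B q X"
  obtains U X' where "open U" "q \<in> U" "(X has_derivative X') (at q)" "\<And>p. p \<in> M \<Longrightarrow> p \<in> U \<Longrightarrow> X p \<in> B p"
proof -
  obtain U where U: "open U" "q \<in> U" "Cinf_on X U" "\<And>p. p \<in> M \<inter> U \<Longrightarrow> X p \<in> B p"
    using assms by (auto simp: local_section_def)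
  then have "X differentiable_on U"
    by (metis Cinf_on_def Ck_on.simps(2))
  then have "X differentiable (at q)"
    using U by (simp add: differentiable_on_eq_differentiable_at)
  then show thesis
    using U that by (auto simp: differentiable_def)
qed

text \<open>The equation \<open>psi S p v = 0\<close> can be solved for coordinate 0, which
  \<open>diff1\<close> does not see. Overwriting it makes any field a section of the holomorphic
  tangent bundle.\<close>

definition hol_section :: "(nat \<Rightarrow> nat \<Rightarrow> real) \<Rightarrow> (complex^'m \<Rightarrow> complex^'m) \<Rightarrow> complex^'m \<Rightarrow> complex^'m"
  where "hol_section S X p = (\<chi> i. if i = e 0 then diff1 n S (re p) (co (X p)) else X p $ i)"

lemma psi_hol_section: "psi S p (hol_section S X p) = 0"
proof -
  have "diff1 n S (re p) (co (hol_section S X p)) = diff1 n S (re p) (co (X p))"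
    by (rule diff1_cong) (auto simp: hol_section_def e_eq_iff)
  then show ?thesis by (simp add: psi_def) (simp add: hol_section_def)
qed

lemma hol_section_id: "psi S q (X q) = 0 \<Longrightarrow> hol_section S X q = X q"
  by (simp add: hol_section_def psi_def vec_eq_iff)

section \<open>Smooth sections and the Levi form\<close>

lemma Ck_on_re: "Ck_on k (\<lambda>p. complex_of_real (re p j)) UNIV"
  unfolding re_def
  by (intro Ck_on_bounded_linear bounded_linear_compose[OF bounded_linear_of_real]
       bounded_linear_compose[OF bounded_linear_Re bounded_linear_vec_nth])

lemma Ck_on_coef: "Ck_on k (\<lambda>p. complex_of_real (coef n S (re p n) i j)) UNIV"
  by (cases "i + j \<le> n") (auto simp: coef_def intro!: Ck_on_mult Ck_on_const Ck_on_power Ck_on_re)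

lemma Ck_on_coef': "Ck_on k (\<lambda>p. complex_of_real (coef' n S (re p n) i j)) UNIV"
  by (cases "i + j \<le> n") (auto simp: coef'_def intro!: Ck_on_mult Ck_on_const Ck_on_power Ck_on_re)

lemma Ck_on_kernel_matrix: "Ck_on k (\<lambda>p. complex_of_real (kernel_matrix r (re p n) i j)) UNIV"
  by (cases "j < i") (auto simp: kernel_matrix_def intro!: Ck_on_mult Ck_on_const Ck_on_power Ck_on_re)

lemma Ck_on_hol_section:
  assumes "\<And>i. Ck_on k (\<lambda>p. X p $ i) UNIV"
  shows "Ck_on k (hol_section S X) UNIV"
proof (rule Ck_on_vec_lambda)
  fix i
  have "Ck_on k (\<lambda>p. diff1 n S (re p) (co (X p))) UNIV"
    unfolding diff1_def
    by (intro Ck_on_sum Ck_on_add Ck_on_mult Ck_on_re Ck_on_coef Ck_on_coef' assms)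
  then show "Ck_on k (\<lambda>p. hol_section S X p $ i) UNIV"
    using assms by (cases "i = e 0") (simp_all add: hol_section_def)
qed

lemma local_section_hol:
  assumes "psi S q x = 0"
  shows "local_section (hypersurface e n S) (hol_tangent (hypersurface e n S)) q (hol_section S (\<lambda>_. x))"
  unfolding local_section_def
  by (rule exI[of _ UNIV]) (auto simp: Cinf_on_def hol_tangent_eq psi_hol_section
      intro!: Ck_on_hol_section Ck_on_const)

lemma cnj_vec_image_iff: "b \<in> cnj_vec ` A \<longleftrightarrow> cnj_vec b \<in> A"
  by (metis cnj_vec_cnj_vec imageE image_eqI)

text \<open>\<open>psi\<close> of the bracket components depends on the sections only through
  \<open>x\<close> and \<open>y\<close>: it is half the Hessian up to sign and conjugation. So the
  Levi form is a single coset, governed by one number.\<close>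

lemma levi_form_eq_iff:
  assumes q: "q \<in> hypersurface e n S" and x: "psi S q x = 0" and y: "psi S q y = 0"
  shows "levi_form (hypersurface e n S) q x y =
      hol_tangent (hypersurface e n S) q \<times> cnj_vec ` hol_tangent (hypersurface e n S) q \<longleftrightarrow>
    hess S q x (cnj_vec y) = 0"
proof -
  let ?M = "hypersurface e n S"
  let ?T = "hol_tangent ?M q \<times> cnj_vec ` hol_tangent ?M q"
  have T_iff: "(a, b) \<in> ?T \<longleftrightarrow> psi S q a = 0 \<and> psi S q (cnj_vec b) = 0" for a b
    by (simp add: cnj_vec_image_iff hol_tangent_eq[OF q])
  have bracket: "psi S q (fst (bracket_bar X Y q)) = - hess S q x (cnj_vec y) / 2 \<and>
       psi S q (cnj_vec (snd (bracket_bar X Y q))) = cnj (hess S q x (cnj_vec y)) / 2"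
    if X: "local_section ?M (hol_tangent ?M) q X" "X q = x"
      and Y: "local_section ?M (hol_tangent ?M) q Y" "Y q = y" for X Y
  proof -
    obtain U X' where U: "open U" "q \<in> U" "(X has_derivative X') (at q)" "\<And>p. p \<in> ?M \<Longrightarrow> p \<in> U \<Longrightarrow> X p \<in> hol_tangent ?M p"
      using local_section_derivative[OF X(1)] by metis
    obtain V Y' where V: "open V" "q \<in> V" "(Y has_derivative Y') (at q)" "\<And>p. p \<in> ?M \<Longrightarrow> p \<in> V \<Longrightarrow> Y p \<in> hol_tangent ?M p"
      using local_section_derivative[OF Y(1)] by metis
    have "psi S q (dbar X' y) = hess S q (X q) (cnj_vec y) / 2"
      using U(4) by (intro psi_dbar[OF q U(3,1,2) _ y]) (auto simp: hol_tangent_eq)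
    moreover have "psi S q (dbar Y' x) = hess S q (Y q) (cnj_vec x) / 2"
      using V(4) by (intro psi_dbar[OF q V(3,1,2) _ x]) (auto simp: hol_tangent_eq)
    moreover have "hess S q y (cnj_vec x) = cnj (hess S q x (cnj_vec y))"
      using hess_cnj[of S q x "cnj_vec y"] by (simp add: hess_commute)
    ultimately show ?thesis
      by (simp add: bracket_bar_eq[OF U(3) V(3)] X Y psi_uminus)
  qed
  have ex: "\<exists>X. local_section ?M (hol_tangent ?M) q X \<and> X q = z" if "psi S q z = 0" for z
    using local_section_hol[OF that] hol_section_id[of S q "\<lambda>_. z"] that by blast
  show ?thesis
  proof
    assume "levi_form ?M q x y = ?T"
    moreover have "cnj_vec (0 :: complex^'m) = 0" "psi S q 0 = 0"
      using psi_scale[of S q 0 0] by (simp_all add: vec_eq_iff)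
    then have "(0, 0) \<in> ?T"
      unfolding T_iff by simp
    ultimately have "(0, 0) \<in> levi_form ?M q x y" by simp
    then obtain X Y where XY: "local_section ?M (hol_tangent ?M) q X" "X q = x"
        "local_section ?M (hol_tangent ?M) q Y" "Y q = y"
        "psi S q (0 - \<i> *s fst (bracket_bar X Y q)) = 0"
      unfolding levi_form_def by (auto simp: hol_tangent_eq[OF q])
    then show "hess S q x (cnj_vec y) = 0"
      using bracket[OF XY(1-4)] by (simp add: psi_uminus psi_scale)
  next
    assume h: "hess S q x (cnj_vec y) = 0"
    show "levi_form ?M q x y = ?T"
    proof (intro set_eqI)
      fix c :: "(complex^'m) \<times> (complex^'m)"
      obtain a b where c: "c = (a, b)" by force
      \<comment> \<open>With zero Hessian the bracket itself lies in the zero coset, so subtracting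
        it does not affect membership.\<close>
      have eq: "(a - \<i> *s fst (bracket_bar X Y q), b - \<i> *s snd (bracket_bar X Y q)) \<in> ?T \<longleftrightarrow> (a, b) \<in> ?T"
        if X: "local_section ?M (hol_tangent ?M) q X" "X q = x"
          and Y: "local_section ?M (hol_tangent ?M) q Y" "Y q = y" for X Y
      proof -
        have "cnj_vec (b - \<i> *s snd (bracket_bar X Y q)) = cnj_vec b + \<i> *s cnj_vec (snd (bracket_bar X Y q))"
          by (simp add: vec_eq_iff)
        then show ?thesis
          unfolding T_iff using bracket[OF X Y] h by (simp add: psi_diff psi_add psi_scale)
      qed
      show "c \<in> levi_form ?M q x y \<longleftrightarrow> c \<in> ?T"
      proof
        assume "c \<in> levi_form ?M q x y"
        then obtain X Y where "local_section ?M (hol_tangent ?M) q X" "X q = x"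
            "local_section ?M (hol_tangent ?M) q Y" "Y q = y"
            "(a - \<i> *s fst (bracket_bar X Y q), b - \<i> *s snd (bracket_bar X Y q)) \<in> ?T"
          unfolding levi_form_def c by blast
        then show "c \<in> ?T" using eq c by blast
      next
        assume "c \<in> ?T"
        moreover obtain X Y where XY: "local_section ?M (hol_tangent ?M) q X" "X q = x"
            "local_section ?M (hol_tangent ?M) q Y" "Y q = y"
          using ex[OF x] ex[OF y] by blast
        ultimately have "(a - \<i> *s fst (bracket_bar X Y q), b - \<i> *s snd (bracket_bar X Y q)) \<in> ?T"
          using eq[OF XY] c by blast
        then show "c \<in> levi_form ?M q x y"
          unfolding levi_form_def c using XY by blast
      qed
    qed
  qed
qed

text \<open>\<open>hess\<close> does not involve coordinate 0, so an arbitrary \<open>b\<close> can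
  be completed to a conjugated tangent vector with the same Hessian.\<close>

lemma levi_kernel_eq:
  assumes q: "q \<in> hypersurface e n S"
  shows "levi_kernel (hypersurface e n S) q = {v. psi S q v = 0 \<and> (\<forall>b. hess S q v b = 0)}"
proof -
  have "hess S q v b = 0" if "\<forall>y. psi S q y = 0 \<longrightarrow> hess S q v (cnj_vec y) = 0" for v b
  proof -
    let ?y = "hol_section S (\<lambda>_. cnj_vec b) q"
    have "hess S q v (cnj_vec ?y) = hess S q v b"
      unfolding hess_def by (rule diff2_cong) (auto simp: hol_section_def e_eq_iff)
    then show ?thesis using that psi_hol_section by metis
  qed
  moreover have "levi_kernel (hypersurface e n S) q =
    {v \<in> hol_tangent (hypersurface e n S) q. \<forall>y\<in>hol_tangent (hypersurface e n S) q. hess S q v (cnj_vec y) = 0}"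
    unfolding levi_kernel_def
    by (intro Collect_cong conj_cong refl ball_cong levi_form_eq_iff[OF q]) (simp_all add: hol_tangent_eq[OF q])
  ultimately show ?thesis
    by (auto simp: hol_tangent_eq[OF q])
qed

end

subsection \<open>The Levi kernel and its adjoint action\<close>

lemma sum_symmetric_swap:
  fixes m :: "'a \<Rightarrow> 'a \<Rightarrow> 'b::comm_ring_1"
  assumes "\<And>j k. j \<in> I \<Longrightarrow> k \<in> I \<Longrightarrow> m j k = m k j"
  shows "(\<Sum>j\<in>I. \<Sum>k\<in>I. m j k * (f j * g k + g j * f k)) = (\<Sum>j\<in>I. f j * (2 * (\<Sum>k\<in>I. m j k * g k)))"
proof -
  have "(\<Sum>j\<in>I. \<Sum>k\<in>I. m j k * (g j * f k)) = (\<Sum>k\<in>I. \<Sum>j\<in>I. m j k * (g j * f k))"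
    by (rule sum.swap)
  also have "\<dots> = (\<Sum>j\<in>I. \<Sum>k\<in>I. m j k * (f j * g k))"
    using assms by (intro sum.cong refl) (simp add: mult_ac)
  finally show ?thesis
    by (simp add: distrib_left sum.distrib sum_distrib_left mult_ac)
qed

lemma dim_one_obtain:
  fixes K :: "(complex^'m) set"
  assumes "vec.dim K = 1"
  obtains b where "b \<noteq> 0" "b \<in> K" "\<And>v. v \<in> K \<Longrightarrow> \<exists>c. v = c *s b"
proof -
  obtain B where B: "B \<subseteq> K" "vec.independent B" "K \<subseteq> vec.span B" "card B = 1"
    using vec.basis_exists[of K] assms by metis
  then obtain b where b: "B = {b}" by (auto simp: card_1_singleton_iff)
  show thesis
  proof (rule that)
    show "b \<noteq> 0" using B(2) b by (metis insertI1 vec.dependent_zero)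
    show "b \<in> K" using B(1) b by simp
    show "\<exists>c. v = c *s b" if "v \<in> K" for v
      using B(3) b that by (auto simp: vec.span_singleton)
  qed
qed

lemma dim_one_intro:
  fixes K :: "(complex^'m) set"
  assumes "b \<noteq> 0" "b \<in> K" "\<And>v. v \<in> K \<Longrightarrow> \<exists>c. v = c *s b"
  shows "vec.dim K = 1"
proof (rule vec.dim_unique[of "{b}"])
  show "K \<subseteq> vec.span {b}"
    using assms(3) by (auto simp: vec.span_singleton)
  show "vec.independent {b}"
    using assms(1) by (simp add: vec.independent_insert vec.independent_empty)
qed (use assms in auto)

text \<open>Euler's identity for a monomial of degree \<open>n - j - k\<close>; beyond the
  antidiagonal both sides vanish.\<close>

lemma coef'_scale: "t * coef' n S t j k = (real n - real j - real k) * coef n S t j k"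
proof (cases "j + k \<le> n")
  case True
  then obtain d where d: "n = j + k + d" by (metis le_add_diff_inverse)
  then show ?thesis by (cases d) (auto simp: coef_def coef'_def)
qed (simp add: coef_def coef'_def)

lemma coef''_scale:
  "t ^ 2 * coef'' n S t j k = (real n - real j - real k) * (real n - real j - real k - 1) * coef n S t j k"
proof (cases "j + k \<le> n")
  case True
  then obtain d where d: "n = j + k + d" by (metis le_add_diff_inverse)
  consider "d = 0" | "d = 1" | c where "d = Suc (Suc c)" by (metis One_nat_def not0_implies_Suc)
  then show ?thesis
    by cases (auto simp: d coef_def coef''_def power2_eq_square algebra_simps)
qed (simp add: coef_def coef''_def)

context tube
begin

definition sym_coef :: "(nat \<Rightarrow> nat \<Rightarrow> real) \<Rightarrow> bool"
  where "sym_coef S \<longleftrightarrow> (\<forall>j\<in>{1..<n}. \<forall>k\<in>{1..<n}. S j k = S k j)"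

lemma sym_coef_iff: "sym_coef S \<longleftrightarrow> symmetric_matrix n S"
proof -
  have "{1..n - 1} = {1..<n}" using n_gt by auto
  then show ?thesis by (simp add: sym_coef_def symmetric_matrix_def)
qed

lemma coef_sym:
  assumes "sym_coef S" "j \<in> {1..<n}" "k \<in> {1..<n}"
  shows "coef n S t j k = coef n S t k j" "coef' n S t j k = coef' n S t k j"
    "coef'' n S t j k = coef'' n S t k j"
proof -
  have "S j k = S k j" "n - j - k = n - k - j" "j + k = k + j"
    using assms unfolding sym_coef_def by auto
  then show "coef n S t j k = coef n S t k j" "coef' n S t j k = coef' n S t k j"
    "coef'' n S t j k = coef'' n S t k j"
    unfolding coef_def coef'_def coef''_def by metis+
qed

definition ax :: "nat \<Rightarrow> complex^'m"
  where "ax i = mk (\<lambda>j. if j = i then 1 else 0)"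

lemma ax_nth: "j \<le> n \<Longrightarrow> ax i $ e j = (if j = i then 1 else 0)"
  by (simp add: ax_def mk_nth)

text \<open>Half the coefficient of \<open>b $ e i\<close> in \<open>hess S q v b\<close>, that is,
  entry \<open>i\<close> of \<open>A v + v\<^sub>n A' x\<close>; \<open>last_row\<close> below is
  the coefficient of \<open>b $ e n\<close>.\<close>

definition row :: "(nat \<Rightarrow> nat \<Rightarrow> real) \<Rightarrow> complex^'m \<Rightarrow> complex^'m \<Rightarrow> nat \<Rightarrow> complex"
  where "row S q v i = (\<Sum>k\<in>{1..<n}. of_real (coef n S (re q n) i k) * v $ e k
    + of_real (coef' n S (re q n) i k * re q k) * v $ e n)"

definition last_row :: "(nat \<Rightarrow> nat \<Rightarrow> real) \<Rightarrow> complex^'m \<Rightarrow> complex^'m \<Rightarrow> complex"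
  where "last_row S q v = (\<Sum>j\<in>{1..<n}. \<Sum>k\<in>{1..<n}. of_real (re q j) * (
      2 * (of_real (coef' n S (re q n) j k) * v $ e k)
      + of_real (coef'' n S (re q n) j k * re q k) * v $ e n))"

lemma hess_expand:
  assumes "sym_coef S"
  shows "hess S q v b = (\<Sum>i\<in>{1..<n}. b $ e i * (2 * row S q v i)) + b $ e n * last_row S q v"
proof -
  let ?A = "\<lambda>j k. complex_of_real (coef n S (re q n) j k)"
  let ?B = "\<lambda>j k. complex_of_real (coef' n S (re q n) j k)"
  let ?C = "\<lambda>j k. complex_of_real (coef'' n S (re q n) j k)"
  let ?x = "\<lambda>j. complex_of_real (re q j)"
  have "hess S q v b = (\<Sum>j\<in>{1..<n}. \<Sum>k\<in>{1..<n}. ?A j k * (b $ e j * v $ e k + v $ e j * b $ e k))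
     + v $ e n * (\<Sum>j\<in>{1..<n}. \<Sum>k\<in>{1..<n}. ?B j k * (b $ e j * ?x k + ?x j * b $ e k))
     + b $ e n * (\<Sum>j\<in>{1..<n}. \<Sum>k\<in>{1..<n}. ?B j k * (?x j * v $ e k + v $ e j * ?x k))
     + b $ e n * (\<Sum>j\<in>{1..<n}. \<Sum>k\<in>{1..<n}. ?C j k * v $ e n * (?x j * ?x k))"
    unfolding hess_def diff2_def sum_distrib_left sum.distrib[symmetric]
    by (intro sum.cong refl) (simp add: algebra_simps)
  also have "(\<Sum>j\<in>{1..<n}. \<Sum>k\<in>{1..<n}. ?A j k * (b $ e j * v $ e k + v $ e j * b $ e k))
     = (\<Sum>j\<in>{1..<n}. b $ e j * (2 * (\<Sum>k\<in>{1..<n}. ?A j k * v $ e k)))"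
    using coef_sym[OF assms] by (intro sum_symmetric_swap) simp
  also have "(\<Sum>j\<in>{1..<n}. \<Sum>k\<in>{1..<n}. ?B j k * (b $ e j * ?x k + ?x j * b $ e k))
     = (\<Sum>j\<in>{1..<n}. b $ e j * (2 * (\<Sum>k\<in>{1..<n}. ?B j k * ?x k)))"
    using coef_sym[OF assms] by (intro sum_symmetric_swap) simp
  also have "(\<Sum>j\<in>{1..<n}. \<Sum>k\<in>{1..<n}. ?B j k * (?x j * v $ e k + v $ e j * ?x k))
     = (\<Sum>j\<in>{1..<n}. ?x j * (2 * (\<Sum>k\<in>{1..<n}. ?B j k * v $ e k)))"
    using coef_sym[OF assms] by (intro sum_symmetric_swap) simp
  finally show ?thesis
    unfolding row_def last_row_def by (simp add: algebra_simps sum_distrib_left sum.distrib)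
qed

text \<open>At points of the hypersurface this is the Levi kernel, but it makes sense for every
  \<open>q\<close>, so kernel sections can be written down on the whole space.\<close>

definition ker :: "(nat \<Rightarrow> nat \<Rightarrow> real) \<Rightarrow> complex^'m \<Rightarrow> (complex^'m) set"
  where "ker S q = {v. psi S q v = 0 \<and> (\<forall>b. hess S q v b = 0)}"

lemma ker_iff:
  assumes "sym_coef S"
  shows "v \<in> ker S q \<longleftrightarrow> psi S q v = 0 \<and> (\<forall>i\<in>{1..<n}. row S q v i = 0) \<and> last_row S q v = 0"
proof -
  have "row S q v i = 0" if "\<forall>b. hess S q v b = 0" "i \<in> {1..<n}" for i
  proof -
    have "(\<Sum>j\<in>{1..<n}. ax i $ e j * (2 * row S q v j)) = (\<Sum>j\<in>{1..<n}. if j = i then 2 * row S q v i else 0)"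
      by (intro sum.cong refl) (auto simp: ax_nth)
    then show ?thesis
      using that hess_expand[OF assms, of q v "ax i"] by (simp add: ax_nth)
  qed
  moreover have "last_row S q v = 0" if "\<forall>b. hess S q v b = 0"
  proof -
    have "(\<Sum>j\<in>{1..<n}. ax n $ e j * (2 * row S q v j)) = 0"
      by (intro sum.neutral) (auto simp: ax_nth)
    then show ?thesis
      using hess_expand[OF assms, of q v "ax n"] that by (simp add: ax_nth)
  qed
  ultimately show ?thesis
    by (auto simp: ker_def hess_expand[OF assms])
qed

lemma levi_kernel_ker: "q \<in> hypersurface e n S \<Longrightarrow> levi_kernel (hypersurface e n S) q = ker S q"
  by (simp add: levi_kernel_eq ker_def)

section \<open>The kernel when the columns are proportional\<close>

lemma column_chain_anti:
  assumes "column_chain n S r" "j \<in> {1..<n}"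
  shows "coef n S t (n - j) j \<noteq> 0" "coef n S t j (n - j) \<noteq> 0"
proof -
  have "n - j \<in> {1..<n}" using assms(2) by auto
  then have "S (n - j) (n - (n - j)) \<noteq> 0" "S j (n - j) \<noteq> 0"
    using assms unfolding column_chain_def by blast+
  then show "coef n S t (n - j) j \<noteq> 0" "coef n S t j (n - j) \<noteq> 0"
    using assms(2) by (auto simp: coef_def)
qed

text \<open>The entries of \<open>N x\<close>; kernel vectors are the multiples of
  \<open>(- N x, 1)\<close> in the coordinates 1 to \<open>n\<close>. \<open>dslope\<close> below is
  the differential, extended complex linearly.\<close>

definition slope :: "(nat \<Rightarrow> real) \<Rightarrow> complex^'m \<Rightarrow> nat \<Rightarrow> real"
  where "slope r q j = (\<Sum>k\<in>{1..<n}. kernel_matrix r (re q n) j k * re q k)"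

definition dslope :: "(nat \<Rightarrow> real) \<Rightarrow> complex^'m \<Rightarrow> nat \<Rightarrow> complex^'m \<Rightarrow> complex"
  where "dslope r q j y = (\<Sum>k\<in>{1..<n}. of_real (kernel_matrix r (re q n) j k) * y $ e k
    + of_real (kernel_matrix' r (re q n) j k * re q k) * y $ e n)"

text \<open>Since \<open>A N = A'\<close>, the vector \<open>A v + v\<^sub>n A' x\<close> is
  \<open>A (v + v\<^sub>n N x)\<close>.\<close>

lemma row_slope:
  assumes "column_chain n S r" "i \<in> {1..<n}"
  shows "row S q v i = (\<Sum>j\<in>{1..<n}. of_real (coef n S (re q n) i j) * (v $ e j + v $ e n * of_real (slope r q j)))"
proof -
  have "(\<Sum>j\<in>{1..<n}. coef n S (re q n) i j * slope r q j)
      = (\<Sum>k\<in>{1..<n}. (\<Sum>j\<in>{1..<n}. coef n S (re q n) i j * kernel_matrix r (re q n) j k) * re q k)"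
    unfolding slope_def sum_distrib_left sum_distrib_right
    by (subst sum.swap) (simp add: mult.assoc)
  also have "\<dots> = (\<Sum>k\<in>{1..<n}. coef' n S (re q n) i k * re q k)"
    using sum_coef_kernel_matrix[OF assms] by (intro sum.cong) auto
  finally have "(\<Sum>j\<in>{1..<n}. of_real (coef n S (re q n) i j * slope r q j))
      = complex_of_real (\<Sum>k\<in>{1..<n}. coef' n S (re q n) i k * re q k)"
    by (metis of_real_sum)
  then show ?thesis
    by (simp add: row_def distrib_left sum.distrib mult.left_commute[of _ "v $ e n"]
        flip: sum_distrib_left sum_distrib_right)
qed

text \<open>The rows say \<open>A (v + v\<^sub>n N x) = 0\<close>, and \<open>A\<close> is
  injective. The last row then follows from \<open>2 A' N = A''\<close>.\<close>

lemma ker_chain: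
  assumes S: "sym_coef S" and r: "column_chain n S r"
  shows "v \<in> ker S q \<longleftrightarrow> psi S q v = 0 \<and> (\<forall>j\<in>{1..<n}. v $ e j + v $ e n * of_real (slope r q j) = 0)"
proof
  assume v: "v \<in> ker S q"
  have "v $ e j + v $ e n * of_real (slope r q j) = 0" if "j \<in> {1..<n}" for j
  proof (rule antitriangular_inj[where a = "\<lambda>i j. complex_of_real (coef n S (re q n) i j)" and n = n and j = j and
        w = "\<lambda>j. v $ e j + v $ e n * of_real (slope r q j)"])
    show "(\<Sum>j\<in>{1..<n}. complex_of_real (coef n S (re q n) i j) * (v $ e j + v $ e n * of_real (slope r q j))) = 0"
      if "i \<in> {1..<n}" for i
      using v that unfolding row_slope[OF r that, symmetric] by (simp add: ker_iff[OF S])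
  qed (use that column_chain_anti[OF r] in \<open>auto simp: coef_def\<close>)
  then show "psi S q v = 0 \<and> (\<forall>j\<in>{1..<n}. v $ e j + v $ e n * of_real (slope r q j) = 0)"
    using v by (simp add: ker_iff[OF S])
next
  assume v: "psi S q v = 0 \<and> (\<forall>j\<in>{1..<n}. v $ e j + v $ e n * of_real (slope r q j) = 0)"
  have "row S q v i = 0" if "i \<in> {1..<n}" for i
    using v by (simp add: row_slope[OF r that])
  moreover have "last_row S q v = 0"
  proof -
    have "(\<Sum>k\<in>{1..<n}. 2 * (of_real (coef' n S (re q n) j k) * v $ e k)
       + of_real (coef'' n S (re q n) j k * re q k) * v $ e n) = 0" if j: "j \<in> {1..<n}" for j
    proof -
      have "2 * (\<Sum>k\<in>{1..<n}. coef' n S (re q n) j k * slope r q k)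
          = (\<Sum>l\<in>{1..<n}. (2 * (\<Sum>k\<in>{1..<n}. coef' n S (re q n) j k * kernel_matrix r (re q n) k l)) * re q l)"
        unfolding slope_def sum_distrib_left sum_distrib_right
        by (subst sum.swap) (simp add: mult.assoc)
      also have "\<dots> = (\<Sum>l\<in>{1..<n}. coef'' n S (re q n) j l * re q l)"
        using sum_coef'_kernel_matrix[OF r j] by (intro sum.cong) auto
      finally have *: "(\<Sum>k\<in>{1..<n}. 2 * (coef' n S (re q n) j k * slope r q k)) = \<dots>"
        by (simp add: sum_distrib_left)
      have "(\<Sum>k\<in>{1..<n}. 2 * (of_real (coef' n S (re q n) j k) * v $ e k))
          = (\<Sum>k\<in>{1..<n}. of_real (2 * (coef' n S (re q n) j k * slope r q k)) * (- v $ e n))"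
        using v by (intro sum.cong refl) (auto simp: eq_neg_iff_add_eq_0[symmetric])
      also have "\<dots> = complex_of_real (\<Sum>l\<in>{1..<n}. coef'' n S (re q n) j l * re q l) * (- v $ e n)"
        unfolding *[symmetric] of_real_sum sum_distrib_right ..
      finally show ?thesis
        by (simp add: sum.distrib flip: sum_distrib_right)
    qed
    then show ?thesis
      unfolding last_row_def by (simp flip: sum_distrib_left)
  qed
  ultimately show "v \<in> ker S q"
    using v by (simp add: ker_iff[OF S])
qed

definition ker_section :: "(nat \<Rightarrow> nat \<Rightarrow> real) \<Rightarrow> (nat \<Rightarrow> real) \<Rightarrow> complex \<Rightarrow> complex^'m \<Rightarrow> complex^'m"
  where "ker_section S r c = hol_section S (\<lambda>p. mk (\<lambda>j. if j = n then c else - c * of_real (slope r p j)))"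

lemma ker_section_nth:
  "1 \<le> j \<Longrightarrow> j \<le> n \<Longrightarrow> ker_section S r c p $ e j = (if j = n then c else - c * of_real (slope r p j))"
  by (simp add: ker_section_def hol_section_def e_eq_iff mk_nth)

lemma ker_section_in:
  assumes "sym_coef S" "column_chain n S r"
  shows "ker_section S r c p \<in> ker S p"
proof -
  have "psi S p (ker_section S r c p) = 0"
    by (simp add: ker_section_def psi_hol_section)
  then show ?thesis
    using n_gt by (simp add: ker_chain[OF assms] ker_section_nth)
qed

lemma psi_zero_eq:
  assumes "psi S q v = 0" "psi S q w = 0" "\<And>j. 1 \<le> j \<Longrightarrow> j \<le> n \<Longrightarrow> v $ e j = w $ e j"
  shows "v = w"
proof (rule co_eqI)
  fix j assume "j \<le> n"
  have "diff1 n S (re q) (co v) = diff1 n S (re q) (co w)"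
    using assms(3) by (intro diff1_cong) auto
  then show "v $ e j = w $ e j"
    using assms \<open>j \<le> n\<close> by (cases "j = 0") (auto simp: psi_def)
qed

lemma ker_eq_iff:
  assumes S: "sym_coef S" and r: "column_chain n S r" and v: "v \<in> ker S q" "w \<in> ker S q" "v $ e n = w $ e n"
  shows "v = w"
proof (rule psi_zero_eq)
  fix j assume "1 \<le> j" "j \<le> n"
  then show "v $ e j = w $ e j"
    using v by (cases "j = n") (auto simp: ker_chain[OF S r] add_eq_0_iff2)
qed (use v in \<open>auto simp: ker_def\<close>)

lemma ker_section_id:
  assumes "sym_coef S" "column_chain n S r" "v \<in> ker S q"
  shows "ker_section S r (v $ e n) q = v"
  using n_gt by (intro ker_eq_iff[OF assms(1,2) ker_section_in[OF assms(1,2)] assms(3)])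
    (simp add: ker_section_nth)

lemma ker_scale: "v \<in> ker S q \<Longrightarrow> c *s v \<in> ker S q"
  by (auto simp: ker_def psi_scale hess_scale)

lemma zero_in_ker: "0 \<in> ker S q"
  using psi_scale[of S q 0 0] hess_scale[of S q 0 0] by (simp add: ker_def)

lemma levi_kernel_rank_chain:
  assumes S: "sym_coef S" "column_chain n S r"
  shows "levi_kernel_rank (hypersurface e n S) 1"
  unfolding levi_kernel_rank_def
proof
  fix q assume q: "q \<in> hypersurface e n S"
  show "vec.dim (levi_kernel (hypersurface e n S) q) = 1"
    unfolding levi_kernel_ker[OF q]
  proof (rule dim_one_intro)
    have *: "ker_section S r 1 q $ e n = 1"
      using n_gt by (simp add: ker_section_nth)
    then show "ker_section S r 1 q \<noteq> 0" by auto
    show "ker_section S r 1 q \<in> ker S q"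
      by (rule ker_section_in[OF S])
    show "\<exists>c. v = c *s ker_section S r 1 q" if v: "v \<in> ker S q" for v
      by (rule exI[of _ "v $ e n"], rule ker_eq_iff[OF S v])
        (simp_all add: * ker_scale ker_section_in[OF S])
  qed
qed

text \<open>With last coordinate zero the rows reduce to \<open>A v = 0\<close>. Only the
  antidiagonal enters, so this is available before the columns are known to be proportional.\<close>

lemma ker_nonzero_nth:
  assumes S: "sym_coef S" and anti: "\<And>j. j \<in> {1..<n} \<Longrightarrow> S j (n - j) \<noteq> 0"
    and v: "v \<in> ker S q" "v \<noteq> 0"
  shows "v $ e n \<noteq> 0"
proof
  assume n0: "v $ e n = 0"
  have "v $ e j = 0" if "j \<in> {1..<n}" for j
  proof (rule antitriangular_inj[where a = "\<lambda>i j. complex_of_real (coef n S (re q n) i j)" and n = n and j = j and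
        w = "\<lambda>j. v $ e j"])
    show "(\<Sum>j\<in>{1..<n}. complex_of_real (coef n S (re q n) i j) * v $ e j) = 0" if "i \<in> {1..<n}" for i
      using v that by (simp add: ker_iff[OF S] row_def n0)
    show "complex_of_real (coef n S (re q n) (n - j) j) \<noteq> 0" if "j \<in> {1..<n}" for j
      using anti[of "n - j"] that by (auto simp: coef_def Suc_le_eq)
  qed (use that in \<open>auto simp: coef_def\<close>)
  then have "v $ e j = 0 $ e j" if "1 \<le> j" "j \<le> n" for j
    using n0 that by (cases "j = n") auto
  then have "v = 0"
    using v zero_in_ker by (intro psi_zero_eq[of S q]) (auto simp: ker_def)
  with v show False by simp
qed

text \<open>
  Only points arbitrarily close to the origin are needed, so that this also applies to the
  germ of a hypersurface.
\<close>
lemma column_chain_of_ker: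
  assumes S: "sym_coef S"
    and at0: "\<And>v j. v \<in> ker S 0 \<Longrightarrow> j \<in> {1..<n} \<Longrightarrow> v $ e j = 0"
    and t: "t \<noteq> 0" and s: "s \<noteq> 0"
    and near: "\<And>i k. i \<in> {1..<n} \<Longrightarrow> k \<in> {1..<n} \<Longrightarrow> \<exists>q v. v \<in> ker S q \<and> v \<noteq> 0 \<and> re q n = t \<and>
      (\<forall>j\<in>{1..<n}. re q j = s * ((if j = i then 1 else 0) + (if j = k then 1 else 0)))"
  shows "\<exists>r. column_chain n S r"
proof -
  \<comment> \<open>At the origin \<open>A\<close> is the bare antidiagonal and all terms containing
    \<open>x\<close> vanish, so a zero at \<open>(j, n - j)\<close> would put
    \<open>ax (n - j)\<close> into the kernel.\<close>
  have anti: "S j (n - j) \<noteq> 0" if j: "j \<in> {1..<n}" for j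
  proof
    assume z: "S j (n - j) = 0"
    have re0: "re 0 j = 0" for j by (simp add: re_def)
    have "coef n S 0 i (n - j) = 0" if "i \<in> {1..<n}" for i
      using z j that by (cases "i = j") (auto simp: coef_def)
    then have "row S 0 (ax (n - j)) i = 0" if "i \<in> {1..<n}" for i
      using that unfolding row_def by (intro sum.neutral) (auto simp: re0 ax_nth)
    moreover have "last_row S 0 (ax (n - j)) = 0"
      by (simp add: last_row_def re0)
    moreover have "psi S 0 (ax (n - j)) = 0"
      using j by (simp add: psi_def diff1_def re0 ax_nth)
    ultimately have "ax (n - j) \<in> ker S 0"
      by (simp add: ker_iff[OF S])
    then show False
      using at0[of "ax (n - j)" "n - j"] j by (auto simp: ax_nth Suc_le_eq)
  qed
  let ?A = "coef n S t" and ?B = "coef' n S t" and ?C = "coef'' n S t"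
  have upper: "?A i j = 0" if "n < i + j" for i j
    using that by (simp add: coef_def)
  have anti_coef: "?A (n - j) j \<noteq> 0" "?A j (n - j) \<noteq> 0" if "j \<in> {1..<n}" for j
    using anti[of j] anti[of "n - j"] that by (auto simp: coef_def Suc_le_eq)
  \<comment> \<open>The kernel equations at \<open>x = s (e\<^sub>i + e\<^sub>k)\<close> for the
    real part of a kernel vector normalised to last coordinate 1; the last equation is divided by
    \<open>s\<close>.\<close>
  have null: "\<exists>w. (\<forall>l\<in>{1..<n}. (\<Sum>j\<in>{1..<n}. ?A l j * w j) = - s * (?B l i + ?B l k)) \<and>
      2 * (\<Sum>j\<in>{1..<n}. (?B i j + ?B k j) * w j) = - s * (?C i i + ?C i k + ?C k i + ?C k k)"
    if ik: "i \<in> {1..<n}" "k \<in> {1..<n}" for i k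
  proof -
    obtain q v where v: "v \<in> ker S q" "v \<noteq> 0" and q: "re q n = t"
      "\<And>j. j \<in> {1..<n} \<Longrightarrow> re q j = s * ((if j = i then 1 else 0) + (if j = k then 1 else 0))"
      using near[OF ik] by blast
    have vn: "v $ e n \<noteq> 0"
      by (rule ker_nonzero_nth[OF S anti v])
    define w where "w = (1 / v $ e n) *s v"
    have w: "w \<in> ker S q" "w $ e n = 1"
      using ker_scale[OF v(1)] vn by (auto simp: w_def)
    have pick: "(\<Sum>j\<in>{1..<n}. f j * re q j) = s * (f i + f k)" for f
    proof -
      have "(\<Sum>j\<in>{1..<n}. f j * re q j)
        = (\<Sum>j\<in>{1..<n}. (if j = i then s * f j else 0) + (if j = k then s * f j else 0))"
        using q(2) by (intro sum.cong) auto
      then show ?thesis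
        using ik by (simp add: sum.distrib distrib_left)
    qed
    show ?thesis
    proof (intro exI[of _ "\<lambda>j. Re (w $ e j)"] conjI ballI)
      fix l assume l: "l \<in> {1..<n}"
      have "Re (row S q w l) = (\<Sum>j\<in>{1..<n}. ?A l j * Re (w $ e j)) + (\<Sum>j\<in>{1..<n}. ?B l j * re q j)"
        by (simp add: row_def q w sum.distrib)
      then show "(\<Sum>j\<in>{1..<n}. ?A l j * Re (w $ e j)) = - s * (?B l i + ?B l k)"
        using w(1) l pick[of "?B l"] by (simp add: ker_iff[OF S])
    next
      let ?f = "\<lambda>j. 2 * (\<Sum>k\<in>{1..<n}. ?B j k * Re (w $ e k)) + (\<Sum>k\<in>{1..<n}. ?C j k * re q k)"
      have "Re (last_row S q w) = (\<Sum>j\<in>{1..<n}. ?f j * re q j)"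
        unfolding last_row_def Re_sum
      proof (intro sum.cong refl)
        fix j
        show "(\<Sum>k\<in>{1..<n}. Re (of_real (re q j) * (2 * (of_real (coef' n S (re q n) j k) * w $ e k)
            + of_real (coef'' n S (re q n) j k * re q k) * w $ e n))) = ?f j * re q j"
          by (simp add: q(1) w(2) sum_distrib_left distrib_right flip: sum.distrib)
            (simp add: algebra_simps sum_distrib_left sum.distrib)
      qed
      also have "\<dots> = s * (?f i + ?f k)"
        by (rule pick)
      also have "\<dots> = s * (2 * (\<Sum>j\<in>{1..<n}. (?B i j + ?B k j) * Re (w $ e j)) + s * (?C i i + ?C i k + ?C k i + ?C k k))"
        unfolding pick by (simp add: sum.distrib algebra_simps)
      finally have "2 * (\<Sum>j\<in>{1..<n}. (?B i j + ?B k j) * Re (w $ e j)) + s * (?C i i + ?C i k + ?C k i + ?C k k) = 0"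
        using w(1) s by (simp add: ker_iff[OF S])
      then show "2 * (\<Sum>j\<in>{1..<n}. (?B i j + ?B k j) * Re (w $ e j)) = - s * (?C i i + ?C i k + ?C k i + ?C k k)"
        by linarith
    qed
  qed
  \<comment> \<open>The case \<open>i = k\<close> gives \<open>A w = - 2 s A' e\<^sub>k\<close>,
    hence a solution \<open>N\<close> of \<open>A N = A'\<close>, column by column.\<close>
  have "\<exists>w. (\<forall>l\<in>{1..<n}. (\<Sum>j\<in>{1..<n}. ?A l j * w j) = ?B l k)" if k: "k \<in> {1..<n}" for k
  proof -
    obtain w where w: "\<And>l. l \<in> {1..<n} \<Longrightarrow> (\<Sum>j\<in>{1..<n}. ?A l j * w j) = - s * (?B l k + ?B l k)"
      using null[OF k k] by blast
    have "(\<Sum>j\<in>{1..<n}. ?A l j * (- w j / (2 * s))) = ?B l k" if "l \<in> {1..<n}" for l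
    proof -
      have "(\<Sum>j\<in>{1..<n}. ?A l j * (- w j / (2 * s))) = (\<Sum>j\<in>{1..<n}. ?A l j * w j) * (- 1 / (2 * s))"
        unfolding sum_distrib_right by (intro sum.cong) auto
      then show ?thesis using w[OF that] s by simp
    qed
    then show ?thesis by (intro exI[of _ "\<lambda>j. - w j / (2 * s)"]) simp
  qed
  then have "\<exists>N'. \<forall>k\<in>{1..<n}. \<forall>l\<in>{1..<n}. (\<Sum>j\<in>{1..<n}. ?A l j * N' k j) = ?B l k"
    by (intro bchoice) blast
  then obtain N' where N': "\<forall>k\<in>{1..<n}. \<forall>l\<in>{1..<n}. (\<Sum>j\<in>{1..<n}. ?A l j * N' k j) = ?B l k"
    by blast
  define N where "N j k = N' k j" for j k
  have N: "(\<Sum>j\<in>{1..<n}. ?A l j * N j k) = ?B l k" if "k \<in> {1..<n}" "l \<in> {1..<n}" for k l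
    using N' that by (simp add: N_def)
  \<comment> \<open>\<open>G = A' N\<close> equals \<open>N^T A N\<close> because
    \<open>A' = A N\<close> and \<open>A\<close> is symmetric. So \<open>G\<close> is symmetric and
    determined by its quadratic form.\<close>
  define G where "G i k = (\<Sum>l\<in>{1..<n}. ?B i l * N l k)" for i k
  have G: "G i k = (\<Sum>l\<in>{1..<n}. \<Sum>m\<in>{1..<n}. ?A l m * N m i * N l k)" if "i \<in> {1..<n}" for i k
  proof -
    have "?B i l = (\<Sum>m\<in>{1..<n}. ?A l m * N m i)" if "l \<in> {1..<n}" for l
      using N[of i l] coef_sym(2)[OF S, of i l t] \<open>i \<in> {1..<n}\<close> that by simp
    then show ?thesis
      unfolding G_def by (simp add: sum_distrib_right)
  qed
  have G_sym: "G i k = G k i" if "i \<in> {1..<n}" "k \<in> {1..<n}" for i k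
  proof -
    have "G i k = (\<Sum>m\<in>{1..<n}. \<Sum>l\<in>{1..<n}. ?A l m * N m i * N l k)"
      unfolding G[OF that(1)] by (rule sum.swap)
    also have "\<dots> = G k i"
      unfolding G[OF that(2)] using coef_sym(1)[OF S] by (intro sum.cong) auto
    finally show ?thesis .
  qed
  \<comment> \<open>Injectivity of \<open>A\<close> gives
    \<open>w = - s N (e\<^sub>i + e\<^sub>k)\<close>, so the last kernel equation says that the
    quadratic forms of \<open>2 G\<close> and \<open>A''\<close> agree at
    \<open>e\<^sub>i + e\<^sub>k\<close>.\<close>
  have G_sum: "2 * (G i i + G i k + G k i + G k k) = ?C i i + ?C i k + ?C k i + ?C k k"
    if ik: "i \<in> {1..<n}" "k \<in> {1..<n}" for i k
  proof -
    obtain w where w: "\<And>l. l \<in> {1..<n} \<Longrightarrow> (\<Sum>j\<in>{1..<n}. ?A l j * w j) = - s * (?B l i + ?B l k)"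
        and w': "2 * (\<Sum>j\<in>{1..<n}. (?B i j + ?B k j) * w j) = - s * (?C i i + ?C i k + ?C k i + ?C k k)"
      using null[OF ik] by blast
    have "w j + s * (N j i + N j k) = 0" if "j \<in> {1..<n}" for j
    proof (rule antitriangular_inj[where a = ?A and n = n and j = j and w = "\<lambda>j. w j + s * (N j i + N j k)"])
      show "(\<Sum>j\<in>{1..<n}. ?A l j * (w j + s * (N j i + N j k))) = 0" if l: "l \<in> {1..<n}" for l
      proof -
        have "(\<Sum>j\<in>{1..<n}. ?A l j * (w j + s * (N j i + N j k))) = (\<Sum>j\<in>{1..<n}. ?A l j * w j)
          + s * ((\<Sum>j\<in>{1..<n}. ?A l j * N j i) + (\<Sum>j\<in>{1..<n}. ?A l j * N j k))"
          by (simp add: distrib_left sum.distrib sum_distrib_left mult_ac)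
        then show ?thesis using w[OF l] N[OF _ l] ik by simp
      qed
    qed (use upper anti_coef that in auto)
    then have "(\<Sum>j\<in>{1..<n}. (?B i j + ?B k j) * w j) = (\<Sum>j\<in>{1..<n}. (?B i j + ?B k j) * (- s * (N j i + N j k)))"
      by (intro sum.cong refl arg_cong2[where f = "(*)"]) (simp add: eq_neg_iff_add_eq_0)
    also have "\<dots> = - s * (G i i + G i k + G k i + G k k)"
      unfolding G_def sum_distrib_left sum.distrib[symmetric]
      by (intro sum.cong refl) (simp add: algebra_simps)
    finally show ?thesis using w' s by simp
  qed
  \<comment> \<open>Polarisation: the diagonal entries agree by the case
    \<open>i = k\<close>.\<close>
  have G2: "2 * G i k = ?C i k" if ik: "i \<in> {1..<n}" "k \<in> {1..<n}" for i k
  proof -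
    have "2 * G i i = ?C i i" "2 * G k k = ?C k k"
      using G_sum[of i i] G_sum[of k k] ik by auto
    then show ?thesis
      using G_sum[OF ik] G_sym[OF ik] coef_sym(3)[OF S ik, of t] by simp
  qed
  \<comment> \<open>At this \<open>t\<close> the matrix \<open>t N\<close> serves as \<nu>:
    multiplication by \<open>t\<close> and \<open>t^2\<close> turns derivatives into the integer
    weights of \<open>column_chain_of_nu\<close>.\<close>
  have "column_chain n ?A (\<lambda>m. t * N (Suc m) m)"
  proof (rule column_chain_of_nu[where \<nu> = "\<lambda>j k. t * N j k"])
    fix i k assume ik: "i \<in> {1..<n}" "k \<in> {1..<n}"
    have "(\<Sum>j\<in>{1..<n}. ?A i j * (t * N j k)) = t * ?B i k"
      unfolding N[OF ik(2,1), symmetric] sum_distrib_left by (simp only: mult_ac)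
    then show "(\<Sum>j\<in>{1..<n}. ?A i j * (t * N j k)) = (real n - real i - real k) * ?A i k"
      by (simp add: coef'_scale)
    have "2 * (\<Sum>j\<in>{1..<n}. (real n - real i - real j) * ?A i j * (t * N j k)) = 2 * (t ^ 2 * G i k)"
      unfolding G_def sum_distrib_left
      by (intro sum.cong refl) (simp add: power2_eq_square flip: coef'_scale)
    then show "2 * (\<Sum>j\<in>{1..<n}. (real n - real i - real j) * ?A i j * (t * N j k))
        = (real n - real i - real k) * (real n - real i - real k - 1) * ?A i k"
      using G2[OF ik] by (simp flip: coef''_scale)
  qed (use upper anti_coef in auto)
  \<comment> \<open>The ratio of adjacent columns of \<open>A(t)\<close> is \<open>t\<close> times
    that of \<open>S\<close>.\<close>
  then have "column_chain n S (\<lambda>m. N (Suc m) m)"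
    unfolding column_chain_def
  proof (intro conjI ballI allI impI; elim conjE)
    fix i m assume chain: "\<forall>i m. 0 < i \<and> 0 < m \<and> i + m < n \<longrightarrow> ?A i m = t * N (Suc m) m * ?A i (Suc m)"
      and im: "0 < i" "0 < m" "i + m < n"
    have "S i m * t ^ Suc (n - i - Suc m) = t * N (Suc m) m * (S i (Suc m) * t ^ (n - i - Suc m))"
      using chain im by (simp add: coef_def Suc_diff_Suc)
    then show "S i m = N (Suc m) m * S i (Suc m)"
      using t by simp
  qed (use anti in auto)
  then show ?thesis by blast
qed

section \<open>The adjoint action\<close>

lemma dslope_add: "dslope r q j (y + z) = dslope r q j y + dslope r q j z"
  by (simp add: dslope_def algebra_simps sum.distrib)

lemma dslope_scale: "dslope r q j (c *s y) = c * dslope r q j y"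
  by (simp add: dslope_def algebra_simps sum.distrib sum_distrib_left)

lemma dslope_revec: "dslope r q j (revec y) + \<i> * dslope r q j (revec (\<i> *s y)) = dslope r q j (cnj_vec y)"
proof -
  have "revec y + \<i> *s revec (\<i> *s y) = cnj_vec y"
    by (simp add: vec_eq_iff revec_def complex_eq_iff)
  then show ?thesis
    by (metis dslope_add dslope_scale)
qed

lemma has_derivative_slope:
  "((\<lambda>p. complex_of_real (slope r p j)) has_derivative (\<lambda>b. dslope r q j (revec b))) (at q)"
proof -
  have "((\<lambda>p. slope r p j) has_derivative (\<lambda>b. \<Sum>k\<in>{1..<n}. kernel_matrix r (re q n) j k * Re (b $ e k)
      + kernel_matrix' r (re q n) j k * Re (b $ e n) * re q k)) (at q)"
    unfolding slope_def
    by (intro has_derivative_sum has_derivative_mult has_derivative_kernel_matrix has_derivative_re)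
  from has_derivative_of_real[OF this] show ?thesis
    by (simp add: dslope_def revec_def mult_ac)
qed

text \<open>Along \<open>(- N x, 1)\<close> the differential of \<open>N x\<close> is a multiple of
  \<open>N' x - N N x\<close>, which vanishes by \<open>kernel_matrix_square\<close>. This makes
  \<open>ad\<close> well defined on cosets.\<close>

lemma dslope_ker:
  assumes S: "sym_coef S" and r: "column_chain n S r" and v: "v \<in> ker S q" and j: "j \<in> {1..<n}"
  shows "dslope r q j (cnj_vec v) = 0"
proof -
  have vk: "v $ e k = - v $ e n * of_real (slope r q k)" if "k \<in> {1..<n}" for k
    using v that by (auto simp: ker_chain[OF S r] add_eq_0_iff2)
  have "(\<Sum>k\<in>{1..<n}. kernel_matrix r (re q n) j k * slope r q k)
      = (\<Sum>l\<in>{1..<n}. (\<Sum>k\<in>{1..<n}. kernel_matrix r (re q n) j k * kernel_matrix r (re q n) k l) * re q l)"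
    unfolding slope_def sum_distrib_left sum_distrib_right
    by (subst sum.swap) (simp add: mult.assoc)
  also have "\<dots> = (\<Sum>l\<in>{1..<n}. kernel_matrix' r (re q n) j l * re q l)"
    by (intro sum.cong refl) (simp only: kernel_matrix_square[OF j])
  finally have *: "(\<Sum>k\<in>{1..<n}. kernel_matrix r (re q n) j k * slope r q k) = \<dots>" .
  have "dslope r q j (cnj_vec v) = (\<Sum>k\<in>{1..<n}. (of_real (kernel_matrix' r (re q n) j k * re q k)
      - of_real (kernel_matrix r (re q n) j k * slope r q k)) * cnj (v $ e n))"
    unfolding dslope_def by (intro sum.cong refl) (auto simp: vk algebra_simps)
  also have "\<dots> = (of_real (\<Sum>k\<in>{1..<n}. kernel_matrix' r (re q n) j k * re q k)
      - of_real (\<Sum>k\<in>{1..<n}. kernel_matrix r (re q n) j k * slope r q k)) * cnj (v $ e n)"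
    by (simp only: of_real_sum sum_subtractf flip: sum_distrib_right)
  finally show ?thesis unfolding * by simp
qed

text \<open>Differentiates the kernel equation
  \<open>V\<^sub>j + V\<^sub>n (N x)\<^sub>j = 0\<close> along the antiholomorphic direction of
  \<open>y\<close>.\<close>

lemma ker_dbar:
  assumes S: "sym_coef S" and r: "column_chain n S r" and q: "q \<in> hypersurface e n S"
    and V: "(V has_derivative V') (at q)" and U: "open U" "q \<in> U"
    and sec: "\<And>p. p \<in> hypersurface e n S \<Longrightarrow> p \<in> U \<Longrightarrow> V p \<in> ker S p"
    and y: "psi S q y = 0" and j: "j \<in> {1..<n}"
  shows "dbar V' y $ e j + dbar V' y $ e n * of_real (slope r q j) = - (V q $ e n / 2 * dslope r q j (cnj_vec y))"
proof -
  have "((\<lambda>p. V p $ e j + V p $ e n * of_real (slope r p j)) has_derivative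
     (\<lambda>b. V' b $ e j + (V q $ e n * dslope r q j (revec b) + V' b $ e n * of_real (slope r q j)))) (at q)"
    by (intro has_derivative_add has_derivative_mult has_derivative_nth V has_derivative_slope)
  from tangent_derivative_zero[OF this U]
  have "V' b $ e j + (V q $ e n * dslope r q j (revec b) + V' b $ e n * of_real (slope r q j)) = 0"
    if "b \<in> tangent_space (hypersurface e n S) q" for b
    using sec that j ker_chain[OF S r] by blast
  then have *: "V' b $ e j = - V q $ e n * dslope r q j (revec b) - V' b $ e n * of_real (slope r q j)"
    if "b \<in> tangent_space (hypersurface e n S) q" for b
    using that by (simp add: algebra_simps eq_neg_iff_add_eq_0)
  show ?thesis
    unfolding dbar_def dslope_revec[symmetric]
    by (simp only: vector_smult_component vector_add_component
        *[OF hol_tangent_in_tangent(1)[OF q y]] *[OF hol_tangent_in_tangent(2)[OF q y]])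
      (simp add: algebra_simps)
qed

text \<open>Among tangent vectors the functionals \<open>w\<^sub>j + w\<^sub>n (N x)\<^sub>j\<close>
  vanish together exactly on the kernel, so they are coordinates on the quotient;
  \<open>ker_dbar\<close> evaluates them on the bracket.\<close>

lemma ad_eq:
  assumes S: "sym_coef S" and r: "column_chain n S r" and q: "q \<in> hypersurface e n S"
    and v: "v \<in> ker S q" and c: "psi S q c = 0"
  shows "ad (hypersurface e n S) q v ((+) c ` ker S q) =
    {w. psi S q w = 0 \<and>
      (\<forall>j\<in>{1..<n}. w $ e j + w $ e n * of_real (slope r q j) = v $ e n / 2 * dslope r q j (cnj_vec c))}"
    (is "?L = ?R")
proof (intro set_eqI iffI)
  let ?M = "hypersurface e n S"
  fix w assume "w \<in> ?L"
  then obtain V X where "w \<in> hol_tangent ?M q"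
    and V: "local_section ?M (levi_kernel ?M) q V" "V q = v"
    and X: "local_section ?M (hol_tangent ?M) q X" "X q \<in> (+) c ` ker S q"
    and "bracket_bar V X q - (w, 0) \<in> levi_kernel ?M q \<times> cnj_vec ` hol_tangent ?M q"
    unfolding ad_def by (elim CollectE conjE exE) (rule that; assumption)
  then have w: "psi S q w = 0" and br: "fst (bracket_bar V X q - (w, 0)) \<in> ker S q"
    by (auto simp: hol_tangent_eq[OF q] levi_kernel_ker[OF q] mem_Times_iff)
  obtain U V' where U: "open U" "q \<in> U" "(V has_derivative V') (at q)" "\<And>p. p \<in> ?M \<Longrightarrow> p \<in> U \<Longrightarrow> V p \<in> levi_kernel ?M p"
    using local_section_derivative[OF V(1)] by metis
  obtain X' where X': "(X has_derivative X') (at q)"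
    using local_section_derivative[OF X(1)] by metis
  obtain \<kappa> where \<kappa>: "\<kappa> \<in> ker S q" "X q = c + \<kappa>" using X(2) by auto
  have psiX: "psi S q (X q) = 0"
    using \<kappa> c by (simp add: psi_add ker_def)
  have u: "- dbar V' (X q) - w \<in> ker S q"
    using br by (simp add: bracket_bar_eq[OF U(3) X'])
  have "w $ e j + w $ e n * of_real (slope r q j) = v $ e n / 2 * dslope r q j (cnj_vec c)" if j: "j \<in> {1..<n}" for j
  proof -
    have "dbar V' (X q) $ e j + dbar V' (X q) $ e n * of_real (slope r q j)
        = - (v $ e n / 2 * dslope r q j (cnj_vec (X q)))"
      using ker_dbar[OF S r q U(3,1,2) _ psiX j] U(4) V(2) by (simp add: levi_kernel_ker)
    moreover have "cnj_vec (X q) = cnj_vec c + cnj_vec \<kappa>"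
      by (simp add: \<kappa> vec_eq_iff)
    then have "dslope r q j (cnj_vec (X q)) = dslope r q j (cnj_vec c)"
      using dslope_ker[OF S r \<kappa>(1) j] by (simp add: dslope_add)
    moreover have "(- dbar V' (X q) - w) $ e j + (- dbar V' (X q) - w) $ e n * of_real (slope r q j) = 0"
      using u j ker_chain[OF S r] by blast
    moreover have "w $ e j + w $ e n * of_real (slope r q j)
        = - (dbar V' (X q) $ e j + dbar V' (X q) $ e n * of_real (slope r q j))
          - ((- dbar V' (X q) - w) $ e j + (- dbar V' (X q) - w) $ e n * of_real (slope r q j))"
      by (simp add: algebra_simps)
    ultimately show ?thesis by (simp only: minus_minus diff_zero)
  qed
  then show "w \<in> ?R" using w by simp
next
  let ?M = "hypersurface e n S"
  fix w assume w: "w \<in> ?R"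
  \<comment> \<open>Explicit global sections through \<open>v\<close> and \<open>c\<close> realise
    every \<open>w\<close> of the right-hand side.\<close>
  let ?V = "ker_section S r (v $ e n)" and ?X = "hol_section S (\<lambda>_. c)"
  have Vq: "?V q = v" by (rule ker_section_id[OF S r v])
  have Xq: "?X q = c" using hol_section_id[of S q "\<lambda>_. c"] c by simp
  have ck: "Ck_on k (\<lambda>p. mk (\<lambda>j. if j = n then v $ e n else - (v $ e n) * of_real (slope r p j)) $ i) UNIV" for i k
  proof -
    obtain j where j: "j \<le> n" "i = e j" by (rule e_cases)
    have "Ck_on k (\<lambda>p. complex_of_real (slope r p j)) UNIV"
      unfolding slope_def of_real_sum of_real_mult
      by (intro Ck_on_sum Ck_on_mult Ck_on_re Ck_on_kernel_matrix)
    then have "Ck_on k (\<lambda>p. - (v $ e n) * complex_of_real (slope r p j)) UNIV"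
      by (intro Ck_on_mult Ck_on_const)
    then show ?thesis
      using j by (cases "j = n") (simp_all add: mk_nth Ck_on_const)
  qed
  have secV: "local_section ?M (levi_kernel ?M) q ?V"
    unfolding local_section_def
    by (rule exI[of _ UNIV])
      (auto simp: Cinf_on_def levi_kernel_ker ker_section_in[OF S r],
        auto simp: ker_section_def intro!: Ck_on_hol_section ck)
  have secX: "local_section ?M (hol_tangent ?M) q ?X"
    by (rule local_section_hol[OF c])
  obtain U V' where U: "open U" "q \<in> U" "(?V has_derivative V') (at q)"
    using local_section_derivative[OF secV] by metis
  obtain U2 X' where U2: "open U2" "q \<in> U2" "(?X has_derivative X') (at q)"
    using local_section_derivative[OF secX] by metis
  have hv: "hess S q a v = 0" "hess S q v a = 0" for a
    using v hess_commute[of S q a v] by (auto simp: ker_def)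
  have "psi S q (dbar V' c) = hess S q (?V q) (cnj_vec c) / 2"
    by (rule psi_dbar[OF q U(3,1,2) _ c]) (simp add: ker_section_def psi_hol_section)
  then have "psi S q (- dbar V' c - w) = 0"
    using w by (simp add: psi_diff psi_uminus Vq hv)
  moreover have "(- dbar V' c - w) $ e j + (- dbar V' c - w) $ e n * of_real (slope r q j) = 0" if j: "j \<in> {1..<n}" for j
  proof -
    have "dbar V' c $ e j + dbar V' c $ e n * of_real (slope r q j) = - (v $ e n / 2 * dslope r q j (cnj_vec c))"
      using ker_dbar[OF S r q U(3,1,2) ker_section_in[OF S r] c j] by (simp only: Vq)
    moreover have "w $ e j + w $ e n * of_real (slope r q j) = v $ e n / 2 * dslope r q j (cnj_vec c)"
      using w j by blast
    moreover have "(- dbar V' c - w) $ e j + (- dbar V' c - w) $ e n * of_real (slope r q j)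
        = - (dbar V' c $ e j + dbar V' c $ e n * of_real (slope r q j)) - (w $ e j + w $ e n * of_real (slope r q j))"
      by (simp add: algebra_simps)
    ultimately show ?thesis by (simp only: minus_minus diff_self)
  qed
  ultimately have 1: "- dbar V' c - w \<in> ker S q"
    by (simp add: ker_chain[OF S r])
  have "psi S q (dbar X' v) = hess S q (?X q) (cnj_vec v) / 2"
    using v by (intro psi_dbar[OF q U2(3,1,2)]) (simp_all add: psi_hol_section ker_def)
  then have 2: "psi S q (dbar X' v) = 0"
    using hess_cnj[of S q "cnj_vec c" v] by (simp add: Xq hv)
  have "bracket_bar ?V ?X q - (w, 0) \<in> levi_kernel ?M q \<times> cnj_vec ` hol_tangent ?M q"
    using 1 2 by (simp add: bracket_bar_eq[OF U(3) U2(3)] Vq Xq levi_kernel_ker[OF q] hol_tangent_eq[OF q])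
  moreover have "?X q \<in> (+) c ` ker S q"
    using zero_in_ker[of S q] by (force simp: Xq)
  moreover have "w \<in> hol_tangent ?M q"
    using w by (simp add: hol_tangent_eq[OF q])
  ultimately show "w \<in> ?L"
    unfolding ad_def using secV secX Vq
    by (simp only: mem_Collect_eq simp_thms) (rule exI[of _ ?V], rule exI[of _ ?X], simp only: simp_thms)
qed

text \<open>If all ratios vanish, then \<open>N = 0\<close> and \<open>ad\<close> is zero on a
  nonzero kernel. A nonzero \<open>r m\<close> is the entry of \<open>N\<close> at
  \<open>(Suc m, m)\<close>, of degree 0 in \<open>t\<close>, so the coordinate direction
  \<open>m\<close> separates kernel vectors at every point.\<close>

lemma uniformly_2_nondegenerate_chain:
  assumes S: "sym_coef S" and r: "column_chain n S r"
  shows "uniformly_2_nondegenerate (hypersurface e n S) \<longleftrightarrow> (\<exists>m. 0 < m \<and> Suc m < n \<and> r m \<noteq> 0)"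
proof
  let ?M = "hypersurface e n S"
  assume u: "uniformly_2_nondegenerate ?M"
  show "\<exists>m. 0 < m \<and> Suc m < n \<and> r m \<noteq> 0"
  proof (rule ccontr)
    assume z: "\<not> (\<exists>m. 0 < m \<and> Suc m < n \<and> r m \<noteq> 0)"
    have N: "kernel_matrix r t j k = 0" "kernel_matrix' r t j k = 0" if "j \<in> {1..<n}" "k \<in> {1..<n}" for t j k
    proof -
      have "(\<Prod>m\<in>{k..<j}. r m) = 0" if "k < j"
      proof (intro prod_zero bexI[of _ k])
        have "0 < k" "Suc k < n" using that \<open>j \<in> {1..<n}\<close> \<open>k \<in> {1..<n}\<close> by auto
        then show "r k = 0" using z by blast
      qed (use that in auto)
      then show "kernel_matrix r t j k = 0" "kernel_matrix' r t j k = 0"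
        by (simp_all add: kernel_matrix_def kernel_matrix'_def)
    qed
    obtain q where q: "q \<in> ?M" using graph_in by blast
    let ?w = "ker_section S r 1 q"
    have w: "?w \<in> ker S q" by (rule ker_section_in[OF S r])
    have "restrict (ad ?M q ?w) (hol_quotient ?M q) = restrict (ad ?M q 0) (hol_quotient ?M q)"
    proof (rule restrict_ext)
      fix C assume "C \<in> hol_quotient ?M q"
      then obtain c where c: "psi S q c = 0" "C = (+) c ` ker S q"
        by (auto simp: hol_quotient_def hol_tangent_eq[OF q] levi_kernel_ker[OF q])
      have "dslope r q j (cnj_vec c) = 0" if "j \<in> {1..<n}" for j
        using N that by (simp add: dslope_def)
      then show "ad ?M q ?w C = ad ?M q 0 C"
        by (simp add: c(2) ad_eq[OF S r q w c(1)] ad_eq[OF S r q zero_in_ker c(1)])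
    qed
    moreover have "inj_on (\<lambda>v. restrict (ad ?M q v) (hol_quotient ?M q)) (ker S q)"
      using u q by (simp add: uniformly_2_nondegenerate_def flip: levi_kernel_ker)
    ultimately have "?w = 0"
      using w zero_in_ker by (auto simp: inj_on_def)
    moreover have "?w $ e n = 1" using n_gt by (simp add: ker_section_nth)
    ultimately show False by simp
  qed
next
  let ?M = "hypersurface e n S"
  assume "\<exists>m. 0 < m \<and> Suc m < n \<and> r m \<noteq> 0"
  then obtain m where m: "0 < m" "Suc m < n" "r m \<noteq> 0" by blast
  have "inj_on (\<lambda>v. restrict (ad ?M q v) (hol_quotient ?M q)) (levi_kernel ?M q)" if q: "q \<in> ?M" for q
    unfolding levi_kernel_ker[OF q]
  proof (rule inj_onI)
    fix v v' assume v: "v \<in> ker S q" "v' \<in> ker S q"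
      and eq: "restrict (ad ?M q v) (hol_quotient ?M q) = restrict (ad ?M q v') (hol_quotient ?M q)"
    define c where "c = hol_section S (\<lambda>_. ax m) q"
    have c: "psi S q c = 0" by (simp add: c_def psi_hol_section)
    have c_nth: "c $ e j = (if j = m then 1 else 0)" if "1 \<le> j" "j \<le> n" for j
      using that by (simp add: c_def hol_section_def e_eq_iff ax_nth)
    have "(+) c ` ker S q \<in> hol_quotient ?M q"
      using c by (auto simp: hol_quotient_def hol_tangent_eq[OF q] levi_kernel_ker[OF q])
    then have ad: "ad ?M q v ((+) c ` ker S q) = ad ?M q v' ((+) c ` ker S q)"
      using eq by (metis restrict_apply')
    \<comment> \<open>A representative of the image coset with last coordinate 0, so that its entry
      at \<open>Suc m\<close> can be read off for \<open>v\<close> and for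
      \<open>v'\<close>.\<close>
    define w where "w = hol_section S (\<lambda>_. mk (\<lambda>j. if j = n then 0 else v $ e n / 2 * dslope r q j (cnj_vec c))) q"
    have "psi S q w = 0"
      unfolding w_def by (rule psi_hol_section)
    moreover have w: "w $ e n = 0"
        "\<And>j. j \<in> {1..<n} \<Longrightarrow> w $ e j = v $ e n / 2 * dslope r q j (cnj_vec c)"
      using n_gt by (auto simp: w_def hol_section_def e_eq_iff mk_nth)
    ultimately have "w \<in> ad ?M q v ((+) c ` ker S q)"
      by (simp add: ad_eq[OF S r q v(1) c])
    then have "w $ e (Suc m) = v' $ e n / 2 * dslope r q (Suc m) (cnj_vec c)"
      unfolding ad ad_eq[OF S r q v(2) c] using w(1) m by auto
    moreover have "dslope r q (Suc m) (cnj_vec c) = of_real (r m)"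
    proof -
      have "dslope r q (Suc m) (cnj_vec c) = (\<Sum>k\<in>{1..<n}. if k = m then of_real (r m) else 0)"
        unfolding dslope_def using m n_gt
        by (intro sum.cong refl) (auto simp: c_nth kernel_matrix_def)
      then show ?thesis using m by simp
    qed
    ultimately have "v $ e n = v' $ e n"
      using w(2)[of "Suc m"] m by simp
    then show "v = v'" by (rule ker_eq_iff[OF S r v])
  qed
  then show "uniformly_2_nondegenerate ?M"
    unfolding uniformly_2_nondegenerate_def using levi_kernel_rank_chain[OF S r] by blast
qed

section \<open>Characterisation of 2-nondegeneracy with rank 1 Levi kernel\<close>

definition nondeg_chain :: "(nat \<Rightarrow> nat \<Rightarrow> real) \<Rightarrow> (nat \<Rightarrow> real) \<Rightarrow> bool"
  where "nondeg_chain S r \<longleftrightarrow> column_chain n S r \<and> (\<exists>m. 0 < m \<and> Suc m < n \<and> r m \<noteq> 0)"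

lemma re_ax_sum: "j \<le> n \<Longrightarrow> re (of_real s *s ax i + of_real s *s ax k + of_real t *s ax n) j
    = s * ((if j = i then 1 else 0) + (if j = k then 1 else 0)) + (if j = n then t else 0)"
  by (simp add: re_def ax_nth distrib_left)

lemma re_graph: "1 \<le> j \<Longrightarrow> j \<le> n \<Longrightarrow> re (graph S q) j = re q j"
  by (simp add: re_def graph_def e_eq_iff)

lemma zero_in_hypersurface: "0 \<in> hypersurface e n S"
  by (simp add: hypersurface_eq defining_poly_def re_def)

text \<open>At the origin \<open>A'\<close> and \<open>A''\<close> are multiplied by
  \<open>x = 0\<close>, so \<open>ax n\<close> is always in the kernel and spans it if the kernel
  lies in a line.\<close>

lemma ker_at_zero_line:
  assumes S: "sym_coef S" and b: "\<And>v. v \<in> ker S 0 \<Longrightarrow> \<exists>c. v = c *s b"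
    and v: "v \<in> ker S 0" and j: "j \<in> {1..<n}"
  shows "v $ e j = 0"
proof -
  have re0: "re 0 j = 0" for j by (simp add: re_def)
  have "ax n \<in> ker S 0"
    using n_gt by (simp add: ker_iff[OF S] psi_def diff1_def row_def last_row_def re0 ax_nth)
  then obtain c where c: "ax n = c *s b" using b by blast
  obtain d where d: "v = d *s b" using b v by blast
  have "c * b $ e n = 1" "c * b $ e j = 0"
    using arg_cong[OF c, of "\<lambda>v. v $ e n"] arg_cong[OF c, of "\<lambda>v. v $ e j"] j by (auto simp: ax_nth)
  then show ?thesis by (auto simp: d)
qed

lemma nondegenerate_iff:
  assumes S: "sym_coef S"
  shows "uniformly_2_nondegenerate (hypersurface e n S) \<and> levi_kernel_rank (hypersurface e n S) 1 \<longleftrightarrow>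
    (\<exists>r. nondeg_chain S r)"
proof
  assume u: "uniformly_2_nondegenerate (hypersurface e n S) \<and> levi_kernel_rank (hypersurface e n S) 1"
  then have rank: "vec.dim (ker S q) = 1" if "q \<in> hypersurface e n S" for q
    using that by (auto simp: levi_kernel_rank_def simp flip: levi_kernel_ker)
  have "\<exists>r. column_chain n S r"
  proof (rule column_chain_of_ker[OF S, where s = 1 and t = 1])
    obtain b where "\<And>v. v \<in> ker S 0 \<Longrightarrow> \<exists>c. v = c *s b"
      using dim_one_obtain[OF rank[OF zero_in_hypersurface]] by metis
    then show "v $ e j = 0" if "v \<in> ker S 0" "j \<in> {1..<n}" for v j
      using ker_at_zero_line[OF S] that by blast
    fix i k assume ik: "i \<in> {1..<n}" "k \<in> {1..<n}"
    let ?q = "graph S (of_real 1 *s ax i + of_real 1 *s ax k + of_real 1 *s ax n)"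
    obtain b where "b \<in> ker S ?q" "b \<noteq> 0"
      using dim_one_obtain[OF rank[OF graph_in]] by metis
    moreover have "re ?q n = 1" "\<forall>j\<in>{1..<n}. re ?q j = 1 * ((if j = i then 1 else 0) + (if j = k then 1 else 0))"
      using n_gt ik re_graph[of _ S] re_ax_sum[of _ 1 i k 1] by auto
    ultimately show "\<exists>q v. v \<in> ker S q \<and> v \<noteq> 0 \<and> re q n = 1 \<and>
        (\<forall>j\<in>{1..<n}. re q j = 1 * ((if j = i then 1 else 0) + (if j = k then 1 else 0)))"
      by blast
  qed auto
  then show "\<exists>r. nondeg_chain S r"
    using uniformly_2_nondegenerate_chain[OF S] u by (auto simp: nondeg_chain_def)
next
  assume "\<exists>r. nondeg_chain S r"
  then show "uniformly_2_nondegenerate (hypersurface e n S) \<and> levi_kernel_rank (hypersurface e n S) 1"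
    using uniformly_2_nondegenerate_chain[OF S] levi_kernel_rank_chain[OF S] by (auto simp: nondeg_chain_def)
qed

end

subsection \<open>Derivatives of holomorphic maps\<close>

lemma norm_vector_scalar_mult: "norm (c *s (v :: complex^'m)) = norm c * norm v"
  by (simp add: norm_vec_def norm_mult L2_set_right_distrib)

lemma bounded_linear_vector_scalar_mult_left: "bounded_linear (\<lambda>w. w *s (v :: complex^'m))"
  by (rule bounded_linear_intro[where K = "norm v"])
    (auto simp: vec_eq_iff distrib_right norm_vector_scalar_mult)

text \<open>Cauchy's formula for the derivative at 0 of
  \<open>\<zeta> \<mapsto> f (z + \<zeta> *s v)\<close>. On the circle the differential of
  \<open>c\<close> divided by \<open>c\<close> is \<open>2 \<pi> \<i> dx\<close>, which leaves the
  integrand \<open>f / c\<close>.\<close>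

lemma has_integral_directional_derivative:
  fixes f :: "complex^'m \<Rightarrow> complex" and z v :: "complex^'m" and \<rho> :: real
  defines "c \<equiv> \<lambda>x::real. of_real \<rho> * exp (2 * of_real pi * \<i> * of_real x)"
  assumes \<rho>: "\<rho> > 0"
    and D: "\<And>\<zeta>. norm \<zeta> \<le> \<rho> \<Longrightarrow> (f has_derivative D (z + \<zeta> *s v)) (at (z + \<zeta> *s v))"
    and lin: "\<And>\<zeta> w u. norm \<zeta> \<le> \<rho> \<Longrightarrow> D (z + \<zeta> *s v) (w *s u) = w * D (z + \<zeta> *s v) u"
  shows "((\<lambda>x. f (z + c x *s v) * (1 / c x)) has_integral D z v) (cbox 0 1)"
proof -
  define h where "h = (\<lambda>\<zeta>. f (z + \<zeta> *s v))"
  have h: "(h has_field_derivative D (z + \<zeta> *s v) v) (at \<zeta>)" if "norm \<zeta> \<le> \<rho>" for \<zeta>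
  proof -
    have "((\<lambda>\<zeta>. z + \<zeta> *s v) has_derivative (\<lambda>w. 0 + w *s v)) (at \<zeta>)"
      by (intro has_derivative_add has_derivative_const bounded_linear_imp_has_derivative
          bounded_linear_vector_scalar_mult_left)
    from has_derivative_compose[OF this, of f "D (z + \<zeta> *s v)"] D[OF that]
    show ?thesis
      unfolding h_def has_field_derivative_def using lin[OF that] by (simp add: mult_commute_abs)
  qed
  have holo: "h holomorphic_on ball 0 \<rho>"
    using h by (auto simp: holomorphic_on_open) (meson less_imp_le)
  have cont: "continuous_on (cball 0 \<rho>) h"
    using h by (intro continuous_at_imp_continuous_on ballI) (auto intro: DERIV_isCont)
  have "((\<lambda>u. h u / (u - 0) ^ Suc 1) has_contour_integral ((2 * pi * \<i>) / fact 1 * (deriv ^^ 1) h 0)) (circlepath 0 \<rho>)"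
    using \<rho> by (intro Cauchy_has_contour_integral_higher_derivative_circlepath cont holo) auto
  moreover have "deriv h 0 = D z v"
    using h[of 0] \<rho> by (simp add: DERIV_imp_deriv)
  ultimately have "((\<lambda>x. h (circlepath 0 \<rho> x) / (circlepath 0 \<rho> x)\<^sup>2 * vector_derivative (circlepath 0 \<rho>) (at x))
      has_integral (2 * pi * \<i> * D z v)) {0..1}"
    by (simp add: has_contour_integral power2_eq_square)
  then have "((\<lambda>x. h (circlepath 0 \<rho> x) / (circlepath 0 \<rho> x)\<^sup>2 * vector_derivative (circlepath 0 \<rho>) (at x) * (1 / (2 * pi * \<i>)))
      has_integral (2 * pi * \<i> * D z v * (1 / (2 * pi * \<i>)))) {0..1}"
    by (rule has_integral_mult_left)
  moreover have "h (circlepath 0 \<rho> x) / (circlepath 0 \<rho> x)\<^sup>2 * vector_derivative (circlepath 0 \<rho>) (at x) * (1 / (2 * pi * \<i>))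
      = f (z + c x *s v) * (1 / c x)" for x
  proof -
    have "circlepath 0 \<rho> x = c x" by (simp add: circlepath c_def)
    moreover have "vector_derivative (circlepath 0 \<rho>) (at x) = 2 * pi * \<i> * c x"
      by (simp add: vector_derivative_circlepath c_def)
    moreover have "c x \<noteq> 0" using \<rho> by (simp add: c_def)
    ultimately show ?thesis by (simp add: h_def power2_eq_square)
  qed
  ultimately show ?thesis by (simp add: cbox_interval)
qed

text \<open>\<open>holomorphic_map_on\<close> only grants pointwise complex differentiability. The
  Cauchy integral expresses the directional derivative through \<open>f\<close> itself, so it can be
  differentiated under the integral sign.\<close>

lemma directional_derivative_holomorphic:
  fixes f :: "complex^'m::finite \<Rightarrow> complex"
  assumes U: "open U" and z0: "z0 \<in> U"
    and D: "\<And>z. z \<in> U \<Longrightarrow> (f has_derivative D z) (at z)"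
    and lin: "\<And>z w u. z \<in> U \<Longrightarrow> D z (w *s u) = w * D z u"
  shows "\<exists>D2. ((\<lambda>z. D z v) has_derivative D2) (at z0) \<and> (\<forall>w u. D2 (w *s u) = w * D2 u)"
proof -
  have bl: "bounded_linear (D z)" if "z \<in> U" for z
    using D[OF that] by (rule has_derivative_bounded_linear)
  define c where "c = (\<lambda>\<rho> x::real. complex_of_real \<rho> * exp (2 * of_real pi * \<i> * of_real x))"
  have c_norm: "norm (c \<rho> x) = \<bar>\<rho>\<bar>" for \<rho> x by (simp add: c_def norm_mult)
  \<comment> \<open>A radius that works for all base points near \<open>z\<close> at once.\<close>
  have room: "\<exists>\<delta> \<rho>. \<delta> > 0 \<and> \<rho> > 0 \<and> (\<forall>y\<in>ball z \<delta>. \<forall>\<zeta>. norm \<zeta> \<le> \<rho> \<longrightarrow> y + \<zeta> *s v \<in> U)"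
    if zU: "z \<in> U" for z v
  proof -
    obtain \<epsilon> where \<epsilon>: "\<epsilon> > 0" "ball z \<epsilon> \<subseteq> U"
      using U zU by (meson open_contains_ball)
    define \<rho> where "\<rho> = \<epsilon> / 2 / (1 + norm v)"
    have \<rho>: "\<rho> > 0" "\<rho> * norm v \<le> \<epsilon> / 2"
    proof -
      have "0 < 1 + norm v" by (smt (verit) norm_ge_zero)
      then show "\<rho> > 0" using \<epsilon> by (simp add: \<rho>_def)
      have "\<rho> * norm v \<le> \<rho> * (1 + norm v)" using \<open>\<rho> > 0\<close> by (intro mult_left_mono) auto
      also have "\<dots> = \<epsilon> / 2" using \<open>0 < 1 + norm v\<close> unfolding \<rho>_def by (metis less_irrefl nonzero_eq_divide_eq)
      finally show "\<rho> * norm v \<le> \<epsilon> / 2" .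
    qed
    have "y + \<zeta> *s v \<in> U" if y: "y \<in> ball z (\<epsilon>/2)" and \<zeta>: "norm \<zeta> \<le> \<rho>" for y \<zeta>
    proof -
      have "norm (\<zeta> *s v) \<le> \<epsilon> / 2"
        unfolding norm_vector_scalar_mult using \<zeta> \<rho>(2) by (meson mult_right_mono norm_ge_zero order_trans)
      then have "dist z (y + \<zeta> *s v) < \<epsilon>"
        using y norm_triangle_ineq4[of "z - y" "\<zeta> *s v"] by (simp add: dist_norm diff_diff_eq)
      then show ?thesis using \<epsilon>(2) by auto
    qed
    then show ?thesis using \<epsilon>(1) \<rho>(1) half_gt_zero by blast
  qed
  have contf: "continuous_on U f"
    using D has_derivative_continuous by (intro continuous_at_imp_continuous_on) blast
  have cont_c: "continuous_on X (\<lambda>(z, x). z + c \<rho> x *s v)" for X :: "((complex^'m) \<times> real) set" and \<rho> v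
  proof -
    have "continuous_on X (\<lambda>p. c \<rho> (snd p) *s v)"
      unfolding c_def
      by (rule bounded_linear.continuous_on[OF bounded_linear_vector_scalar_mult_left])
        (intro continuous_intros)
    then show ?thesis
      unfolding case_prod_beta by (intro continuous_on_add continuous_on_fst continuous_on_id)
  qed
  have cont_inv: "continuous_on X (\<lambda>p. 1 / c \<rho> (snd p))" if "\<rho> > 0" for X :: "((complex^'m) \<times> real) set" and \<rho>
    unfolding c_def using that by (intro continuous_intros) auto
  \<comment> \<open>Continuity comes first, from the integral over \<open>f\<close>: the Leibniz
    rule below requires a continuous family \<open>fx\<close> of derivatives.\<close>
  have contD: "continuous_on U (\<lambda>z. D z v)" for v
  proof (rule continuous_at_imp_continuous_on, rule ballI)
    fix z assume z: "z \<in> U"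
    obtain \<delta> \<rho> where \<delta>: "\<delta> > 0" "\<rho> > 0" "\<forall>y\<in>ball z \<delta>. \<forall>\<zeta>. norm \<zeta> \<le> \<rho> \<longrightarrow> y + \<zeta> *s v \<in> U"
      using room[OF z] by blast
    have in_U: "y + c \<rho> x *s v \<in> U" if "y \<in> ball z \<delta>" for y x
      using \<delta> that by (simp add: c_norm)
    have eq: "D y v = integral (cbox 0 1) (\<lambda>x. f (y + c \<rho> x *s v) * (1 / c \<rho> x))" if "y \<in> ball z \<delta>" for y
      using \<delta> that D lin unfolding c_def
      by (intro integral_unique[symmetric] has_integral_directional_derivative) auto
    have "continuous_on (ball z \<delta> \<times> cbox 0 1) (\<lambda>p. f ((\<lambda>(z, x). z + c \<rho> x *s v) p) * (1 / c \<rho> (snd p)))"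
      using in_U by (intro continuous_on_mult cont_inv \<delta> continuous_on_compose2[OF contf cont_c]) auto
    then have "continuous_on (ball z \<delta>) (\<lambda>y. integral (cbox 0 1) (\<lambda>x. f (y + c \<rho> x *s v) * (1 / c \<rho> x)))"
      by (intro integral_continuous_on_param) (simp add: case_prod_beta)
    then have "continuous_on (ball z \<delta>) (\<lambda>y. D y v)"
      by (rule continuous_on_eq) (simp only: eq)
    then show "isCont (\<lambda>y. D y v) z"
      using \<delta>(1) by (simp add: continuous_on_eq_continuous_at)
  qed
  obtain \<delta> \<rho> where \<delta>: "\<delta> > 0" "\<rho> > 0" "\<forall>y\<in>ball z0 \<delta>. \<forall>\<zeta>. norm \<zeta> \<le> \<rho> \<longrightarrow> y + \<zeta> *s v \<in> U"
    using room[OF z0] by blast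
  define B where "B = ball z0 \<delta>"
  have in_U: "y + c \<rho> x *s v \<in> U" if "y \<in> B" for y x
    using \<delta> that by (simp add: c_norm B_def)
  define fx where "fx y x = Blinfun (\<lambda>w. D (y + c \<rho> x *s v) w * (1 / c \<rho> x))" for y x
  have fx: "blinfun_apply (fx y x) w = D (y + c \<rho> x *s v) w * (1 / c \<rho> x)" if "y \<in> B" for y x w
    unfolding fx_def
    by (subst bounded_linear_Blinfun_apply)
      (rule bounded_linear_compose[OF bounded_linear_mult_left bl[OF in_U[OF that]]], rule refl)
  have int_fx: "continuous_on (B \<times> cbox 0 1) (\<lambda>(y, x). fx y x)"
  proof (rule continuous_on_blinfun_componentwise)
    fix i :: "complex^'m"
    have "continuous_on (B \<times> cbox 0 1) (\<lambda>p. D ((\<lambda>(z, x). z + c \<rho> x *s v) p) i * (1 / c \<rho> (snd p)))"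
      using in_U by (intro continuous_on_mult cont_inv \<delta> continuous_on_compose2[OF contD cont_c]) auto
    then show "continuous_on (B \<times> cbox 0 1) (\<lambda>p. blinfun_apply (case p of (y, x) \<Rightarrow> fx y x) i)"
      by (rule continuous_on_eq) (auto simp: fx)
  qed
  have int_f: "(\<lambda>x. f (y + c \<rho> x *s v) * (1 / c \<rho> x)) integrable_on cbox 0 1"
    and D_eq: "D y v = integral (cbox 0 1) (\<lambda>x. f (y + c \<rho> x *s v) * (1 / c \<rho> x))" if "y \<in> B" for y
  proof -
    have "((\<lambda>x. f (y + c \<rho> x *s v) * (1 / c \<rho> x)) has_integral D y v) (cbox 0 1)"
      using \<delta> that D lin unfolding c_def B_def
      by (intro has_integral_directional_derivative) auto
    then show "(\<lambda>x. f (y + c \<rho> x *s v) * (1 / c \<rho> x)) integrable_on cbox 0 1"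
      "D y v = integral (cbox 0 1) (\<lambda>x. f (y + c \<rho> x *s v) * (1 / c \<rho> x))"
      by (auto simp: integral_unique)
  qed
  have zB: "z0 \<in> B" using \<delta> by (simp add: B_def)
  have L: "((\<lambda>y. integral (cbox 0 1) (\<lambda>x. f (y + c \<rho> x *s v) * (1 / c \<rho> x))) has_derivative
      integral (cbox 0 1) (fx z0)) (at z0 within B)"
  proof (rule leibniz_rule[OF _ int_f int_fx zB])
    fix y x assume y: "y \<in> B"
    have "((\<lambda>y. y + c \<rho> x *s v) has_derivative (\<lambda>w. w + 0)) (at y)"
      by (intro has_derivative_add has_derivative_ident has_derivative_const)
    from has_derivative_compose[OF this D[OF in_U[OF y]]]
    have "((\<lambda>y. f (y + c \<rho> x *s v) * (1 / c \<rho> x)) has_derivative (\<lambda>w. D (y + c \<rho> x *s v) w * (1 / c \<rho> x))) (at y)"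
      by (intro has_derivative_mult_left) simp
    then show "((\<lambda>y. f (y + c \<rho> x *s v) * (1 / c \<rho> x)) has_derivative blinfun_apply (fx y x)) (at y within B)"
      unfolding fx[OF y, symmetric] by (rule has_derivative_at_withinI)
  qed (auto simp: B_def)
  have "((\<lambda>y. D y v) has_derivative integral (cbox 0 1) (fx z0)) (at z0 within B)"
    by (rule has_derivative_transform[OF zB D_eq L])
  then have der: "((\<lambda>y. D y v) has_derivative integral (cbox 0 1) (fx z0)) (at z0)"
    using at_within_open[OF zB] by (metis B_def open_ball)
  have "fx z0 integrable_on cbox 0 1"
  proof (rule integrable_continuous)
    have "continuous_on (cbox 0 1) (\<lambda>x. (\<lambda>(y, x). fx y x) (z0, x))"
      using zB by (intro continuous_on_compose2[OF int_fx]) (auto intro!: continuous_intros)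
    then show "continuous_on (cbox 0 1) (fx z0)" by simp
  qed
  then have app: "blinfun_apply (integral (cbox 0 1) (fx z0)) u = integral (cbox 0 1) (\<lambda>x. blinfun_apply (fx z0 x) u)" for u
    by (rule blinfun_apply_integral)
  have "blinfun_apply (integral (cbox 0 1) (fx z0)) (w *s u) = w * blinfun_apply (integral (cbox 0 1) (fx z0)) u" for w u
    unfolding app fx[OF zB] lin[OF in_U[OF zB]] mult.assoc by (rule integral_mult_right)
  with der show ?thesis by blast
qed

lemma holomorphic_map_on_derivative:
  assumes F: "holomorphic_map_on F U" and z: "z \<in> U"
  shows "(F has_derivative frechet_derivative F (at z)) (at z)"
    and "frechet_derivative F (at z) (c *s v) = c *s frechet_derivative F (at z) v"
proof -
  obtain D where D: "(F has_derivative D) (at z)" "\<And>c v. D (c *s v) = c *s D v"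
    using assms by (auto simp: holomorphic_map_on_def)
  then have "frechet_derivative F (at z) = D" by (metis frechet_derivative_at)
  then show "(F has_derivative frechet_derivative F (at z)) (at z)"
    "frechet_derivative F (at z) (c *s v) = c *s frechet_derivative F (at z) v"
    using D by auto
qed

lemma holomorphic_map_on_second_derivative:
  fixes F :: "complex^'m::finite \<Rightarrow> complex^'m"
  assumes F: "holomorphic_map_on F U" and U: "open U" and z: "z \<in> U"
  obtains D2 where "((\<lambda>p. frechet_derivative F (at p) v) has_derivative D2) (at z)"
    "\<And>c u. D2 (c *s u) = c *s D2 u"
proof -
  have "\<exists>D2. ((\<lambda>p. frechet_derivative F (at p) v $ i) has_derivative D2) (at z) \<and> (\<forall>w u. D2 (w *s u) = w * D2 u)" for i
  proof (rule directional_derivative_holomorphic[OF U z])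
    show "((\<lambda>p. F p $ i) has_derivative (\<lambda>v. frechet_derivative F (at z) v $ i)) (at z)" if "z \<in> U" for z
      by (rule bounded_linear.has_derivative[OF bounded_linear_vec_nth holomorphic_map_on_derivative(1)[OF F that]])
  qed (simp add: holomorphic_map_on_derivative(2)[OF F])
  then obtain D2 where D2: "\<And>i. ((\<lambda>p. frechet_derivative F (at p) v $ i) has_derivative D2 i) (at z)"
      "\<And>i w u. D2 i (w *s u) = w * D2 i u"
    by metis
  show thesis
  proof (rule that)
    show "((\<lambda>p. frechet_derivative F (at p) v) has_derivative (\<lambda>u. \<chi> i. D2 i u)) (at z)"
      using D2(1) by (intro has_derivative_vec_lambda) simp
    show "(\<chi> i. D2 i (c *s u)) = c *s (\<chi> i. D2 i u)" for c u
      by (simp add: D2(2) vec_eq_iff)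
  qed
qed

subsection \<open>Biholomorphic invariance\<close>

context tube
begin

text \<open>Both directions of the correspondence are recorded, so that each result can also be
  applied to the inverse map.\<close>

definition germ_iso ::
    "(nat \<Rightarrow> nat \<Rightarrow> real) \<Rightarrow> (nat \<Rightarrow> nat \<Rightarrow> real) \<Rightarrow> (complex^'m \<Rightarrow> complex^'m) \<Rightarrow> (complex^'m \<Rightarrow> complex^'m) \<Rightarrow>
     (complex^'m) set \<Rightarrow> (complex^'m) set \<Rightarrow> bool"
  where "germ_iso S S' F G U V \<longleftrightarrow>
    open U \<and> open V \<and> 0 \<in> U \<and> 0 \<in> V \<and> F 0 = 0 \<and> G 0 = 0 \<and>
    holomorphic_map_on F U \<and> holomorphic_map_on G V \<and> F ` U = V \<and> G ` V = U \<and>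
    (\<forall>z\<in>U. G (F z) = z) \<and> (\<forall>w\<in>V. F (G w) = w) \<and>
    (\<forall>z\<in>U. z \<in> hypersurface e n S \<longleftrightarrow> F z \<in> hypersurface e n S') \<and>
    (\<forall>w\<in>V. w \<in> hypersurface e n S' \<longleftrightarrow> G w \<in> hypersurface e n S)"

lemma germ_iso_sym: "germ_iso S S' F G U V \<Longrightarrow> germ_iso S' S G F V U"
  unfolding germ_iso_def by auto

lemma locally_equivalent_germ_iso:
  assumes "locally_equivalent (hypersurface e n S) (hypersurface e n S')"
  obtains F G U V where "germ_iso S S' F G U V"
proof -
  obtain F G U V where *: "open U" "open V" "0 \<in> U" "0 \<in> V" "F 0 = 0" "holomorphic_map_on F U"
      "holomorphic_map_on G V" "F ` U = V" "G ` V = U" "\<forall>z\<in>U. G (F z) = z" "\<forall>w\<in>V. F (G w) = w"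
      and M: "F ` (hypersurface e n S \<inter> U) = hypersurface e n S' \<inter> V"
    using assms unfolding locally_equivalent_def by (elim exE conjE) (rule that; assumption)
  have FM: "z \<in> hypersurface e n S \<longleftrightarrow> F z \<in> hypersurface e n S'" if z: "z \<in> U" for z
  proof
    show "F z \<in> hypersurface e n S'" if "z \<in> hypersurface e n S" using M that z by blast
    assume "F z \<in> hypersurface e n S'"
    then have "F z \<in> F ` (hypersurface e n S \<inter> U)" using M *(8) z by blast
    then obtain z' where z': "z' \<in> U" "z' \<in> hypersurface e n S" "F z = F z'" by auto
    then have "z = z'" using *(10) z by metis
    then show "z \<in> hypersurface e n S" using z' by simp
  qed
  moreover have "w \<in> hypersurface e n S' \<longleftrightarrow> G w \<in> hypersurface e n S" if "w \<in> V" for w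
    using FM[of "G w"] *(9,11) that by auto
  moreover have "G 0 = 0" using *(3,5,10) by metis
  ultimately have "germ_iso S S' F G U V"
    unfolding germ_iso_def using * by blast
  then show thesis by (rule that)
qed

context
  fixes S S' F G U V
  assumes iso: "germ_iso S S' F G U V"
begin

abbreviation "DF z \<equiv> frechet_derivative F (at z)"
abbreviation "DG z \<equiv> frechet_derivative G (at z)"

lemma iso_facts:
  shows "open U" "open V" "0 \<in> U" "0 \<in> V" "F 0 = 0" "G 0 = 0" "holomorphic_map_on F U" "holomorphic_map_on G V"
    and "z \<in> U \<Longrightarrow> F z \<in> V" "w \<in> V \<Longrightarrow> G w \<in> U" "z \<in> U \<Longrightarrow> G (F z) = z" "w \<in> V \<Longrightarrow> F (G w) = w"
    and "z \<in> U \<Longrightarrow> z \<in> hypersurface e n S \<Longrightarrow> F z \<in> hypersurface e n S'"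
    and "w \<in> V \<Longrightarrow> w \<in> hypersurface e n S' \<Longrightarrow> G w \<in> hypersurface e n S"
  using iso unfolding germ_iso_def by auto

lemma DF: "z \<in> U \<Longrightarrow> (F has_derivative DF z) (at z)" "z \<in> U \<Longrightarrow> DF z (c *s v) = c *s DF z v"
  using holomorphic_map_on_derivative[OF iso_facts(7)] by auto

lemma DG: "w \<in> V \<Longrightarrow> (G has_derivative DG w) (at w)" "w \<in> V \<Longrightarrow> DG w (c *s v) = c *s DG w v"
  using holomorphic_map_on_derivative[OF iso_facts(8)] by auto

lemma DF_minus: "z \<in> U \<Longrightarrow> DF z (a - b) = DF z a - DF z b"
  using has_derivative_linear[OF DF(1)] by (simp add: linear_diff)

lemma DF_zero: "z \<in> U \<Longrightarrow> DF z 0 = 0"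
  using has_derivative_linear[OF DF(1)] by (simp add: linear_0)

lemma DG_DF:
  assumes z: "z \<in> U" shows "DG (F z) (DF z v) = v"
proof -
  have "((\<lambda>p. G (F p)) has_derivative (\<lambda>v. DG (F z) (DF z v))) (at z)"
    by (rule has_derivative_compose[OF DF(1)[OF z] DG(1)[OF iso_facts(9)[OF z]]])
  moreover have "((\<lambda>p. G (F p)) has_derivative (\<lambda>v. v)) (at z)"
    by (rule has_derivative_transform_within_open[OF has_derivative_ident iso_facts(1) z])
      (simp add: iso_facts(11))
  ultimately show ?thesis
    using has_derivative_unique by metis
qed

text \<open>Real tangent vectors go to real tangent vectors; applied to \<open>a\<close> and
  \<open>\<i> *s a\<close> this gives the real and the imaginary part.\<close>

lemma psi_DF:
  assumes z: "z \<in> U" "z \<in> hypersurface e n S" and a: "psi S z a = 0"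
  shows "psi S' (F z) (DF z a) = 0"
proof -
  have re: "Re (psi S' (F z) (DF z b)) = 0" if b: "b \<in> tangent_space (hypersurface e n S) z" for b
  proof -
    have "((\<lambda>p. Re (F p $ e 0) - defining_poly n S' (re (F p))) has_derivative
        (\<lambda>b. Re (DF z b $ e 0) - Re (diff1 n S' (re (F z)) (co (DF z b))))) (at z)"
      by (intro has_derivative_diff has_derivative_compose[OF DF(1)[OF z(1)] has_derivative_defining_poly]
          bounded_linear.has_derivative[OF bounded_linear_Re] has_derivative_nth DF z)
    from tangent_derivative_zero[OF this iso_facts(1) z(1) _ b]
    show ?thesis
      using iso_facts(13) by (simp add: hypersurface_eq psi_def)
  qed
  have "Re (psi S' (F z) (DF z (\<i> *s a))) = 0"
    by (rule re[OF hol_tangent_in_tangent(2)[OF z(2) a]])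
  then have "Im (psi S' (F z) (DF z a)) = 0"
    by (simp add: DF(2)[OF z(1)] psi_scale)
  with re[OF hol_tangent_in_tangent(1)[OF z(2) a]] show ?thesis
    by (simp add: complex_eq_iff)
qed

text \<open>
  The push-forward \<open>q \<mapsto> DF (x - psi x \<partial>\<^sub>0)\<close> of the section extending \<open>x\<close> is a section for \<open>S'\<close>;
  the second derivatives of \<open>F\<close> cancel in \<open>dbar\<close>.
\<close>
lemma hess_DF:
  assumes z: "z \<in> U" "z \<in> hypersurface e n S" and x: "psi S z x = 0" and a: "psi S z a = 0"
  shows "hess S' (F z) (DF z x) (cnj_vec (DF z a)) = hess S z x (cnj_vec a) * psi S' (F z) (DF z (ax 0))"
proof -
  obtain D2x where D2x: "((\<lambda>p. DF p x) has_derivative D2x) (at z)" "\<And>c u. D2x (c *s u) = c *s D2x u"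
    by (rule holomorphic_map_on_second_derivative[OF iso_facts(7,1) z(1), where v = x]) (rule that; assumption)
  obtain D20 where D20: "((\<lambda>p. DF p (ax 0)) has_derivative D20) (at z)"
    by (rule holomorphic_map_on_second_derivative[OF iso_facts(7,1) z(1), where v = "ax 0"]) (rule that; assumption)
  \<comment> \<open>On the hypersurface \<open>DF p x\<close> is tangent only where
    \<open>psi S p x = 0\<close>. As \<open>psi S p (ax 0) = 1\<close>, the subtracted term repairs
    this at nearby points, and it vanishes at \<open>z\<close>.\<close>
  define W where "W p = DF p x - psi S p x *s DF p (ax 0)" for p
  have psi_const: "((\<lambda>p. psi S p x) has_derivative (\<lambda>b. psi S z 0 - hess S z x (revec b))) (at z)"
    by (rule has_derivative_psi[OF has_derivative_const])
  have psi0: "psi S z 0 = 0" using psi_scale[of S z 0 0] by simp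
  have W_der: "(W has_derivative (\<lambda>b. D2x b + hess S z x (revec b) *s DF z (ax 0))) (at z)"
  proof (rule has_derivative_vec_lambda)
    fix i
    have "((\<lambda>p. DF p x $ i - psi S p x * DF p (ax 0) $ i) has_derivative
      (\<lambda>b. D2x b $ i - (psi S z x * D20 b $ i + (psi S z 0 - hess S z x (revec b)) * DF z (ax 0) $ i))) (at z)"
      by (intro has_derivative_diff has_derivative_mult has_derivative_nth D2x(1) D20 psi_const)
    then show "((\<lambda>p. W p $ i) has_derivative (\<lambda>b. (D2x b + hess S z x (revec b) *s DF z (ax 0)) $ i)) (at z)"
      by (simp add: W_def x psi0)
  qed
  have W_sec: "psi S' (F p) (W p) = 0" if p: "p \<in> U" "p \<in> hypersurface e n S" for p
  proof -
    have "psi S p (x - psi S p x *s ax 0) = 0"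
      using n_gt by (simp add: psi_diff psi_scale) (simp add: psi_def ax_nth diff1_def)
    then have "psi S' (F p) (DF p (x - psi S p x *s ax 0)) = 0"
      by (rule psi_DF[OF p])
    then show ?thesis by (simp add: W_def DF_minus[OF p(1)] DF(2)[OF p(1)])
  qed
  have Fz: "F z \<in> hypersurface e n S'" "F z \<in> V" "G (F z) = z"
    using z iso_facts by auto
  have WG: "((\<lambda>w. W (G w)) has_derivative (\<lambda>b. D2x (DG (F z) b) + hess S z x (revec (DG (F z) b)) *s DF z (ax 0))) (at (F z))"
    using has_derivative_compose[OF DG(1)[OF Fz(2)], of W] W_der by (simp add: Fz(3))
  have "psi S' (F z) (dbar (\<lambda>b. D2x (DG (F z) b) + hess S z x (revec (DG (F z) b)) *s DF z (ax 0)) (DF z a))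
      = hess S' (F z) (W (G (F z))) (cnj_vec (DF z a)) / 2"
  proof (rule psi_dbar[OF Fz(1) WG iso_facts(2) Fz(2)])
    show "psi S' w (W (G w)) = 0" if "w \<in> hypersurface e n S'" "w \<in> V" for w
      using W_sec[of "G w"] that iso_facts by simp
    show "psi S' (F z) (DF z a) = 0" by (rule psi_DF[OF z a])
  qed
  moreover have "W (G (F z)) = DF z x"
    by (simp add: Fz(3) W_def x)
  moreover have "dbar (\<lambda>b. D2x (DG (F z) b) + hess S z x (revec (DG (F z) b)) *s DF z (ax 0)) (DF z a)
      = (hess S z x (cnj_vec a) / 2) *s DF z (ax 0)"
    unfolding hess_revec[symmetric]
    by (simp add: dbar_def DG(2)[OF Fz(2)] DG_DF[OF z(1)] D2x(2) vec_eq_iff algebra_simps)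
  ultimately show ?thesis
    by (simp add: psi_scale)
qed

end

text \<open>Coordinate 0 of the test vector is free, so it may be chosen tangent and pulled back by
  \<open>G\<close>; then \<open>hess_DF\<close> applies with a zero Hessian on the side of
  \<open>S\<close>.\<close>

lemma ker_DF:
  assumes iso: "germ_iso S S' F G U V"
    and z: "z \<in> U" "z \<in> hypersurface e n S" and v: "v \<in> ker S z"
  shows "frechet_derivative F (at z) v \<in> ker S' (F z)"
proof -
  note iso' = germ_iso_sym[OF iso]
  have Fz: "F z \<in> hypersurface e n S'" "F z \<in> V" "G (F z) = z"
    using iso_facts[OF iso] z by auto
  have psi_v: "psi S z v = 0" using v by (simp add: ker_def)
  have "hess S' (F z) (frechet_derivative F (at z) v) b = 0" for b
  proof -
    let ?y = "hol_section S' (\<lambda>_. cnj_vec b) (F z)"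
    let ?a = "frechet_derivative G (at (F z)) ?y"
    have "psi S z ?a = 0"
      using psi_DF[OF iso' Fz(2,1) psi_hol_section] by (simp add: Fz(3))
    from hess_DF[OF iso z psi_v this]
    have "hess S' (F z) (frechet_derivative F (at z) v) (cnj_vec ?y) = 0"
      using v DG_DF[OF iso' Fz(2), of ?y] by (simp add: ker_def Fz(3))
    moreover have "hess S' (F z) (frechet_derivative F (at z) v) (cnj_vec ?y) = hess S' (F z) (frechet_derivative F (at z) v) b"
      unfolding hess_def by (rule diff2_cong) (auto simp: hol_section_def e_eq_iff)
    ultimately show ?thesis by simp
  qed
  then show ?thesis
    using psi_DF[OF iso z psi_v] by (simp add: ker_def)
qed

text \<open>The probe points of \<open>column_chain_of_ker\<close> with \<open>s = t\<close>. For
  each of the finitely many pairs they tend to 0 with \<open>s\<close>.\<close>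

lemma ex_small_graph_points:
  assumes U: "open U" "0 \<in> U"
  shows "\<exists>s>0. \<forall>i\<in>{1..<n}. \<forall>k\<in>{1..<n}. graph S (of_real s *s ax i + of_real s *s ax k + of_real s *s ax n) \<in> U"
proof -
  have "\<forall>\<^sub>F s in at_right 0. graph S (of_real s *s ax i + of_real s *s ax k + of_real s *s ax n) \<in> U" for i k
  proof -
    let ?f = "\<lambda>s::real. graph S (of_real s *s ax i + of_real s *s ax k + of_real s *s ax n)"
    have "continuous_on UNIV (graph S)"
      using has_derivative_graph has_derivative_continuous
      by (intro continuous_at_imp_continuous_on) blast
    moreover have "continuous_on UNIV (\<lambda>s::real. of_real s *s ax i + of_real s *s ax k + of_real s *s ax n)"
      by (intro continuous_on_add bounded_linear.continuous_on[OF bounded_linear_vector_scalar_mult_left]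
          continuous_on_of_real continuous_on_id)
    ultimately have "continuous_on UNIV ?f"
      by (rule continuous_on_compose2) auto
    then have "isCont ?f 0"
      by (simp add: continuous_on_eq_continuous_at)
    then have t: "(?f \<longlongrightarrow> ?f 0) (at_right 0)"
      unfolding isCont_def by (rule tendsto_mono[OF at_le[OF subset_UNIV]])
    have "?f 0 = 0"
      using graph_id[OF zero_in_hypersurface] by simp
    then show ?thesis
      using topological_tendstoD[OF t U(1)] U(2) by (simp only: simp_thms)
  qed
  then have "\<forall>\<^sub>F s in at_right 0. \<forall>i\<in>{1..<n}. \<forall>k\<in>{1..<n}. graph S (of_real s *s ax i + of_real s *s ax k + of_real s *s ax n) \<in> U"
    by (intro eventually_ball_finite ballI) auto
  moreover have "\<forall>\<^sub>F s in at_right (0::real). s > 0"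
    by (simp add: eventually_at_right_less)
  ultimately show ?thesis
    using eventually_conj[THEN eventually_happens'[OF trivial_limit_at_right_real]] by blast
qed

text \<open>All ratios zero means \<open>N = 0\<close>, hence \<open>A' = A N = 0\<close>, and the
  equation does not involve \<open>z\<^sub>n\<close>.\<close>

lemma ax_n_in_ker:
  assumes S: "sym_coef S" and r: "column_chain n S r" and z: "\<And>m. 0 < m \<Longrightarrow> Suc m < n \<Longrightarrow> r m = 0"
  shows "ax n \<in> ker S q"
proof -
  have N: "kernel_matrix r t j k = 0" if "j \<in> {1..<n}" "k \<in> {1..<n}" for t j k
  proof -
    have "(\<Prod>m\<in>{k..<j}. r m) = 0" if "k < j"
    proof (intro prod_zero bexI[of _ k])
      have "0 < k" "Suc k < n" using that \<open>j \<in> {1..<n}\<close> \<open>k \<in> {1..<n}\<close> by auto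
      then show "r k = 0" by (rule z)
    qed (use that in auto)
    then show ?thesis by (simp add: kernel_matrix_def)
  qed
  have "coef' n S (re q n) i k = 0" if "i \<in> {1..<n}" "k \<in> {1..<n}" for i k
    unfolding sum_coef_kernel_matrix[OF r that, symmetric] using N that by (intro sum.neutral) auto
  then have "diff1 n S (re q) (co (ax n)) = 0"
    unfolding diff1_def by (intro sum.neutral ballI) (auto simp: ax_nth)
  moreover have "slope r q j = 0" if "j \<in> {1..<n}" for j
    unfolding slope_def using N that by (intro sum.neutral) auto
  ultimately show ?thesis
    using n_gt by (simp add: ker_chain[OF S r] psi_def ax_nth)
qed

text \<open>
  If all \<open>r m\<close> vanish for \<open>S\<close>, then \<open>W = \<partial>\<^sub>n F\<close> spans the kernel of \<open>S'\<close> and \<open>W\<^sub>j / W\<^sub>n\<close> is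
  holomorphic, but real on the hypersurface, hence stationary along the complex directions.
\<close>
lemma nondeg_chain_invariant:
  assumes iso: "germ_iso S S' F G U V" and S: "sym_coef S" and S': "sym_coef S'" and r': "nondeg_chain S' r'"
  shows "\<exists>r. nondeg_chain S r"
proof -
  note iso' = germ_iso_sym[OF iso]
  note facts = iso_facts[OF iso]
  have chain': "column_chain n S' r'" using r' by (simp add: nondeg_chain_def)
  let ?DF = "\<lambda>z. frechet_derivative F (at z)" and ?DG = "\<lambda>z. frechet_derivative G (at z)"
  \<comment> \<open>Kernels correspond, so for \<open>S\<close> the kernel at the origin lies in a
    line and the kernels near it are nonzero, as \<open>column_chain_of_ker\<close> demands.\<close>
  obtain r where r: "column_chain n S r"
  proof -
    obtain s where s: "s > 0"
      "\<And>i k. i \<in> {1..<n} \<Longrightarrow> k \<in> {1..<n} \<Longrightarrow> graph S (of_real s *s ax i + of_real s *s ax k + of_real s *s ax n) \<in> U"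
      using ex_small_graph_points[OF facts(1,3)] by blast
    have "\<exists>r. column_chain n S r"
    proof (rule column_chain_of_ker[OF S, where s = s and t = s])
      show "v $ e j = 0" if v: "v \<in> ker S 0" "j \<in> {1..<n}" for v j
      proof (rule ker_at_zero_line[OF S _ v])
        fix v assume v: "v \<in> ker S 0"
        have "?DF 0 v \<in> ker S' 0"
          using ker_DF[OF iso facts(3) zero_in_hypersurface v] by (simp add: facts(5))
        then have "?DF 0 v = (?DF 0 v $ e n) *s ker_section S' r' 1 0"
          using n_gt by (intro ker_eq_iff[OF S' chain'])
            (auto intro: ker_scale ker_section_in[OF S' chain'] simp: ker_section_nth)
        then show "\<exists>c. v = c *s ?DG 0 (ker_section S' r' 1 0)"
          using DG_DF[OF iso facts(3), of v] DG(2)[OF iso facts(4)] facts(5) by metis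
      qed
      fix i k assume ik: "i \<in> {1..<n}" "k \<in> {1..<n}"
      let ?q = "graph S (of_real s *s ax i + of_real s *s ax k + of_real s *s ax n)"
      let ?w = "ker_section S' r' 1 (F ?q)"
      have q: "?q \<in> U" "?q \<in> hypersurface e n S" using s(2)[OF ik] graph_in by auto
      have Fq: "F ?q \<in> V" "F ?q \<in> hypersurface e n S'" "G (F ?q) = ?q"
        using facts q by auto
      have "?DG (F ?q) ?w \<in> ker S ?q"
        using ker_DF[OF iso' Fq(1,2) ker_section_in[OF S' chain']] by (simp add: Fq(3))
      moreover have "?DG (F ?q) ?w \<noteq> 0"
      proof
        assume "?DG (F ?q) ?w = 0"
        then have "?w = ?DF ?q 0"
          using DG_DF[OF iso' Fq(1), of ?w] by (simp add: Fq(3))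
        then have "?w $ e n = 0" using DF_zero[OF iso q(1)] by simp
        then show False using n_gt by (simp add: ker_section_nth)
      qed
      moreover have "re ?q n = s" "\<forall>j\<in>{1..<n}. re ?q j = s * ((if j = i then 1 else 0) + (if j = k then 1 else 0))"
        using n_gt ik re_graph[of _ S] re_ax_sum[of _ s i k s] by auto
      ultimately show "\<exists>q v. v \<in> ker S q \<and> v \<noteq> 0 \<and> re q n = s \<and>
          (\<forall>j\<in>{1..<n}. re q j = s * ((if j = i then 1 else 0) + (if j = k then 1 else 0)))"
        by blast
    qed (use s in auto)
    then show thesis using that by blast
  qed
  have "\<exists>m. 0 < m \<and> Suc m < n \<and> r m \<noteq> 0"
  proof (rule ccontr)
    assume none: "\<not> (\<exists>m. 0 < m \<and> Suc m < n \<and> r m \<noteq> 0)"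
    obtain m where m: "0 < m" "Suc m < n" "r' m \<noteq> 0"
      using r' by (auto simp: nondeg_chain_def)
    have re0: "re 0 j = 0" for j by (simp add: re_def)
    define W where "W p = ?DF p (ax n)" for p
    have W_ker: "W p \<in> ker S' (F p)" if "p \<in> U" "p \<in> hypersurface e n S" for p
      unfolding W_def using none by (intro ker_DF[OF iso that] ax_n_in_ker[OF S r]) blast
    obtain W' where "((\<lambda>p. ?DF p (ax n)) has_derivative W') (at 0)" and W'_scale: "\<And>c u. W' (c *s u) = c *s W' u"
      by (rule holomorphic_map_on_second_derivative[OF facts(7,1,3), where v = "ax n"]) (rule that; assumption)
    then have W'_der: "(W has_derivative W') (at 0)"
      by (simp add: W_def[abs_def])
    let ?j = "Suc m"
    have j: "?j \<in> {1..<n}" using m by simp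
    have psi_axm: "psi S' 0 (ax m) = 0"
      using m by (simp add: psi_def ax_nth diff1_def re0)
    \<comment> \<open>The tangent vector with image \<open>ax m\<close>, the direction in which
      slope \<open>Suc m\<close> changes at rate \<open>r' m\<close>.\<close>
    define a where "a = ?DG 0 (ax m)"
    have a: "psi S 0 a = 0"
      using psi_DF[OF iso' facts(4) zero_in_hypersurface psi_axm] by (simp add: a_def facts(6))
    have DFa: "?DF 0 a = ax m"
      using DG_DF[OF iso' facts(4), of "ax m"] by (simp add: a_def facts(6))
    have "((\<lambda>p. of_real (slope r' (F p) ?j)) has_derivative (\<lambda>b. dslope r' (F 0) ?j (revec (?DF 0 b)))) (at 0)"
      by (rule has_derivative_compose[OF DF(1)[OF iso facts(3)] has_derivative_slope])
    then have slope_der: "((\<lambda>p. W p $ e ?j + W p $ e n * of_real (slope r' (F p) ?j)) has_derivative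
      (\<lambda>b. W' b $ e ?j + (W 0 $ e n * dslope r' (F 0) ?j (revec (?DF 0 b))
          + W' b $ e n * of_real (slope r' (F 0) ?j)))) (at 0)"
      by (intro has_derivative_add has_derivative_mult has_derivative_nth W'_der)
    have tangent: "W' b $ e ?j + W 0 $ e n * dslope r' 0 ?j (revec (?DF 0 b)) = 0"
      if "b \<in> tangent_space (hypersurface e n S) 0" for b
    proof -
      have "W p $ e ?j + W p $ e n * of_real (slope r' (F p) ?j) = 0" if "p \<in> hypersurface e n S" "p \<in> U" for p
        using W_ker[OF that(2,1)] j ker_chain[OF S' chain'] by blast
      moreover have "slope r' 0 ?j = 0" by (simp add: slope_def re0)
      ultimately show ?thesis
        using tangent_derivative_zero[OF slope_der facts(1,3) _ that] by (simp add: facts(5))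
    qed
    have revec: "revec (ax m) = ax m" "revec (\<i> *s ax m) = 0"
      by (simp_all add: revec_def ax_def mk_def vec_eq_iff)
    have d0: "dslope r' 0 ?j 0 = 0" by (simp add: dslope_def)
    have d1: "dslope r' 0 ?j (ax m) = of_real (r' m)"
    proof -
      have "dslope r' 0 ?j (ax m) = (\<Sum>k\<in>{1..<n}. if k = m then of_real (r' m) else 0)"
        unfolding dslope_def using m
        by (intro sum.cong refl) (auto simp: ax_nth kernel_matrix_def re0)
      then show ?thesis using m by simp
    qed
    \<comment> \<open>The image of \<open>\<i> *s a\<close> is imaginary and leaves the slope
      unchanged, so component \<open>Suc m\<close> of \<open>W'\<close> vanishes on it and, by
      complex linearity, on \<open>a\<close>. The equation along \<open>a\<close> then leaves
      \<open>W\<^sub>n r'\<^sub>m = 0\<close>.\<close>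
    have "W' (\<i> *s a) $ e ?j = 0"
      using tangent[OF hol_tangent_in_tangent(2)[OF zero_in_hypersurface a]]
      by (simp add: DF(2)[OF iso facts(3)] DFa revec d0)
    then have "W' a $ e ?j = 0" by (simp add: W'_scale)
    then have "W 0 $ e n = 0"
      using tangent[OF hol_tangent_in_tangent(1)[OF zero_in_hypersurface a]] m(3)
      by (simp add: DFa revec d1)
    \<comment> \<open>A kernel vector with last coordinate 0 is 0, which contradicts injectivity of
      the differential of \<open>F\<close>.\<close>
    then have "W 0 = 0"
      using W_ker[OF facts(3) zero_in_hypersurface] facts(5)
      by (intro ker_eq_iff[OF S' chain' _ zero_in_ker]) auto
    then have "ax n = ?DG 0 0"
      using DG_DF[OF iso facts(3), of "ax n"] facts(5) by (simp add: W_def)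
    then have "ax n $ e n = 0" using DF_zero[OF iso' facts(4)] by simp
    then show False by (simp add: ax_nth)
  qed
  then show ?thesis using r by (auto simp: nondeg_chain_def)
qed

end

subsection \<open>Diagonal scalings\<close>

text \<open>Entry \<open>(n - 1 - m, m)\<close> is reached from the antidiagonal along its row and,
  by symmetry, along its column.\<close>

lemma column_chain_reflect:
  assumes chain: "column_chain n S r" and sym: "\<forall>j\<in>{1..<n}. \<forall>k\<in>{1..<n}. S j k = S k j"
    and m: "0 < m" "Suc m < n"
  shows "r m * S (Suc m) (n - Suc m) = r (n - 1 - m) * S m (n - m)"
    and "r (n - 1 - m) = 0 \<longleftrightarrow> r m = 0"
proof -
  let ?i = "n - 1 - m"
  have i: "0 < ?i" "?i + m < n" "Suc ?i = n - m" "?i = n - Suc m" using m by auto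
  have "S ?i m = r m * S ?i (Suc m)" "S m ?i = r ?i * S m (Suc ?i)"
    using chain m i(1,2) by (auto simp: column_chain_def add.commute)
  moreover have "S ?i m = S m ?i" "S ?i (Suc m) = S (Suc m) ?i"
    using sym m i by auto
  ultimately show *: "r m * S (Suc m) (n - Suc m) = r ?i * S m (n - m)"
    using i by simp
  have "m \<in> {1..<n}" "Suc m \<in> {1..<n}" using m by auto
  then have "S (Suc m) (n - Suc m) \<noteq> 0" "S m (n - m) \<noteq> 0"
    using chain unfolding column_chain_def by blast+
  then show "r ?i = 0 \<longleftrightarrow> r m = 0"
    using * by auto
qed

text \<open>
  The antidiagonal and the ratios \<open>r\<close> are the edges of a path on the indices, ending in a loop at
  the middle index \<open>h\<close>: the scaling is fixed there up to sign first, and the sign is absorbed by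
  \<open>\<sigma>\<close> or \<open>\<tau>\<close>.
\<close>
lemma column_chain_scaling:
  assumes n: "2 < n"
    and chain: "column_chain n S r" and sym: "\<forall>j\<in>{1..<n}. \<forall>k\<in>{1..<n}. S j k = S k j"
    and chain': "column_chain n S' r'" and sym': "\<forall>j\<in>{1..<n}. \<forall>k\<in>{1..<n}. S' j k = S' k j"
    and support: "\<And>m. 0 < m \<Longrightarrow> Suc m < n \<Longrightarrow> r m = 0 \<longleftrightarrow> r' m = 0"
  shows "\<exists>\<sigma> \<tau> l. \<sigma> \<noteq> 0 \<and> \<tau> \<noteq> 0 \<and> (\<forall>j\<in>{1..<n}. l j \<noteq> (0::real)) \<and>
    (\<forall>j\<in>{1..<n}. \<forall>k\<in>{1..<n}. j + k \<le> n \<longrightarrow> \<sigma> * S j k = l j * l k * \<tau> ^ (n - j - k) * S' j k)"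
proof -
  define a where "a j = S j (n - j)" for j
  define a' where "a' j = S' j (n - j)" for j
  \<comment> \<open>Adjacent columns require \<open>l (Suc m) = l m * \<tau> * \<rho> m\<close>.
    Where both ratios vanish nothing is required, and the value 1 keeps \<rho> nonzero.\<close>
  define \<rho> where "\<rho> m = (if r m = 0 then 1 else r' m / r m)" for m
  define h where "h = n div 2"
  have h: "1 \<le> h" "h < n" using n by (auto simp: h_def)
  have a: "a j \<noteq> 0" "a' j \<noteq> 0" "a (n - j) = a j" "a' (n - j) = a' j" if "j \<in> {1..<n}" for j
  proof -
    have "n - j \<in> {1..<n}" "n - (n - j) = j" using that by auto
    then show "a (n - j) = a j" "a' (n - j) = a' j"
      using sym sym' that by (auto simp: a_def a'_def)
    show "a j \<noteq> 0" "a' j \<noteq> 0"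
      using chain chain' that unfolding column_chain_def a_def a'_def by blast+
  qed
  have \<rho>0: "\<rho> m \<noteq> 0" if "0 < m" "Suc m < n" for m
    using support[OF that] by (auto simp: \<rho>_def)
  \<comment> \<open>Symmetry ties the ratios at \<open>m\<close> and \<open>n - 1 - m\<close>, so
    the upper half of \<open>l\<close> will inherit its steps from the lower half.\<close>
  have reflect: "a (Suc m) * \<rho> (n - 1 - m) * a' m = \<rho> m * a' (Suc m) * a m" if m: "0 < m" "Suc m < n" "r m \<noteq> 0" for m
  proof -
    have 1: "r m * a (Suc m) = r (n - 1 - m) * a m" "r (n - 1 - m) \<noteq> 0"
      using column_chain_reflect[OF chain sym m(1,2)] m(3) by (auto simp: a_def)
    have 2: "r' m * a' (Suc m) = r' (n - 1 - m) * a' m"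
      using column_chain_reflect[OF chain' sym' m(1,2)] by (auto simp: a'_def)
    have "a (Suc m) * \<rho> (n - 1 - m) * a' m = a (Suc m) * (r' (n - 1 - m) * a' m) / r (n - 1 - m)"
      using 1 by (simp add: \<rho>_def)
    also have "\<dots> = (r m * a (Suc m)) * (r' m * a' (Suc m)) / (r (n - 1 - m) * r m)"
      unfolding 2[symmetric] using m(3) by simp
    also have "\<dots> = \<rho> m * a' (Suc m) * a m"
      using 1(2) m(3) unfolding 1(1) by (simp add: \<rho>_def)
    finally show ?thesis .
  qed
  \<comment> \<open>The loop equation for \<open>x = l h\<close>. For even \<open>n\<close>,
    \<open>h\<close> is its own antidiagonal partner. For odd \<open>n\<close> the partner is
    \<open>Suc h\<close>, with \<open>l (Suc h) = x * \<tau> * \<rho> h\<close>.\<close>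
  have "\<exists>\<sigma> \<tau> x. \<sigma> \<noteq> 0 \<and> \<tau> \<noteq> 0 \<and> x \<noteq> 0 \<and> (even n \<longrightarrow> x\<^sup>2 * a' h = \<sigma> * a h) \<and>
      (odd n \<longrightarrow> x\<^sup>2 * (a' h * \<tau> * \<rho> h) = \<sigma> * a h)"
  proof (cases "even n")
    case True
    define \<kappa> where "\<kappa> = a h / a' h"
    have \<kappa>: "\<kappa> \<noteq> 0" using a h by (simp add: \<kappa>_def)
    have "(sqrt \<bar>\<kappa>\<bar>)\<^sup>2 * a' h = sgn \<kappa> * (\<kappa> * a' h)"
      by (simp only: real_sqrt_pow2 abs_ge_zero) (simp add: abs_sgn mult_ac)
    also have "\<kappa> * a' h = a h" using a(2)[of h] h by (simp add: \<kappa>_def)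
    finally have "(sqrt \<bar>\<kappa>\<bar>)\<^sup>2 * a' h = sgn \<kappa> * a h" .
    then show ?thesis
      using True \<kappa> by (intro exI[of _ "sgn \<kappa>"] exI[of _ 1] exI[of _ "sqrt \<bar>\<kappa>\<bar>"]) (auto simp: sgn_zero_iff)
  next
    case False
    have "\<rho> h \<noteq> 0" using h n False by (intro \<rho>0) (auto simp: h_def elim: oddE)
    define \<kappa> where "\<kappa> = a h / (a' h * \<rho> h)"
    have \<kappa>: "\<kappa> \<noteq> 0" using a h \<open>\<rho> h \<noteq> 0\<close> by (simp add: \<kappa>_def)
    have "(sqrt \<bar>\<kappa>\<bar>)\<^sup>2 * (a' h * sgn \<kappa> * \<rho> h) = \<kappa> * (a' h * \<rho> h)"
      using \<kappa> by (simp add: abs_sgn sgn_if)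
    also have "\<dots> = a h" using a h \<open>\<rho> h \<noteq> 0\<close> by (simp add: \<kappa>_def)
    finally show ?thesis
      using False \<kappa> by (intro exI[of _ 1] exI[of _ "sgn \<kappa>"] exI[of _ "sqrt \<bar>\<kappa>\<bar>"]) (auto simp: sgn_zero_iff)
  qed
  then obtain \<sigma> \<tau> x where x: "\<sigma> \<noteq> 0" "\<tau> \<noteq> 0" "x \<noteq> 0" "even n \<Longrightarrow> x\<^sup>2 * a' h = \<sigma> * a h"
      "odd n \<Longrightarrow> x\<^sup>2 * (a' h * \<tau> * \<rho> h) = \<sigma> * a h"
    by blast
  define L where "L j = x * (\<Prod>m\<in>{j..<h}. 1 / (\<tau> * \<rho> m))" for j
  have L0: "L j \<noteq> 0" if "0 < j" for j
    using x(2,3) that h \<rho>0 by (auto simp: L_def)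
  have L_step: "L (Suc m) = L m * \<tau> * \<rho> m" if "0 < m" "Suc m \<le> h" for m
  proof -
    have "L m = L (Suc m) / (\<tau> * \<rho> m)"
      using that by (simp add: L_def prod.atLeast_Suc_lessThan)
    then show ?thesis using x(2) \<rho>0[of m] that h by simp
  qed
  \<comment> \<open>The lower half is propagated from the middle, the upper half is forced by the
    antidiagonal.\<close>
  define l where "l j = (if j \<le> h then L j else \<sigma> * a j / (a' j * L (n - j)))" for j
  have l0: "l j \<noteq> 0" if "j \<in> {1..<n}" for j
    using that a(1,2)[OF that] L0 x(1) by (auto simp: l_def)
  have l_upper: "l j = \<sigma> * a j / (a' j * L (n - j))" if j: "j \<in> {1..<n}" "n \<le> 2 * j" for j
  proof (cases "j \<le> h")
    case True
    then have "n = 2 * h" "j = h" using j by (auto simp: h_def)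
    then have "L j = x" "n - j = j" "x\<^sup>2 * a' j = \<sigma> * a j"
      using x(4) by (auto simp: L_def)
    then show ?thesis
      using True x(3) a(2)[OF j(1)] by (simp add: l_def field_simps power2_eq_square)
  qed (simp add: l_def)
  have anti: "l j * l (n - j) * a' j = \<sigma> * a j" if j: "j \<in> {1..<n}" for j
  proof -
    have *: "l j * l (n - j) * a' j = \<sigma> * a j" if j: "j \<in> {1..<n}" "2 * j \<le> n" for j
    proof -
      have "j \<le> h" using j by (simp add: h_def less_eq_div_iff_mult_less_eq mult.commute)
      then have "l j = L j" by (simp add: l_def)
      moreover have "n - j \<in> {1..<n}" "n - (n - j) = j" using j by auto
      then have "l (n - j) = \<sigma> * a j / (a' j * L j)"
        using l_upper[of "n - j"] a(3,4)[OF j(1)] j by auto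
      ultimately show ?thesis
        using L0[of j] a(2)[OF j(1)] j by simp
    qed
    show ?thesis
    proof (cases "2 * j \<le> n")
      case False
      then have "n - j \<in> {1..<n}" "n - (n - j) = j" "2 * (n - j) \<le> n" using j by auto
      then show ?thesis using *[of "n - j"] a(3,4)[OF j] by (simp add: mult_ac)
    qed (rule *[OF j])
  qed
  have step: "l (Suc m) = l m * \<tau> * \<rho> m" if m: "0 < m" "Suc m < n" "r m \<noteq> 0" for m
  proof -
    have mI: "m \<in> {1..<n}" "Suc m \<in> {1..<n}" using m by auto
    note nz = a(1,2)[OF mI(1)] a(1,2)[OF mI(2)]
    \<comment> \<open>The step lies in the lower half, in the upper half, or crosses the middle of
      an odd \<open>n\<close>.\<close>
    consider "Suc m \<le> h" | "n \<le> 2 * m" | "n = 2 * m + 1" "m = h" by (force simp: h_def)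
    then show ?thesis
    proof cases
      case 1
      then show ?thesis using L_step[OF m(1)] by (simp add: l_def)
    next
      case 2
      have "L (n - m) = L (n - Suc m) * \<tau> * \<rho> (n - 1 - m)"
        using L_step[of "n - Suc m"] m 2 by (auto simp: h_def Suc_diff_Suc)
      moreover have "L (n - Suc m) \<noteq> 0" using L0 m by simp
      moreover have "\<rho> (n - 1 - m) \<noteq> 0" using m by (intro \<rho>0) auto
      moreover have "l (Suc m) = \<sigma> * a (Suc m) / (a' (Suc m) * L (n - Suc m))"
        using l_upper[OF mI(2)] 2 by simp
      moreover have "l m = \<sigma> * a m / (a' m * L (n - m))"
        using l_upper[OF mI(1)] 2 by simp
      ultimately have "l m * \<tau> * \<rho> m = \<sigma> * (\<rho> m * a' (Suc m) * a m)
          / (a' m * L (n - Suc m) * \<rho> (n - 1 - m) * a' (Suc m))"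
          and "l (Suc m) = \<sigma> * (a (Suc m) * \<rho> (n - 1 - m) * a' m)
          / (a' m * L (n - Suc m) * \<rho> (n - 1 - m) * a' (Suc m))"
        using nz x(2) by (simp_all add: mult_ac)
      then show ?thesis unfolding reflect[OF m] by simp
    next
      case 3
      then have nm: "n - Suc m = m" by simp
      have "L m = x" using 3 by (simp add: L_def)
      have "a (Suc m) = a m" "a' (Suc m) = a' m"
        using a(3,4)[OF mI(1)] 3(1) by auto
      then have "l (Suc m) = \<sigma> * a m / (a' m * x)"
        using l_upper[OF mI(2)] nm \<open>L m = x\<close> 3 by simp
      also have "\<dots> = x * \<tau> * \<rho> m"
        using x(5) 3 nz x(3) by (simp add: field_simps power2_eq_square)
      also have "\<dots> = l m * \<tau> * \<rho> m"
        using 3 \<open>L m = x\<close> by (simp add: l_def)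
      finally show ?thesis .
    qed
  qed
  \<comment> \<open>By induction from the antidiagonal to the left, one column at a time.\<close>
  have "\<sigma> * S j k = l j * l k * \<tau> ^ (n - j - k) * S' j k" if "j \<in> {1..<n}" "k \<in> {1..<n}" "j + k \<le> n" for j k
    using that
  proof (induction "n - j - k" arbitrary: k)
    case 0
    then have "k = n - j" by auto
    then show ?case using anti[OF 0(2)] by (simp add: a_def a'_def mult_ac)
  next
    case (Suc d)
    then have jk: "0 < j" "0 < k" "j + k < n" "Suc k < n" "d = n - j - Suc k" by auto
    have S: "S j k = r k * S j (Suc k)" "S' j k = r' k * S' j (Suc k)"
      using chain chain' jk by (auto simp: column_chain_def)
    show ?case
    proof (cases "r k = 0")
      case True
      then show ?thesis using S support[of k] jk by simp
    next
      case False
      have "\<sigma> * S j (Suc k) = l j * l (Suc k) * \<tau> ^ d * S' j (Suc k)"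
        using Suc(1)[of "Suc k"] Suc.prems jk by simp
      then have "\<sigma> * S j k = r k * (l j * (l k * \<tau> * \<rho> k) * \<tau> ^ d * S' j (Suc k))"
        using S step[of k] False jk by (simp add: mult_ac)
      also have "\<dots> = l j * l k * \<tau> ^ Suc d * (r k * \<rho> k * S' j (Suc k))"
        by (simp add: mult_ac)
      also have "r k * \<rho> k = r' k" using False by (simp add: \<rho>_def)
      finally show ?thesis
        using S(2) Suc(2) by simp
    qed
  qed
  with x(1,2) l0 have "\<sigma> \<noteq> 0 \<and> \<tau> \<noteq> 0 \<and> (\<forall>j\<in>{1..<n}. l j \<noteq> 0) \<and>
    (\<forall>j\<in>{1..<n}. \<forall>k\<in>{1..<n}. j + k \<le> n \<longrightarrow> \<sigma> * S j k = l j * l k * \<tau> ^ (n - j - k) * S' j k)"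
    by simp
  then show ?thesis
    by (rule exI[of _ \<sigma>, OF exI[of _ \<tau>, OF exI[of _ l]]])
qed

lemma locally_equivalent_diagonal:
  fixes d :: "'m::finite \<Rightarrow> complex"
  assumes d: "\<And>i. d i \<noteq> 0" and M: "\<And>z. z \<in> M \<longleftrightarrow> (\<chi> i. d i * z $ i) \<in> M'"
  shows "locally_equivalent M M'"
proof -
  have holo: "holomorphic_map_on (\<lambda>z. \<chi> i. c i * z $ i) UNIV" for c :: "'m \<Rightarrow> complex"
    unfolding holomorphic_map_on_def
  proof
    fix z :: "complex^'m"
    have "((\<lambda>z. \<chi> i. c i * z $ i) has_derivative (\<lambda>z. \<chi> i. c i * z $ i)) (at z)"
      by (rule has_derivative_vec_lambda)
        (simp only: vec_lambda_beta, intro has_derivative_mult_right bounded_linear_imp_has_derivative bounded_linear_vec_nth)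
    moreover have "(\<chi> i. c i * (a *s v) $ i) = a *s (\<chi> i. c i * v $ i)" for a v
      by (simp add: vec_eq_iff)
    ultimately show "\<exists>D. ((\<lambda>z. \<chi> i. c i * z $ i) has_derivative D) (at z) \<and> (\<forall>c v. D (c *s v) = c *s D v)"
      by blast
  qed
  let ?F = "\<lambda>z. \<chi> i. d i * z $ i" and ?G = "\<lambda>z. \<chi> i. (1 / d i) * z $ i"
  have GF: "?G (?F z) = z" "?F (?G z) = z" for z
    using d by (auto simp: vec_eq_iff)
  show ?thesis
    unfolding locally_equivalent_def
  proof (rule exI[of _ ?F], rule exI[of _ ?G], rule exI[of _ UNIV], rule exI[of _ UNIV], intro conjI)
    show "?F ` (M \<inter> UNIV) = M' \<inter> UNIV"
    proof (intro set_eqI iffI)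
      fix w assume "w \<in> M' \<inter> UNIV"
      then have "?F (?G w) \<in> M'" by (simp only: GF Int_UNIV_right)
      then have "?G w \<in> M" using M by blast
      then show "w \<in> ?F ` (M \<inter> UNIV)" by (intro image_eqI[of _ _ "?G w"]) (simp_all only: GF Int_UNIV_right)
    qed (use M in auto)
    show "?F ` UNIV = UNIV" by (rule surjI[of ?F ?G]) (rule GF(2))
    show "?G ` UNIV = UNIV" by (rule surjI[of ?G ?F]) (rule GF(1))
    show "?F 0 = 0" by (simp add: vec_eq_iff)
    show "\<forall>z\<in>UNIV. ?G (?F z) = z" "\<forall>z\<in>UNIV. ?F (?G z) = z"
      using GF by blast+
  qed (simp_all only: holo open_UNIV UNIV_I)
qed

section \<open>Symmetry and transitivity of local equivalence\<close>

lemma locally_equivalent_sym: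
  assumes "locally_equivalent M M'"
  shows "locally_equivalent M' M"
proof -
  obtain F G U V where *: "open U" "open V" "0 \<in> U" "0 \<in> V" "F 0 = 0" "holomorphic_map_on F U"
      "holomorphic_map_on G V" "F ` U = V" "G ` V = U" "\<forall>z\<in>U. G (F z) = z" "\<forall>w\<in>V. F (G w) = w"
      and M: "F ` (M \<inter> U) = M' \<inter> V"
    using assms unfolding locally_equivalent_def by (elim exE conjE) (rule that; assumption)
  have "G ` (M' \<inter> V) = M \<inter> U"
    unfolding M[symmetric] image_image using *(10) by force
  moreover have "G 0 = 0" using *(3,5,10) by metis
  ultimately show ?thesis
    unfolding locally_equivalent_def using * by blast
qed

lemma holomorphic_map_on_compose:
  assumes F: "holomorphic_map_on F U" and F': "holomorphic_map_on F' V" and FU: "F ` U \<subseteq> V"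
  shows "holomorphic_map_on (\<lambda>z. F' (F z)) U"
  unfolding holomorphic_map_on_def
proof
  fix z assume z: "z \<in> U"
  obtain D where D: "(F has_derivative D) (at z)" "\<forall>c v. D (c *s v) = c *s D v"
    using F z by (auto simp: holomorphic_map_on_def)
  obtain D' where D': "(F' has_derivative D') (at (F z))" "\<forall>c v. D' (c *s v) = c *s D' v"
    using F' subsetD[OF FU imageI[OF z]] by (auto simp: holomorphic_map_on_def)
  show "\<exists>D. ((\<lambda>z. F' (F z)) has_derivative D) (at z) \<and> (\<forall>c v. D (c *s v) = c *s D v)"
    using has_derivative_compose[OF D(1) D'(1)] D(2) D'(2) by (intro exI[of _ "\<lambda>v. D' (D v)"]) simp
qed

lemma holomorphic_map_on_continuous: "holomorphic_map_on F U \<Longrightarrow> continuous_on U F"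
  using has_derivative_continuous
  by (intro continuous_at_imp_continuous_on) (force simp: holomorphic_map_on_def)

lemma holomorphic_map_on_subset: "holomorphic_map_on F U \<Longrightarrow> W \<subseteq> U \<Longrightarrow> holomorphic_map_on F W"
  by (auto simp: holomorphic_map_on_def)

lemma locally_equivalent_trans:
  assumes "locally_equivalent M M'" "locally_equivalent M' M''"
  shows "locally_equivalent M M''"
proof -
  obtain F G U V where 1: "open U" "open V" "0 \<in> U" "0 \<in> V" "F 0 = 0" "holomorphic_map_on F U"
      "holomorphic_map_on G V" "F ` U = V" "G ` V = U" "\<forall>z\<in>U. G (F z) = z" "\<forall>w\<in>V. F (G w) = w"
      and M1: "F ` (M \<inter> U) = M' \<inter> V"
    using assms(1) unfolding locally_equivalent_def by (elim exE conjE) (rule that; assumption)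
  obtain F' G' U' V' where 2: "open U'" "open V'" "0 \<in> U'" "0 \<in> V'" "F' 0 = 0" "holomorphic_map_on F' U'"
      "holomorphic_map_on G' V'" "F' ` U' = V'" "G' ` V' = U'" "\<forall>z\<in>U'. G' (F' z) = z" "\<forall>w\<in>V'. F' (G' w) = w"
      and M2: "F' ` (M' \<inter> U') = M'' \<inter> V'"
    using assms(2) unfolding locally_equivalent_def by (elim exE conjE) (rule that; assumption)
  define A where "A = {z \<in> U. F z \<in> U'}"
  define B where "B = {w \<in> V'. G' w \<in> V}"
  have sub: "A \<subseteq> U" "B \<subseteq> V'" by (auto simp: A_def B_def)
  have "open A"
    unfolding A_def using continuous_open_preimage[OF holomorphic_map_on_continuous[OF 1(6)] 1(1) 2(1)]
    by (simp add: vimage_def Int_def)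
  moreover have "open B"
    unfolding B_def using continuous_open_preimage[OF holomorphic_map_on_continuous[OF 2(7)] 2(2) 1(2)]
    by (simp add: vimage_def Int_def)
  moreover have "0 \<in> A" using 1 2 by (simp add: A_def)
  moreover have "G' 0 = 0" using 2(3,5,10) by metis
  then have "0 \<in> B" using 1 2 by (simp add: B_def)
  moreover have "holomorphic_map_on (\<lambda>z. F' (F z)) A"
    using holomorphic_map_on_subset[OF 1(6) sub(1)] 2(6)
    by (rule holomorphic_map_on_compose) (auto simp: A_def)
  moreover have "holomorphic_map_on (\<lambda>z. G (G' z)) B"
    using holomorphic_map_on_subset[OF 2(7) sub(2)] 1(7)
    by (rule holomorphic_map_on_compose) (auto simp: B_def)
  moreover have GF: "\<forall>z\<in>A. G (G' (F' (F z))) = z" "\<forall>w\<in>B. F' (F (G (G' w))) = w"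
    using 1(10,11) 2(10,11) by (auto simp: A_def B_def)
  moreover have AB: "F' (F z) \<in> B" if "z \<in> A" for z
    using that 1(8) 2(8,10) by (auto simp: A_def B_def)
  moreover have BA: "G (G' w) \<in> A" if "w \<in> B" for w
    using that 2(9) 1(9,11) by (auto simp: A_def B_def)
  moreover have "(\<lambda>z. F' (F z)) ` A = B"
    using AB BA GF by (force intro!: image_eqI)
  moreover have "(\<lambda>w. G (G' w)) ` B = A"
    using AB BA GF by (force intro!: image_eqI)
  moreover have "(\<lambda>z. F' (F z)) ` (M \<inter> A) = M'' \<inter> B"
  proof (intro set_eqI iffI)
    fix w assume "w \<in> (\<lambda>z. F' (F z)) ` (M \<inter> A)"
    then obtain z where z: "z \<in> M" "z \<in> A" "w = F' (F z)" by auto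
    then have "F z \<in> M'" "F z \<in> U'" using M1 by (auto simp: A_def)
    then show "w \<in> M'' \<inter> B" using M2 AB[OF z(2)] z(3) by auto
  next
    fix w assume w: "w \<in> M'' \<inter> B"
    then have "w \<in> F' ` (M' \<inter> U')" using M2 by (auto simp: B_def)
    then have "G' w \<in> M'" using 2(10) by auto
    then have "G' w \<in> F ` (M \<inter> U)" using M1 w by (auto simp: B_def)
    then have "G (G' w) \<in> M" using 1(10) by auto
    then show "w \<in> (\<lambda>z. F' (F z)) ` (M \<inter> A)"
      using BA GF(2) w by (intro image_eqI[of _ _ "G (G' w)"]) auto
  qed
  ultimately show ?thesis
    unfolding locally_equivalent_def
    by (rule_tac exI[of _ "\<lambda>z. F' (F z)"], rule_tac exI[of _ "\<lambda>w. G (G' w)"], rule_tac exI[of _ A], rule_tac exI[of _ B])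
      (simp add: 1(5) 2(5))
qed

context tube
begin

lemma locally_equivalent_chain:
  assumes S: "sym_coef S" "column_chain n S r" and S': "sym_coef S'" "column_chain n S' r'"
    and support: "\<And>m. 0 < m \<Longrightarrow> Suc m < n \<Longrightarrow> r m = 0 \<longleftrightarrow> r' m = 0"
  shows "locally_equivalent (hypersurface e n S) (hypersurface e n S')"
proof -
  have "\<exists>\<sigma> \<tau> l. \<sigma> \<noteq> 0 \<and> \<tau> \<noteq> 0 \<and> (\<forall>j\<in>{1..<n}. l j \<noteq> (0::real)) \<and>
      (\<forall>j\<in>{1..<n}. \<forall>k\<in>{1..<n}. j + k \<le> n \<longrightarrow> \<sigma> * S j k = l j * l k * \<tau> ^ (n - j - k) * S' j k)"
    by (rule column_chain_scaling[OF n_gt S(2) S(1)[unfolded sym_coef_def] S'(2) S'(1)[unfolded sym_coef_def] support])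
  then obtain \<sigma> \<tau> l where *: "\<sigma> \<noteq> 0 \<and> \<tau> \<noteq> 0 \<and> (\<forall>j\<in>{1..<n}. l j \<noteq> (0::real)) \<and>
      (\<forall>j\<in>{1..<n}. \<forall>k\<in>{1..<n}. j + k \<le> n \<longrightarrow> \<sigma> * S j k = l j * l k * \<tau> ^ (n - j - k) * S' j k)"
    by (elim exE) (rule that)
  from * have l: "\<sigma> \<noteq> 0" "\<tau> \<noteq> 0" "\<And>j. j \<in> {1..<n} \<Longrightarrow> l j \<noteq> 0"
    "\<And>j k. j \<in> {1..<n} \<Longrightarrow> k \<in> {1..<n} \<Longrightarrow> j + k \<le> n \<Longrightarrow> \<sigma> * S j k = l j * l k * \<tau> ^ (n - j - k) * S' j k"
    by auto
  \<comment> \<open>The weights of the coordinates. They are real, so the diagonal map commutes with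
    taking real parts.\<close>
  define c where "c j = (if j = 0 then \<sigma> else if j = n then \<tau> else l j)" for j
  define d where "d i = complex_of_real (c (inv_into {0..n} e i))" for i
  have c0: "c j \<noteq> 0" if "j \<le> n" for j
    using l that by (auto simp: c_def)
  have d: "d (e j) = of_real (c j)" if "j \<le> n" for j
    using that bij by (simp add: d_def bij_betw_def inv_into_f_f)
  show ?thesis
  proof (rule locally_equivalent_diagonal[where d = d])
    show "d i \<noteq> 0" for i
      using e_cases[of i] c0 d by (metis of_real_eq_0_iff)
    fix z :: "complex^'m"
    let ?z = "\<chi> i. d i * z $ i"
    have re: "re ?z j = c j * re z j" if "j \<le> n" for j
      using that by (simp add: re_def d)
    have "defining_poly n S' (re ?z) = \<sigma> * defining_poly n S (re z)"
      unfolding defining_poly_def sum_distrib_left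
    proof (intro sum.cong refl)
      fix j k assume jk: "j \<in> {1..<n}" "k \<in> {1..<n}"
      show "coef n S' (re ?z n) j k * (re ?z j * re ?z k) = \<sigma> * (coef n S (re z n) j k * (re z j * re z k))"
      proof (cases "j + k \<le> n")
        case True
        have "coef n S' (re ?z n) j k * (re ?z j * re ?z k)
            = (l j * l k * \<tau> ^ (n - j - k) * S' j k) * (re z n ^ (n - j - k) * (re z j * re z k))"
          using jk n_gt True by (simp add: coef_def re c_def power_mult_distrib mult_ac)
        also have "\<dots> = \<sigma> * (coef n S (re z n) j k * (re z j * re z k))"
          unfolding l(4)[OF jk True, symmetric] using True by (simp add: coef_def)
        finally show ?thesis .
      qed (simp add: coef_def)
    qed
    moreover have "Re (?z $ e 0) = \<sigma> * Re (z $ e 0)"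
      by (simp add: d c_def)
    ultimately show "z \<in> hypersurface e n S \<longleftrightarrow> ?z \<in> hypersurface e n S'"
      using l(1) by (simp add: hypersurface_eq)
  qed
qed

end

subsection \<open>Block anti-diagonal matrices\<close>

text \<open>The inner block boundaries. They encode a composition of \<open>n - 1\<close> as a
  subset of \<open>{1..n - 2}\<close>, which will be the set of columns with ratio zero.\<close>

definition cuts :: "nat list \<Rightarrow> nat set"
  where "cuts ns = {sum_list (take i ns) | i. 0 < i \<and> i < length ns}"

context
  fixes ns :: "nat list" and n :: nat
  assumes pos: "\<forall>m\<in>set ns. m > 0" and total: "sum_list ns = n - 1" and n: "2 < n"
begin

abbreviation "P i \<equiv> sum_list (take i ns)"

lemma P_Suc: "i < length ns \<Longrightarrow> P (Suc i) = P i + ns ! i"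
  by (simp add: take_Suc_conv_app_nth)

lemma P_less: "i < j \<Longrightarrow> j \<le> length ns \<Longrightarrow> P i < P j"
proof (induction j)
  case (Suc j)
  then have "P j < P (Suc j)" using pos by (simp add: P_Suc)
  then show ?case using Suc by (cases "i = j") auto
qed simp

lemma P_length: "P (length ns) = n - 1"
  by (simp add: total)

lemma P_le: "i \<le> j \<Longrightarrow> j \<le> length ns \<Longrightarrow> P i \<le> P j"
  using P_less[of i j] by (cases "i = j") auto

lemma P_drop: "i < length ns \<Longrightarrow> sum_list (drop (Suc i) ns) = n - 1 - P (Suc i)"
  using total by (metis append_take_drop_id diff_add_inverse sum_list_append)

lemma cuts_bounds: "m \<in> cuts ns \<Longrightarrow> 0 < m \<and> m < n - 1"
  using P_less[of 0] P_less[of _ "length ns"] P_length by (auto simp: cuts_def)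

lemma block_index_exists: 
  assumes "0 < k" "k < n"
  obtains i where "i < length ns" "P i < k" "k \<le> P (Suc i)"
proof -
  let ?i = "LEAST i. k \<le> P i"
  have ex: "k \<le> P (length ns)" using assms P_length by simp
  then have 1: "k \<le> P ?i" by (rule LeastI)
  have 2: "?i \<le> length ns" using ex by (rule Least_le)
  have "?i \<noteq> 0" using 1 assms(1) by (metis neq0_conv not_le sum_list.Nil take0)
  then obtain i where i: "?i = Suc i" using not0_implies_Suc by blast
  moreover have "P i < k" using not_less_Least[of i "\<lambda>i. k \<le> P i"] i by simp
  ultimately show thesis using that[of i] 1 2 by simp
qed

text \<open>Row \<open>j\<close> meets the antidiagonal in column \<open>n - j\<close>. An entry on
  or above the antidiagonal is 1 iff no cut separates column \<open>k\<close> from column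
  \<open>n - j\<close>, that is, iff both lie in one block.\<close>

lemma block_antidiagonal_eq:
  assumes j: "0 < j" "j < n" and k: "0 < k" "k < n"
  shows "block_antidiagonal ns j k =
    (if j + k \<le> n \<and> (\<forall>m\<in>cuts ns. \<not> (k \<le> m \<and> m + j < n)) then 1 else 0)"
proof -
  \<comment> \<open>Column \<open>k\<close> is right of the blocks before \<open>i\<close> and row
    \<open>j\<close> is below those after it; the triangular shape becomes
    \<open>j + k \<le> n\<close> for every \<open>i\<close>.\<close>
  let ?c = "\<lambda>i. P i < k \<and> n \<le> j + P (Suc i) \<and> j + k \<le> n"
  have "block_antidiagonal ns j k = (\<Sum>i<length ns. if ?c i then 1 else 0)"
    unfolding block_antidiagonal_def Let_def
  proof (intro sum.cong refl)
    fix i assume "i \<in> {..<length ns}"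
    then have i: "i < length ns" by simp
    have le: "P (Suc i) \<le> n - 1" using P_le[of "Suc i" "length ns"] P_length i by simp
    show "(if sum_list (drop (Suc i) ns) < j \<and> P i < k
        then triangular_block (ns ! i) (j - sum_list (drop (Suc i) ns)) (k - P i) else 0)
      = (if ?c i then 1 else 0)"
      using le n P_Suc[OF i] by (auto simp: P_drop[OF i] triangular_block_def)
  qed
  also have "\<dots> = (if j + k \<le> n \<and> (\<forall>m\<in>cuts ns. \<not> (k \<le> m \<and> m + j < n)) then 1 else 0)"
  proof -
    obtain i0 where i0: "i0 < length ns" "P i0 < k" "k \<le> P (Suc i0)"
      using block_index_exists[OF k] by blast
    \<comment> \<open>The condition gives \<open>P i < k \<le> n - j \<le> P (Suc i)\<close>, so
      block \<open>i\<close> is the one containing column \<open>k\<close>.\<close>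
    have uniq: "i = i0" if "i < length ns" "?c i" for i
    proof (rule ccontr)
      assume "i \<noteq> i0"
      then consider "Suc i \<le> i0" | "Suc i0 \<le> i" by linarith
      then show False
      proof cases
        case 1
        then have "P (Suc i) < k" using P_le[of "Suc i" i0] i0 by simp
        then show False using that by linarith
      next
        case 2
        then have "k \<le> P i" using P_le[of "Suc i0" i] i0 that by simp
        then show False using that by linarith
      qed
    qed
    have "(\<Sum>i<length ns. if ?c i then 1 else 0) = (\<Sum>i<length ns. if i = i0 then (if ?c i0 then 1 else 0) else (0::real))"
    proof (intro sum.cong refl)
      fix i assume "i \<in> {..<length ns}"
      then show "(if ?c i then 1 else 0) = (if i = i0 then (if ?c i0 then 1 else 0) else (0::real))"
      proof (cases "i = i0")
        case False
        then have "\<not> ?c i" using uniq[of i] \<open>i \<in> {..<length ns}\<close> by blast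
        with False show ?thesis by (simp only: if_not_P if_False)
      qed simp
    qed
    also have "\<dots> = (if ?c i0 then 1 else 0)"
      using i0 by simp
    also have "?c i0 \<longleftrightarrow> j + k \<le> n \<and> (\<forall>m\<in>cuts ns. \<not> (k \<le> m \<and> m + j < n))"
    proof
      assume c: "?c i0"
      have "\<not> (k \<le> m \<and> m + j < n)" if mc: "m \<in> cuts ns" for m
      proof
        assume m: "k \<le> m \<and> m + j < n"
        obtain i where i: "0 < i" "i < length ns" "m = P i" using mc by (auto simp: cuts_def)
        then have "\<not> i \<le> i0" using P_le[of i i0] i0 m by auto
        then have "P (Suc i0) \<le> m" using P_le[of "Suc i0" i] i by auto
        then show False using c m by linarith
      qed
      then show "j + k \<le> n \<and> (\<forall>m\<in>cuts ns. \<not> (k \<le> m \<and> m + j < n))" using c by blast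
    next
      assume c: "j + k \<le> n \<and> (\<forall>m\<in>cuts ns. \<not> (k \<le> m \<and> m + j < n))"
      have "n \<le> j + P (Suc i0)"
      proof (rule ccontr)
        assume lt: "\<not> n \<le> j + P (Suc i0)"
        then have "Suc i0 \<noteq> length ns" using P_length j by auto
        then have "P (Suc i0) \<in> cuts ns" using i0(1) by (auto simp: cuts_def)
        then show False using c i0(3) lt by auto
      qed
      then show "?c i0" using c i0 by blast
    qed
    finally show ?thesis .
  qed
  finally show ?thesis .
qed

text \<open>Passing from column \<open>m\<close> to \<open>Suc m\<close> drops exactly the cut
  \<open>m\<close> from the condition in \<open>block_antidiagonal_eq\<close>.\<close>

lemma block_antidiagonal_chain:
  "column_chain n (block_antidiagonal ns) (\<lambda>m. if m \<in> cuts ns then 0 else 1)"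
  unfolding column_chain_def
proof (intro conjI ballI allI impI)
  fix j assume j: "j \<in> {1..<n}"
  then show "block_antidiagonal ns j (n - j) \<noteq> 0"
    by (subst block_antidiagonal_eq) auto
next
  fix i m assume im: "0 < i \<and> 0 < m \<and> i + m < n"
  have "(\<forall>c\<in>cuts ns. \<not> (m \<le> c \<and> c + i < n)) \<longleftrightarrow> m \<notin> cuts ns \<and> (\<forall>c\<in>cuts ns. \<not> (Suc m \<le> c \<and> c + i < n))"
    using im by (auto simp: Suc_le_eq le_less)
  then show "block_antidiagonal ns i m = (if m \<in> cuts ns then 0 else 1) * block_antidiagonal ns i (Suc m)"
    using im by (subst (1 2) block_antidiagonal_eq) auto
qed

text \<open>In a palindrome the blocks after position \<open>i\<close> have the same sum as equally
  many blocks at the beginning.\<close>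

lemma cuts_palindrome:
  assumes pal: "\<forall>i<length ns. ns ! i = ns ! (length ns - 1 - i)" and m: "m \<in> cuts ns"
  shows "n - 1 - m \<in> cuts ns"
proof -
  have rev: "rev ns = ns"
  proof (rule nth_equalityI)
    fix i assume "i < length (rev ns)"
    then have i: "i < length ns" by simp
    then have "rev ns ! i = ns ! (length ns - 1 - i)" by (simp add: rev_nth)
    also have "\<dots> = ns ! i" using pal[rule_format, OF i] by (rule sym)
    finally show "rev ns ! i = ns ! i" .
  qed simp
  obtain i where i: "0 < i" "i < length ns" "m = P i" using m by (auto simp: cuts_def)
  have "P (length ns - i) = sum_list (take (length ns - i) (rev ns))"
    by (simp add: rev)
  also have "\<dots> = sum_list (drop i ns)"
    using i by (simp add: take_rev)
  also have "\<dots> = n - 1 - m"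
    using total i(3) by (metis append_take_drop_id diff_add_inverse sum_list_append)
  finally show ?thesis
    using i unfolding cuts_def by (intro CollectI exI[of _ "length ns - i"]) auto
qed

text \<open>The reflection \<open>m \<mapsto> n - 1 - m\<close> of the cuts exchanges the conditions
  for \<open>(j, k)\<close> and \<open>(k, j)\<close>.\<close>

lemma block_antidiagonal_sym:
  assumes pal: "\<forall>i<length ns. ns ! i = ns ! (length ns - 1 - i)"
    and j: "0 < j" "j < n" and k: "0 < k" "k < n"
  shows "block_antidiagonal ns j k = block_antidiagonal ns k j"
proof -
  have "\<forall>m\<in>cuts ns. \<not> (k \<le> m \<and> m + j < n)" if *: "\<forall>m\<in>cuts ns. \<not> (j \<le> m \<and> m + k < n)" for j k
  proof
    fix m assume m: "m \<in> cuts ns"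
    then have "n - 1 - m \<in> cuts ns" by (rule cuts_palindrome[OF pal])
    then have "\<not> (j \<le> n - 1 - m \<and> n - 1 - m + k < n)" using * by blast
    then show "\<not> (k \<le> m \<and> m + j < n)" using cuts_bounds[OF m] by auto
  qed
  from this[of j k] this[of k j]
  have "(\<forall>m\<in>cuts ns. \<not> (k \<le> m \<and> m + j < n)) \<longleftrightarrow> (\<forall>m\<in>cuts ns. \<not> (j \<le> m \<and> m + k < n))"
    by blast
  then show ?thesis
    unfolding block_antidiagonal_eq[OF j k] block_antidiagonal_eq[OF k j] by (simp only: add.commute)
qed

text \<open>The first column of a block of size at least 2 lies strictly between two
  boundaries.\<close>

lemma ex_no_cut:
  assumes "m \<in> set ns" "m \<noteq> 1"
  shows "\<exists>c. 0 < c \<and> Suc c < n \<and> c \<notin> cuts ns"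
proof -
  obtain i where i: "i < length ns" "ns ! i = m" using assms by (auto simp: in_set_conv_nth)
  then have m: "2 \<le> m" using pos assms by (metis One_nat_def Suc_1 Suc_leI le_neq_implies_less)
  have le: "P (Suc i) \<le> n - 1" using P_le[of "Suc i" "length ns"] P_length i by simp
  have "Suc (P i) \<notin> cuts ns"
  proof
    assume "Suc (P i) \<in> cuts ns"
    then obtain i' where i': "0 < i'" "i' < length ns" "Suc (P i) = P i'" by (auto simp: cuts_def)
    have "\<not> i' \<le> i" using P_le[of i' i] i i' by auto
    then have "P (Suc i) \<le> P i'" using P_le[of "Suc i" i'] i' by auto
    then show False using i i' m P_Suc[OF i(1)] by simp
  qed
  then show ?thesis
    using le P_Suc[OF i(1)] i m n by (intro exI[of _ "Suc (P i)"]) auto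
qed

end

lemma cuts_all_one:
  assumes "\<forall>m\<in>set ns. m = 1" "0 < m" "m < length ns"
  shows "m \<in> cuts ns"
proof -
  have "take m ns = replicate m 1"
    using assms by (intro replicate_eqI) (auto dest: in_set_takeD)
  then have "sum_list (take m ns) = m" by (simp add: sum_list_replicate)
  then show ?thesis using assms(2,3) unfolding cuts_def by force
qed

text \<open>The list of gaps between consecutive elements of \<open>E\<close> with 0 and
  \<open>N\<close> added. The map \<open>x \<mapsto> N - x\<close> reverses the sorted list of these
  elements, which makes the gaps a palindrome.\<close>

lemma ex_palindrome_cuts:
  assumes E: "E \<subseteq> {0<..<N}" and refl: "\<And>m. m \<in> E \<Longrightarrow> N - m \<in> E" and N: "0 < N"
  shows "\<exists>ns. (\<forall>m\<in>set ns. m > 0) \<and> sum_list ns = N \<and> (\<forall>i<length ns. ns ! i = ns ! (length ns - 1 - i)) \<and> cuts ns = E"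
proof -
  have finE: "finite E" using E finite_subset by blast
  define A where "A = insert 0 (insert N E)"
  define xs where "xs = sorted_list_of_set A"
  have finA: "finite A" using finE by (simp add: A_def)
  have xs: "sorted xs" "distinct xs" "set xs = A"
    by (simp_all add: xs_def finA)
  define L where "L = length xs"
  have less: "xs ! i < xs ! j" if "i < j" "j < L" for i j
    using xs that by (simp add: L_def sorted_wrt_nth_less strict_sorted_iff)
  have "card A = L" using xs by (metis L_def distinct_card)
  moreover have "card A \<ge> card {0, N}"
    using finE by (intro card_mono) (auto simp: A_def)
  ultimately have L: "2 \<le> L" using N by simp
  have le: "x \<le> N" if "x \<in> A" for x using that E by (auto simp: A_def)
  have rev: "rev (map (\<lambda>x. N - x) xs) = xs"
  proof (rule sorted_distinct_set_unique)
    show "sorted (rev (map (\<lambda>x. N - x) xs))"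
      unfolding sorted_rev_iff_nth_mono using xs(1) sorted_nth_mono[of xs] by (auto simp: diff_le_mono2)
    show "distinct (rev (map (\<lambda>x. N - x) xs))"
      using xs(2,3) le by (auto simp: distinct_map intro!: inj_onI) (metis diff_diff_cancel)
    have "(\<lambda>x. N - x) ` A = A"
    proof -
      have "N - x \<in> A" if "x \<in> A" for x using that refl by (auto simp: A_def)
      moreover have "N - (N - x) = x" if "x \<in> A" for x using le[OF that] by simp
      ultimately show ?thesis by (force intro: image_eqI)
    qed
    then show "set (rev (map (\<lambda>x. N - x) xs)) = set xs" by (simp add: xs(3))
  qed (use xs in auto)
  have refl_nth: "xs ! (L - 1 - i) = N - xs ! i" if "i < L" for i
  proof -
    have "xs ! (L - 1 - i) = rev (map (\<lambda>x. N - x) xs) ! (L - 1 - i)" by (simp add: rev)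
    also have "\<dots> = N - xs ! i"
      using that by (simp add: rev_nth L_def Suc_diff_Suc)
    finally show ?thesis .
  qed
  have xs0: "xs ! 0 = 0"
  proof -
    have "0 \<in> set xs" by (simp add: xs(3) A_def)
    then obtain i where i: "i < L" "xs ! i = 0" by (auto simp: in_set_conv_nth L_def)
    then show ?thesis using less[of 0 i] by (cases "i = 0") auto
  qed
  have xsN: "xs ! (L - 1) = N" using refl_nth[of 0] xs0 L by simp
  define ns where "ns = map (\<lambda>i. xs ! Suc i - xs ! i) [0..<L - 1]"
  have len: "length ns = L - 1" by (simp add: ns_def)
  have P: "sum_list (take i ns) = xs ! i" if "i < L" for i
    using that
  proof (induction i)
    case (Suc i)
    then have "i < L - 1" by simp
    then have "ns ! i = xs ! Suc i - xs ! i" by (simp add: ns_def)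
    then have "sum_list (take (Suc i) ns) = xs ! i + (xs ! Suc i - xs ! i)"
      using Suc by (simp add: take_Suc_conv_app_nth len)
    then show ?case using less[of i "Suc i"] Suc by simp
  qed (simp add: xs0)
  have "\<forall>m\<in>set ns. m > 0"
    using less L by (auto simp: ns_def)
  moreover have "sum_list ns = N"
    using P[of "L - 1"] len L xsN by simp
  moreover have "ns ! i = ns ! (length ns - 1 - i)" if "i < length ns" for i
  proof -
    have i: "i < L" "Suc i < L" using that len by auto
    have "ns ! (length ns - 1 - i) = xs ! Suc (L - 1 - 1 - i) - xs ! (L - 1 - 1 - i)"
    proof -
      have "L - 1 - 1 - i < L - 1" using i by auto
      then show ?thesis by (simp add: ns_def)
    qed
    also have "Suc (L - 1 - 1 - i) = L - 1 - i" "L - 1 - 1 - i = L - 1 - Suc i"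
      using i by auto
    then have "xs ! Suc (L - 1 - 1 - i) - xs ! (L - 1 - 1 - i) = (N - xs ! i) - (N - xs ! Suc i)"
      using refl_nth[OF i(1)] refl_nth[OF i(2)] by simp
    also have "\<dots> = xs ! Suc i - xs ! i"
    proof -
      have "xs ! Suc i \<in> A" using i(2) xs(3) nth_mem[of "Suc i" xs] by (simp add: L_def)
      then show ?thesis using le[of "xs ! Suc i"] less[of i "Suc i"] i by simp
    qed
    also have "\<dots> = ns ! i" using that by (simp add: ns_def)
    finally show ?thesis by simp
  qed
  moreover have "cuts ns = E"
  proof (intro set_eqI iffI)
    fix m assume "m \<in> cuts ns"
    then obtain i where i: "0 < i" "i < L - 1" "m = xs ! i" by (auto simp: cuts_def len P)
    then have "m \<in> A" using xs(3) by (auto simp: L_def)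
    moreover have "m \<noteq> 0" "m \<noteq> N"
      using less[of 0 i] less[of i "L - 1"] i xs0 xsN by auto
    ultimately show "m \<in> E" by (simp add: A_def)
  next
    fix m assume m: "m \<in> E"
    then have "m \<in> set xs" by (simp add: xs(3) A_def)
    then obtain i where i: "i < L" "m = xs ! i" by (auto simp: in_set_conv_nth L_def)
    have "m \<noteq> 0" "m \<noteq> N" using m E by auto
    then have "i \<noteq> 0" "i \<noteq> L - 1" using xs0 xsN i by metis+
    then show "m \<in> cuts ns"
      using i P by (auto simp: cuts_def len intro!: exI[of _ i])
  qed
  ultimately show ?thesis by blast
qed

subsection \<open>Classification\<close>

text \<open>One representative for each value of \<open>f\<close> already reaches every
  class.\<close>

lemma card_quotient_le:
  assumes B: "finite B" "f ` M \<subseteq> B"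
    and f: "\<And>x y. x \<in> M \<Longrightarrow> y \<in> M \<Longrightarrow> f x = f y \<Longrightarrow> R `` {x} = R `` {y}"
  shows "finite (M // R) \<and> card (M // R) \<le> card B"
proof -
  have "M // R \<subseteq> (\<lambda>b. R `` {SOME x. x \<in> M \<and> f x = b}) ` B"
  proof
    fix C assume "C \<in> M // R"
    then obtain x where x: "x \<in> M" "C = R `` {x}" by (rule quotientE)
    let ?y = "SOME y. y \<in> M \<and> f y = f x"
    have "?y \<in> M \<and> f ?y = f x" by (rule someI[of "\<lambda>y. y \<in> M \<and> f y = f x" x]) (simp add: x(1))
    then have "C = R `` {?y}" using f[of x ?y] x by simp
    then show "C \<in> (\<lambda>b. R `` {SOME x. x \<in> M \<and> f x = b}) ` B"
      using B(2) x(1) by (intro image_eqI[of _ _ "f x"]) auto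
  qed
  then show ?thesis
    using surj_card_le[OF B(1)] finite_surj[OF B(1)] by blast
qed

context tube
begin

lemma block_antidiagonal_sym_coef:
  assumes "\<forall>m\<in>set ns. m > 0" "sum_list ns = n - 1" "\<forall>i<length ns. ns ! i = ns ! (length ns - 1 - i)"
  shows "sym_coef (block_antidiagonal ns)"
  unfolding sym_coef_def
  using block_antidiagonal_sym[OF assms(1,2) n_gt assms(3)] by auto

lemma column_chain_reflect_zero:
  assumes S: "sym_coef S" and r: "column_chain n S r" and m: "0 < m" "Suc m < n"
  shows "r (n - 1 - m) = 0 \<longleftrightarrow> r m = 0"
  using column_chain_reflect(2)[OF r _ m] S by (simp add: sym_coef_def)

lemma nondeg_chain_normal_form:
  assumes S: "sym_coef S" and r: "nondeg_chain S r"
  shows "\<exists>ns. (\<forall>m\<in>set ns. m > 0) \<and> sum_list ns = n - 1 \<and>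
    (\<forall>i<length ns. ns ! i = ns ! (length ns - 1 - i)) \<and> (\<exists>m\<in>set ns. m \<noteq> 1) \<and>
    locally_equivalent (hypersurface e n S) (hypersurface e n (block_antidiagonal ns))"
proof -
  have chain: "column_chain n S r" using r by (simp add: nondeg_chain_def)
  \<comment> \<open>The zeros of \<open>r\<close> become the cuts, so that both matrices have zero
    ratios in the same places.\<close>
  define E where "E = {m. 0 < m \<and> Suc m < n \<and> r m = 0}"
  have "n - 1 - m \<in> E" if "m \<in> E" for m
    using that column_chain_reflect_zero[OF S chain, of m] by (auto simp: E_def)
  moreover have "E \<subseteq> {0<..<n - 1}" "0 < n - 1" using n_gt by (auto simp: E_def)
  ultimately obtain ns where ns: "\<forall>m\<in>set ns. m > 0" "sum_list ns = n - 1"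
      "\<forall>i<length ns. ns ! i = ns ! (length ns - 1 - i)" "cuts ns = E"
    using ex_palindrome_cuts[of E "n - 1"] by blast
  have "\<exists>m\<in>set ns. m \<noteq> 1"
  proof (rule ccontr)
    assume "\<not> (\<exists>m\<in>set ns. m \<noteq> 1)"
    then have one: "\<forall>m\<in>set ns. m = 1" by blast
    then have "sum_list ns = length ns" by (induction ns) auto
    moreover obtain m where m: "0 < m" "Suc m < n" "r m \<noteq> 0" using r by (auto simp: nondeg_chain_def)
    ultimately have "m \<in> cuts ns" using cuts_all_one[OF one, of m] ns(2) by simp
    then show False using m(3) by (simp add: ns(4) E_def)
  qed
  moreover have "locally_equivalent (hypersurface e n S) (hypersurface e n (block_antidiagonal ns))"
    by (rule locally_equivalent_chain[OF S chain block_antidiagonal_sym_coef[OF ns(1-3)]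
          block_antidiagonal_chain[OF ns(1,2) n_gt]]) (auto simp: ns(4) E_def)
  ultimately show ?thesis using ns by blast
qed

text \<open>A block of size other than 1 leaves a column that is not a cut, hence a nonzero ratio;
  biholomorphic invariance carries this over to \<open>S\<close>.\<close>

lemma nondeg_chain_of_normal_form:
  assumes S: "sym_coef S"
    and ns: "\<forall>m\<in>set ns. m > 0" "sum_list ns = n - 1" "\<forall>i<length ns. ns ! i = ns ! (length ns - 1 - i)"
      "\<exists>m\<in>set ns. m \<noteq> 1"
    and equiv: "locally_equivalent (hypersurface e n S) (hypersurface e n (block_antidiagonal ns))"
  shows "\<exists>r. nondeg_chain S r"
proof -
  obtain F G U V where "germ_iso S (block_antidiagonal ns) F G U V"
    using locally_equivalent_germ_iso[OF equiv] by blast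
  moreover have "\<exists>c. 0 < c \<and> Suc c < n \<and> c \<notin> cuts ns"
    using ex_no_cut[OF ns(1,2) n_gt] ns(4) by blast
  then have "nondeg_chain (block_antidiagonal ns) (\<lambda>m. if m \<in> cuts ns then 0 else 1)"
    using block_antidiagonal_chain[OF ns(1,2) n_gt] by (auto simp: nondeg_chain_def)
  ultimately show ?thesis
    using nondeg_chain_invariant[OF _ S block_antidiagonal_sym_coef[OF ns(1-3)]] by blast
qed

lemma card_classes:
  assumes M: "\<M> = {M. \<exists>S. sym_coef S \<and> M = hypersurface e n S \<and> (\<exists>r. nondeg_chain S r)}"
    and R: "R = {(M, M'). M \<in> \<M> \<and> M' \<in> \<M> \<and> locally_equivalent M M'}"
  shows "finite (\<M> // R) \<and> card (\<M> // R) \<le> 2 ^ ((n - 1) div 2) - 1"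
proof -
  define p where "p = (n - 1) div 2"
  have "\<forall>M\<in>\<M>. \<exists>S r. sym_coef S \<and> M = hypersurface e n S \<and> nondeg_chain S r"
    using M by blast
  then obtain S r where Sr: "\<And>M. M \<in> \<M> \<Longrightarrow> sym_coef (S M)" "\<And>M. M \<in> \<M> \<Longrightarrow> M = hypersurface e n (S M)"
      "\<And>M. M \<in> \<M> \<Longrightarrow> nondeg_chain (S M) (r M)"
    by metis
  have chain: "column_chain n (S M) (r M)" if "M \<in> \<M>" for M
    using Sr(3)[OF that] by (simp add: nondeg_chain_def)
  \<comment> \<open>\<open>{1..p}\<close> meets every orbit of \<open>m \<mapsto> n - 1 - m\<close>
    on \<open>{1..n - 2}\<close>, so this set determines where all ratios vanish. It is never empty,
    which accounts for the subtracted 1.\<close>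
  define f where "f M = {m \<in> {1..p}. r M m \<noteq> 0}" for M
  have half: "m \<in> {1..p} \<or> n - 1 - m \<in> {1..p}" if "0 < m" "Suc m < n" for m
    using that by (auto simp: p_def)
  have f_ne: "f M \<noteq> {}" if M: "M \<in> \<M>" for M
  proof -
    obtain m where m: "0 < m" "Suc m < n" "r M m \<noteq> 0"
      using Sr(3)[OF M] by (auto simp: nondeg_chain_def)
    then show ?thesis
      using half[OF m(1,2)] column_chain_reflect_zero[OF Sr(1)[OF M] chain[OF M] m(1,2)]
      unfolding f_def by blast
  qed
  have equiv: "locally_equivalent M M'" if M: "M \<in> \<M>" "M' \<in> \<M>" and eq: "f M = f M'" for M M'
  proof -
    have "r M m = 0 \<longleftrightarrow> r M' m = 0" if m: "0 < m" "Suc m < n" for m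
    proof -
      have "r M i = 0 \<longleftrightarrow> r M' i = 0" if "i \<in> {1..p}" for i
        using eq that unfolding f_def by blast
      then show ?thesis
        using half[OF m] column_chain_reflect_zero[OF Sr(1)[OF M(1)] chain[OF M(1)] m]
          column_chain_reflect_zero[OF Sr(1)[OF M(2)] chain[OF M(2)] m] by blast
    qed
    then have "locally_equivalent (hypersurface e n (S M)) (hypersurface e n (S M'))"
      by (rule locally_equivalent_chain[OF Sr(1)[OF M(1)] chain[OF M(1)] Sr(1)[OF M(2)] chain[OF M(2)]])
    then show ?thesis
      using Sr(2) M by simp
  qed
  have "finite (\<M> // R) \<and> card (\<M> // R) \<le> card (Pow {1..p} - {{}})"
  proof (rule card_quotient_le[where f = f])
    show "f ` \<M> \<subseteq> Pow {1..p} - {{}}"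
      using f_ne by (auto simp: f_def)
    fix M M' assume M: "M \<in> \<M>" "M' \<in> \<M>" "f M = f M'"
    have MM': "locally_equivalent M M'" by (rule equiv[OF M])
    show "R `` {M} = R `` {M'}"
      using M(1,2) locally_equivalent_trans[OF MM'] locally_equivalent_trans[OF locally_equivalent_sym[OF MM']]
      unfolding R by blast
  qed simp
  moreover have "card (Pow {1..p} - {{}}) = 2 ^ p - 1"
    by (simp add: card_Pow)
  ultimately show ?thesis by (simp add: p_def)
qed

end

text \<open>Both sides count the orbits of \<open>m \<mapsto> n - 1 - m\<close> on
  \<open>{1..n - 2}\<close>.\<close>

lemma ceiling_half: "2 < n \<Longrightarrow> nat \<lceil>(real n - 2) / 2\<rceil> = (n - 1) div 2"
proof -
  assume n: "2 < n"
  have "\<lceil>(real n - 2) / 2\<rceil> = int ((n - 1) div 2)"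
  proof (cases "even n")
    case True
    then obtain k where "n = 2 * k" by blast
    then show ?thesis using n by (intro ceiling_unique) auto
  next
    case False
    then obtain k where "n = 2 * k + 1" by (blast elim: oddE)
    then show ?thesis using n by (intro ceiling_unique) auto
  qed
  then show ?thesis by simp
qed

theorem theorem5p3:
  fixes n :: nat and e :: "nat \<Rightarrow> 'm::finite"
  assumes "n > 2" and "bij_betw e {0..n} UNIV"
  shows "(\<forall>S. symmetric_matrix n S \<longrightarrow>
      (uniformly_2_nondegenerate (hypersurface e n S) \<and> levi_kernel_rank (hypersurface e n S) 1 \<longleftrightarrow>
       (\<exists>ns. (\<forall>m\<in>set ns. m > 0) \<and> sum_list ns = n - 1 \<and>
          (\<forall>i<length ns. ns ! i = ns ! (length ns - 1 - i)) \<and> (\<exists>m\<in>set ns. m \<noteq> 1) \<and>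
          locally_equivalent (hypersurface e n S) (hypersurface e n (block_antidiagonal ns))))) \<and>
    (let \<M> = {M. \<exists>S. symmetric_matrix n S \<and> M = hypersurface e n S \<and>
                uniformly_2_nondegenerate M \<and> levi_kernel_rank M 1};
         classes = \<M> // {(M, M'). M \<in> \<M> \<and> M' \<in> \<M> \<and> locally_equivalent M M'};
         p = nat \<lceil>(real n - 2) / 2\<rceil>
     in finite classes \<and> card classes \<le> 2 ^ p - 1)"
proof -
  interpret tube n e
    using assms by unfold_locales
  have "uniformly_2_nondegenerate (hypersurface e n S) \<and> levi_kernel_rank (hypersurface e n S) 1 \<longleftrightarrow>
       (\<exists>ns. (\<forall>m\<in>set ns. m > 0) \<and> sum_list ns = n - 1 \<and>
          (\<forall>i<length ns. ns ! i = ns ! (length ns - 1 - i)) \<and> (\<exists>m\<in>set ns. m \<noteq> 1) \<and>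
          locally_equivalent (hypersurface e n S) (hypersurface e n (block_antidiagonal ns)))"
    if "symmetric_matrix n S" for S
  proof -
    have S: "sym_coef S" using that by (simp add: sym_coef_iff)
    show ?thesis
      unfolding nondegenerate_iff[OF S]
      using nondeg_chain_normal_form[OF S] nondeg_chain_of_normal_form[OF S] by blast
  qed
  moreover have "{M. \<exists>S. symmetric_matrix n S \<and> M = hypersurface e n S \<and>
        uniformly_2_nondegenerate M \<and> levi_kernel_rank M 1}
      = {M. \<exists>S. sym_coef S \<and> M = hypersurface e n S \<and> (\<exists>r. nondeg_chain S r)}"
  proof (intro Collect_cong ex_cong1)
    fix M S
    show "symmetric_matrix n S \<and> M = hypersurface e n S \<and> uniformly_2_nondegenerate M \<and> levi_kernel_rank M 1 \<longleftrightarrow>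
        sym_coef S \<and> M = hypersurface e n S \<and> (\<exists>r. nondeg_chain S r)"
      using nondegenerate_iff[of S] by (simp only: sym_coef_iff) blast
  qed
  ultimately show ?thesis
    using card_classes[OF refl refl] by (simp only: Let_def ceiling_half[OF assms(1)] simp_thms) blast
qed

end
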